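(* Let $T_n$ be a uniformly random labelled tree on the vertex set $[n]$, and let $m_n(z)$ be the Stieltjes transform of the empirical spectral measure of its adjacency matrix $A(T_n)$. Then: (i) There exists a unique probability measure $R$ on $\mathcal H$ such that for all $z\in\mathbb C_+$, $$X(z)\stackrel{d}{=}\big(W(z)^{-1}-X_1(z)\big)^{-1},$$ where $X$, $X_1$ have law $R$, $W$ and $X_1$ are independent, and $W(z)$ is the diagonal entry at the root $v_0$ of the resolvent $(A(T_0)-zI)^{-1}$ of a Galton–Watson tree $T_0$ with Poisson(1) offspring distribution. (ii) For all $z\in\mathbb C_+$, $m_n(z)$ converges in $L^1$ as $n\to\infty$ to $\mathbb E X(z)$.
   Context: $\mathbb C_+=\{z:\Im z>0\}$; $\mathcal H$ is the set of holomorphic $f:\mathbb C_+\to\mathbb C_+$ with $|f(z)|\le1/\Im z$, with the topology of uniform convergence on compact sets. The Stieltjes transform of a probability measure $\mu$ on $\mathbb R$ is $\int(x-z)^{-1}d\mu(x)$. A Galton–Watson tree with Poisson(1) offspring distribution is the family tree of a branching process in which each vertex independently has a Poisson(1) number of children; $A(T_0)$ denotes its adjacency operator on $\ell^2$ of its vertex set. Equivalently, $W$ is a random element of $\mathcal H$ whose law is the unique fixed point $Q$ with $W(z)\stackrel d=-\big(z+\sum_{i=1}^N W_i(z)\big)^{-1}$, $N\sim$ Poisson(1), $W_i$ i.i.d. copies of $W$ independent of $N$. *)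

theory Defs
  imports "HOL-Probability.Probability" "Jordan_Normal_Form.Char_Poly"
begin

definition upper_half :: "complex set" ("\<complex>\<^sub>+") where
  "upper_half = {z. Im z > 0}"

text \<open>Elements of H are holomorphic f : C+ -> C+ with |f z| <= 1 / Im z.  Functions are
  represented as total functions complex => complex, normalised to 0 off C+.\<close>
definition H_set :: "(complex \<Rightarrow> complex) set" where
  "H_set = {f. f holomorphic_on \<complex>\<^sub>+ \<and>
                (\<forall>z\<in>\<complex>\<^sub>+. 0 < Im (f z) \<and> cmod (f z) \<le> 1 / Im z) \<and>
                (\<forall>z. z \<notin> \<complex>\<^sub>+ \<longrightarrow> f z = 0)}"

definition H_open :: "(complex \<Rightarrow> complex) set \<Rightarrow> bool" where
  "H_open U \<longleftrightarrow> U \<subseteq> H_set \<and>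
     (\<forall>f\<in>U. \<exists>K e. compact K \<and> K \<subseteq> \<complex>\<^sub>+ \<and> 0 < e \<and>
                   {g\<in>H_set. \<forall>z\<in>K. cmod (g z - f z) < e} \<subseteq> U)"

definition H_borel :: "(complex \<Rightarrow> complex) measure" where
  "H_borel = sigma H_set {U. H_open U}"

definition prob_on_H :: "(complex \<Rightarrow> complex) measure \<Rightarrow> bool" where
  "prob_on_H P \<longleftrightarrow> prob_space P \<and> sets P = sets H_borel"

definition GW_resolvent_fixed_point :: "(complex \<Rightarrow> complex) measure \<Rightarrow> bool" where
  "GW_resolvent_fixed_point Q \<longleftrightarrow> prob_on_H Q \<and>
     Q = distr (measure_pmf (poisson_pmf 1) \<Otimes>\<^sub>M (\<Pi>\<^sub>M i\<in>(UNIV::nat set). Q)) H_borel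
           (\<lambda>(k, ws). \<lambda>z. if z \<in> \<complex>\<^sub>+ then - 1 / (z + (\<Sum>i<k. ws i z)) else 0)"

definition X_fixed_point ::
  "(complex \<Rightarrow> complex) measure \<Rightarrow> (complex \<Rightarrow> complex) measure \<Rightarrow> bool" where
  "X_fixed_point Q R \<longleftrightarrow> prob_on_H R \<and>
     R = distr (Q \<Otimes>\<^sub>M R) H_borel
           (\<lambda>(w, x). \<lambda>z. if z \<in> \<complex>\<^sub>+ then 1 / (1 / w z - x z) else 0)"

text \<open>Simple graphs on the vertex set {0..<n} (labels [n] shifted by one), given by edge sets.\<close>
definition connected_in :: "nat set set \<Rightarrow> nat \<Rightarrow> nat \<Rightarrow> bool" where
  "connected_in E u v \<longleftrightarrow> (\<lambda>a b. {a, b} \<in> E)\<^sup>*\<^sup>* u v"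

definition is_labelled_tree :: "nat \<Rightarrow> nat set set \<Rightarrow> bool" where
  "is_labelled_tree n E \<longleftrightarrow>
     E \<subseteq> {{i, j} | i j. i < n \<and> j < n \<and> i \<noteq> j} \<and>
     (\<forall>u<n. \<forall>v<n. connected_in E u v) \<and>
     (\<forall>u v. {u, v} \<in> E \<longrightarrow> \<not> connected_in (E - {{u, v}}) u v)"

definition labelled_trees :: "nat \<Rightarrow> nat set set set" where
  "labelled_trees n = {E. is_labelled_tree n E}"

definition uniform_random_tree :: "nat \<Rightarrow> nat set set pmf" where
  "uniform_random_tree n = pmf_of_set (labelled_trees n)"

definition adjacency_matrix :: "nat \<Rightarrow> nat set set \<Rightarrow> complex mat" where
  "adjacency_matrix n E = mat n n (\<lambda>(i, j). if {i, j} \<in> E then 1 else 0)"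

text \<open>Stieltjes transform of the empirical spectral measure (1/n) sum_i delta_{lambda_i} of an
  n x n matrix: eigenvalues counted with (algebraic) multiplicity, i.e. roots of the
  characteristic polynomial with their orders.\<close>
definition esm_stieltjes :: "complex mat \<Rightarrow> complex \<Rightarrow> complex" where
  "esm_stieltjes A z =
     (1 / of_nat (dim_row A)) *
     (\<Sum>e\<in>{e. eigenvalue A e}. of_nat (order e (char_poly A)) / (e - z))"

definition m_n :: "nat \<Rightarrow> nat set set \<Rightarrow> complex \<Rightarrow> complex" where
  "m_n n E z = esm_stieltjes (adjacency_matrix n E) z"

end

theory Submission
  imports Defs "HOL-Complex_Analysis.Complex_Analysis" "HOL-Real_Asymp.Real_Asymp"
    "HOL-Combinatorics.Multiset_Permutations"
begin

text \<open>
  Write \<open>T w x = 1 / (1 / w - x)\<close>.  By Julia's lemma every \<open>w\<close> in \<open>H\<close> satisfies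
  \<open>Im (- 1 / w z) \<ge> Im z\<close>, so \<open>T w\<close> maps \<open>H\<close> to itself and contracts by \<open>1 / (Im z)\<^sup>2\<close>.  On the
  line \<open>Im z = 3\<close> this makes \<open>T W\<^sub>0 (T W\<^sub>1 (T W\<^sub>2 \<dots>))\<close> converge, and Montel's theorem extends the
  convergence to the half-plane; the law of the limit is the unique fixed point \<open>R\<close>.

  A critical Galton--Watson tree is finite, so \<open>Q\<close> is the law of \<open>W\<^sub>t\<close> for a random finite
  unordered tree \<open>t\<close>, taken with probability \<open>p(t) = exp (- size t) / aut t\<close>.  Gaussian
  elimination from the leaves gives \<open>det (z - A) = \<Prod>\<^sub>v (- 1 / W\<^sub>v z)\<close>, where \<open>W\<^sub>v\<close> belongs to the
  subtree of descendants of \<open>v\<close> (the tree being rooted at \<open>0\<close>), hence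
  \<open>m\<^sub>n(z) = (1 / n) \<Sum>\<^sub>v W\<^sub>v'(z) / W\<^sub>v(z)\<close> is an average over descendant subtrees.  By exact first
  and second moment counts the proportion of vertices whose descendant subtree has shape \<open>t\<close>
  tends to \<open>p(t)\<close> in \<open>L\<^sup>2\<close>, so \<open>m\<^sub>n(z)\<close> tends to \<open>E [W'(z) / W(z)]\<close> in \<open>L\<^sup>1\<close>.  Finally
  \<open>E [W' / W] = E X\<close>: with \<open>\<phi>(x) = E [1 / (1 / X - x)]\<close>, apply the Mecke formula to
  \<open>E [\<phi>(W) W']\<close> and use the fixed point equation of \<open>R\<close>.
\<close>

section \<open>Holomorphic self-maps of the upper half-plane\<close>

text \<open>Julia's lemma makes \<open>T w\<close> usable: Im (1 / w z - x) <= - Im z for every x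
  with Im x >= 0, so \<open>T w x\<close> obeys the bounds of H without loss. The contraction is
  strict only where Im z > 1; the line Im z = 3, with factor 1/9, is one choice, and it contains a
  sequence converging inside the half-plane, which is enough to control elements of H everywhere.
  The tree is finite at criticality because s = exp (s - 1) has 1 as its only real solution; there
  is equality of laws only after all heights have been exhausted, so Q is first compared with trees
  of bounded height. The weight exp (- size) / aut ties both halves together. Adding a subtree t at
  the root multiplies \<open>aut\<close> by \<open>aut t\<close> and by the new multiplicity of t.
  This recursion yields the Mecke formula, and it also yields the number (size - 1)! / aut of
  labelled trees with given shape and root. The factor exp (- size) comes from the limit of (1 -
  size / n)^n in the counts, so descendant subtrees have limiting frequencies p(t). Rooting at 0 is
  an arbitrary choice and costs one vertex out of n.\<close>

lemma in_upper_half [simp]: "z \<in> \<complex>\<^sub>+ \<longleftrightarrow> 0 < Im z"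
  by (simp add: upper_half_def)

lemma open_upper_half: "open \<complex>\<^sub>+"
  by (simp add: upper_half_def open_halfspace_Im_gt)

lemma connected_upper_half: "connected \<complex>\<^sub>+"
  by (simp add: upper_half_def convex_halfspace_Im_gt convex_connected)

text \<open>Turns the pseudo-hyperbolic distance |z - a| / |z - cnj a| of the half-plane into an
  expression without conjugates.\<close>

lemma cmod_diff_cnj_sq: "(cmod (z - cnj a))\<^sup>2 = (cmod (z - a))\<^sup>2 + 4 * Im z * Im a"
  unfolding cmod_power2 by (simp add: power2_eq_square algebra_simps)

text \<open>Schwarz's lemma for \<open>F\<close>, which is \<open>h\<close> between two Cayley
  transforms sending \<open>a\<close> and \<open>h a\<close> to 0; \<open>k\<close> is the inverse
  of the first, z -> (z - a) / (z - cnj a). The squared form without denominators survives both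
  limits needed later, z -> a and z -> infinity.\<close>

lemma Schwarz_Pick_upper_half:
  assumes hol: "h holomorphic_on \<complex>\<^sub>+" and pos: "\<And>z. 0 < Im z \<Longrightarrow> 0 < Im (h z)"
    and z: "0 < Im z" and a: "0 < Im a"
  shows "(cmod (h z - h a))\<^sup>2 * (Im z * Im a) \<le> (cmod (z - a))\<^sup>2 * (Im (h z) * Im (h a))"
proof -
  define k where "k = (\<lambda>u. (a - cnj a * u) / (1 - u))"
  define F where "F = (\<lambda>u. (h (k u) - h a) / (h (k u) - cnj (h a)))"
  have ne1: "u \<noteq> 1" if "cmod u < 1" for u using that by auto
  have ne_cnj: "w - cnj b \<noteq> 0" if "0 < Im w" "0 < Im b" for w b
    using that by (auto simp: complex_eq_iff)
  have lt1: "cmod ((w - b) / (w - cnj b)) < 1" if "0 < Im w" "0 < Im b" for w b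
  proof -
    have "(cmod (w - b))\<^sup>2 < (cmod (w - cnj b))\<^sup>2"
      using that by (simp add: cmod_diff_cnj_sq)
    hence "cmod (w - b) < cmod (w - cnj b)"
      by (rule power_less_imp_less_base) simp
    thus ?thesis using ne_cnj[OF that] by (simp add: norm_divide divide_simps)
  qed
  have Imk: "0 < Im (k u)" if u: "cmod u < 1" for u
  proof -
    have "Im (k u) = Im ((a - cnj a * u) * cnj (1 - u)) / (cmod (1 - u))\<^sup>2"
      unfolding k_def by (simp add: complex_div_cnj[of "a - cnj a * u"] Im_divide_of_real
          flip: of_real_power)
    also have "Im ((a - cnj a * u) * cnj (1 - u)) = Im a * (1 - (cmod u)\<^sup>2)"
      unfolding cmod_power2 by (simp add: power2_eq_square algebra_simps)
    also have "\<dots> / (cmod (1 - u))\<^sup>2 > 0"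
      using a u ne1[OF u] by (simp add: power_less_one_iff)
    finally show ?thesis .
  qed
  have "F holomorphic_on ball 0 1"
  proof -
    have "k holomorphic_on ball 0 1"
      unfolding k_def by (intro holomorphic_intros) (use ne1 in auto)
    hence "(h \<circ> k) holomorphic_on ball 0 1"
      by (rule holomorphic_on_compose_gen[OF _ hol]) (use Imk in auto)
    thus ?thesis unfolding F_def o_def
      by (intro holomorphic_intros) (use ne_cnj pos Imk a in auto)
  qed
  moreover have "F 0 = 0" by (simp add: F_def k_def)
  moreover have "cmod (F u) < 1" if "cmod u < 1" for u
    unfolding F_def by (rule lt1) (use that Imk pos a in auto)
  moreover define u where "u = (z - a) / (z - cnj a)"
  moreover have u1: "cmod u < 1" unfolding u_def by (rule lt1[OF z a])
  ultimately have le: "cmod (F u) \<le> cmod u"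
    using Schwarz_Lemma(1)[of F u] by blast
  have ne: "z - cnj a \<noteq> 0" "a - cnj a \<noteq> 0" using ne_cnj z a by auto
  have u1': "1 - u = (a - cnj a) / (z - cnj a)" 
    unfolding u_def using ne by (simp add: divide_simps)
  have u2': "a - cnj a * u = z * (a - cnj a) / (z - cnj a)" 
    unfolding u_def using ne by (simp add: divide_simps) (simp add: algebra_simps)
  have "k u = z" unfolding k_def u1' u2' using ne by simp
  hence "cmod (h z - h a) / cmod (h z - cnj (h a)) \<le> cmod (z - a) / cmod (z - cnj a)"
    using le by (simp add: F_def u_def norm_divide)
  hence "cmod (h z - h a) * cmod (z - cnj a) \<le> cmod (z - a) * cmod (h z - cnj (h a))"
    using ne ne_cnj[of "h z" "h a"] pos z a by (simp add: divide_simps)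
  hence "(cmod (h z - h a) * cmod (z - cnj a))\<^sup>2 \<le> (cmod (z - a) * cmod (h z - cnj (h a)))\<^sup>2"
    by (intro power_mono) auto
  thus ?thesis by (simp add: power_mult_distrib cmod_diff_cnj_sq algebra_simps)
qed

lemma H_setD:
  assumes "f \<in> H_set"
  shows "f holomorphic_on \<complex>\<^sub>+" "\<And>z. 0 < Im z \<Longrightarrow> 0 < Im (f z)"
    "\<And>z. 0 < Im z \<Longrightarrow> cmod (f z) \<le> 1 / Im z" "\<And>z. Im z \<le> 0 \<Longrightarrow> f z = 0"
    "\<And>z. 0 < Im z \<Longrightarrow> f z \<noteq> 0"
proof -
  show "f z \<noteq> 0" if "0 < Im z" for z
  proof
    assume "f z = 0"
    moreover have "0 < Im (f z)" using assms that by (auto simp: H_set_def)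
    ultimately show False by simp
  qed
qed (use assms in \<open>auto simp: H_set_def\<close>)

lemma Im_neg_inverse: "Im (- 1 / w) = Im w / (cmod w)\<^sup>2"
  by (simp add: Im_divide cmod_power2)

text \<open>Julia's lemma at infinity: let the second point in the Schwarz--Pick inequality for
  \<open>- 1 / w\<close> tend to \<open>\<i>\<infinity>\<close>.\<close>
lemma H_set_Im_neg_inverse_ge:
  assumes w: "w \<in> H_set" and z: "0 < Im z"
  shows "Im z \<le> Im (- 1 / w z)"
proof -
  define h where "h = (\<lambda>z. - 1 / w z)"
  have hol: "h holomorphic_on \<complex>\<^sub>+"
    unfolding h_def using H_setD[OF w] by (intro holomorphic_intros) auto
  have pos: "0 < Im (h v)" if "0 < Im v" for v
    using H_setD[OF w] that by (simp add: h_def Im_neg_inverse[simplified])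
  \<comment> \<open>The decay of \<open>w\<close> enters here: it forces \<open>h\<close> to grow at
    least like Im v, hence along the imaginary axis.\<close>
  have big: "Im v \<le> cmod (h v)" if "0 < Im v" for v
  proof -
    have "cmod (w v) \<le> 1 / Im v" "0 < cmod (w v)" using H_setD[OF w] that by auto
    hence "Im v \<le> 1 / cmod (w v)" using that by (simp add: field_simps)
    thus ?thesis by (simp add: h_def norm_divide)
  qed
  \<comment> \<open>Schwarz-Pick between z and iy, with b = h (iy) unknown. Since Im b <= |b| and |h
    z - b|^2 >= |b| (|b| - 2 |h z|), the factor |b| cancels, and |b| >= y leaves a bound in y
    alone.\<close>
  have ineq: "Im z * (1 - 2 * cmod (h z) / y) \<le> Im (h z) * (1 + cmod z / y)\<^sup>2"
    if y: "y > 0" "y \<ge> cmod (h z)" for y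
  proof -
    define b where "b = h (\<i> * of_real y)"
    have bpos: "0 < Im b" "y \<le> cmod b" using pos[of "\<i> * of_real y"] big[of "\<i> * of_real y"] y by (auto simp: b_def)
    have "(cmod (h z - b))\<^sup>2 * (Im z * y) \<le> (cmod (z - \<i> * of_real y))\<^sup>2 * (Im (h z) * Im b)"
      using Schwarz_Pick_upper_half[OF hol pos z, of "\<i> * of_real y"] y by (simp add: b_def)
    also have "\<dots> \<le> (y + cmod z)\<^sup>2 * (Im (h z) * cmod b)"
      using bpos pos[OF z] y norm_triangle_ineq4[of z "\<i> * of_real y"] abs_Im_le_cmod[of b]
      by (intro mult_mono power_mono mult_left_mono) (auto simp: norm_mult)
    finally have 1: "(cmod (h z - b))\<^sup>2 * (Im z * y) \<le> (y + cmod z)\<^sup>2 * (Im (h z) * cmod b)" .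
    have "cmod b * (y - 2 * cmod (h z)) \<le> cmod b * (cmod b - 2 * cmod (h z))"
      using bpos by (intro mult_left_mono) auto
    also have "\<dots> \<le> (cmod b - cmod (h z))\<^sup>2" by (simp add: power2_eq_square algebra_simps)
    also have "\<dots> \<le> (cmod (h z - b))\<^sup>2"
      using norm_triangle_ineq3[of b "h z"]
      by (subst abs_le_square_iff[symmetric]) (simp add: norm_minus_commute)
    finally have "cmod b * (y - 2 * cmod (h z)) * (Im z * y) \<le> (cmod (h z - b))\<^sup>2 * (Im z * y)"
      using z y by (intro mult_right_mono) auto
    with 1 have "cmod b * ((y - 2 * cmod (h z)) * (Im z * y)) \<le> cmod b * ((y + cmod z)\<^sup>2 * Im (h z))"
      by (simp add: mult_ac)
    hence "(y - 2 * cmod (h z)) * (Im z * y) \<le> (y + cmod z)\<^sup>2 * Im (h z)"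
      using bpos y by (subst (asm) mult_le_cancel_left_pos) auto
    hence "(y - 2 * cmod (h z)) * (Im z * y) / y\<^sup>2 \<le> (y + cmod z)\<^sup>2 * Im (h z) / y\<^sup>2"
      by (intro divide_right_mono) auto
    also have "(y - 2 * cmod (h z)) * (Im z * y) / y\<^sup>2 = Im z * (1 - 2 * cmod (h z) / y)"
      using y by (simp add: field_simps power2_eq_square)
    also have "(y + cmod z)\<^sup>2 * Im (h z) / y\<^sup>2 = Im (h z) * (1 + cmod z / y)\<^sup>2"
      using y by (simp add: field_simps power2_eq_square)
    finally show ?thesis .
  qed
  have "((\<lambda>y. Im z * (1 - 2 * cmod (h z) / y)) \<longlongrightarrow> Im z * (1 - 0)) at_top"
    by real_asymp
  moreover have "((\<lambda>y. Im (h z) * (1 + cmod z / y)\<^sup>2) \<longlongrightarrow> Im (h z) * (1 + 0)\<^sup>2) at_top"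
    by real_asymp
  moreover have "\<forall>\<^sub>F y in at_top. Im z * (1 - 2 * cmod (h z) / y) \<le> Im (h z) * (1 + cmod z / y)\<^sup>2"
    using eventually_gt_at_top[of "0::real"] eventually_ge_at_top[of "cmod (h z)"]
    by eventually_elim (rule ineq)
  ultimately have "Im z * (1 - 0) \<le> Im (h z) * (1 + 0)\<^sup>2"
    by (intro tendsto_le[OF trivial_limit_at_top_linorder])
  thus ?thesis by (simp add: h_def)
qed

text \<open>Infinitesimal Schwarz-Pick: divide by |z - a|^2 and let z -> a. It is the source of
  every bound on W'.\<close>

lemma cmod_deriv_le_upper_half:
  assumes hol: "h holomorphic_on \<complex>\<^sub>+" and pos: "\<And>z. 0 < Im z \<Longrightarrow> 0 < Im (h z)"
    and a: "0 < Im a"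
  shows "cmod (deriv h a) \<le> Im (h a) / Im a"
proof -
  have der: "(h has_field_derivative deriv h a) (at a)"
    using holomorphic_derivI[OF hol open_upper_half] a by simp
  hence lim: "((\<lambda>z. (cmod ((h z - h a) / (z - a)))\<^sup>2 * (Im z * Im a)) \<longlongrightarrow> (cmod (deriv h a))\<^sup>2 * (Im a * Im a)) (at a)"
    by (intro tendsto_intros) (auto simp: has_field_derivative_iff)
  have "isCont h a" using der by (rule DERIV_isCont)
  hence lim2: "((\<lambda>z. Im (h z) * Im (h a)) \<longlongrightarrow> Im (h a) * Im (h a)) (at a)"
    by (intro tendsto_intros) (auto simp: isCont_def)
  have "\<forall>\<^sub>F z in at a. z \<in> \<complex>\<^sub>+" using open_upper_half a by (intro eventually_at_in_open') auto
  moreover have "\<forall>\<^sub>F z in at a. z \<noteq> a" by (simp add: eventually_at_filter)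
  ultimately have "\<forall>\<^sub>F z in at a. (cmod ((h z - h a) / (z - a)))\<^sup>2 * (Im z * Im a) \<le> Im (h z) * Im (h a)"
  proof eventually_elim
    case (elim z)
    have "(cmod (h z - h a))\<^sup>2 * (Im z * Im a) \<le> (cmod (z - a))\<^sup>2 * (Im (h z) * Im (h a))"
      using Schwarz_Pick_upper_half[OF hol pos _ a, of z] elim by auto
    thus ?case using elim by (simp add: norm_divide power_divide divide_le_eq mult_ac)
  qed
  hence "(cmod (deriv h a))\<^sup>2 * (Im a * Im a) \<le> Im (h a) * Im (h a)"
    by (rule tendsto_le[OF at_neq_bot lim2 lim])
  hence "(cmod (deriv h a) * Im a)\<^sup>2 \<le> (Im (h a))\<^sup>2" by (simp add: power2_eq_square mult_ac)
  hence "cmod (deriv h a) * Im a \<le> Im (h a)" by (rule power2_le_imp_le) (use pos[OF a] in simp)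
  thus ?thesis using a by (simp add: field_simps)
qed

section \<open>The space H and its Borel structure\<close>

definition tmap :: "(complex \<Rightarrow> complex) \<Rightarrow> (complex \<Rightarrow> complex) \<Rightarrow> complex \<Rightarrow> complex" where
  "tmap w x = (\<lambda>z. if z \<in> \<complex>\<^sub>+ then 1 / (1 / w z - x z) else 0)"

lemma Im_le_neg_imp:
  assumes "Im u \<le> - t" "0 < t"
  shows "t \<le> cmod u" "u \<noteq> 0" "0 < Im (1 / u)" "cmod (1 / u) \<le> 1 / t"
proof -
  show *: "t \<le> cmod u" using abs_Im_le_cmod[of u] assms by linarith
  show "u \<noteq> 0" using assms by auto
  thus "0 < Im (1 / u)" using assms Im_neg_inverse[of u]
    by (simp add: Im_divide field_simps cmod_power2 sum_power2_gt_zero_iff complex_eq_iff)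
  show "cmod (1 / u) \<le> 1 / t" using * assms by (simp add: norm_divide frac_le)
qed

lemma H_set_Im_inverse_diff_le:
  assumes w: "w \<in> H_set" and z: "0 < Im z" and y: "0 \<le> Im y"
  shows "Im (1 / w z - y) \<le> - Im z"
  using H_set_Im_neg_inverse_ge[OF w z] y by simp

text \<open>Only Im x >= 0 is assumed, because the inner argument will be a limit of elements of H,
  for which strict positivity is not yet known.\<close>

lemma tmap_in_H_set_gen:
  assumes w: "w \<in> H_set" and hol: "x holomorphic_on \<complex>\<^sub>+" and Im: "\<And>z. 0 < Im z \<Longrightarrow> 0 \<le> Im (x z)"
  shows "tmap w x \<in> H_set"
proof -
  note bnd = Im_le_neg_imp[OF H_set_Im_inverse_diff_le[OF w _ Im]]
  have "(\<lambda>z. 1 / (1 / w z - x z)) holomorphic_on \<complex>\<^sub>+"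
    using H_setD[OF w] hol bnd by (intro holomorphic_intros) auto
  hence "tmap w x holomorphic_on \<complex>\<^sub>+"
    by (rule holomorphic_transform) (simp add: tmap_def)
  thus ?thesis using bnd by (simp add: H_set_def) (simp add: tmap_def)
qed

lemma tmap_in_H_set: "w \<in> H_set \<Longrightarrow> x \<in> H_set \<Longrightarrow> tmap w x \<in> H_set"
  by (rule tmap_in_H_set_gen) (auto dest: H_setD intro: less_imp_le)

lemma inverse_diff_contraction:
  assumes w: "w \<in> H_set" and z: "0 < Im z" and y: "0 \<le> Im y" "0 \<le> Im y'"
  shows "cmod (1 / (1 / w z - y) - 1 / (1 / w z - y')) \<le> cmod (y - y') / (Im z)\<^sup>2"
proof -
  note b = Im_le_neg_imp[OF H_set_Im_inverse_diff_le[OF w z y(1)] z]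
  note b' = Im_le_neg_imp[OF H_set_Im_inverse_diff_le[OF w z y(2)] z]
  have "1 / (1 / w z - y) - 1 / (1 / w z - y') = (y - y') * (1 / (1 / w z - y)) * (1 / (1 / w z - y'))"
    using b(2) b'(2) by (simp add: divide_simps del: divide_eq_0_iff) (simp add: algebra_simps)
  hence "cmod (1 / (1 / w z - y) - 1 / (1 / w z - y')) = cmod (y - y') * cmod (1 / (1 / w z - y)) * cmod (1 / (1 / w z - y'))"
    by (simp only: norm_mult)
  also have "\<dots> \<le> cmod (y - y') * (1 / Im z) * (1 / Im z)"
    using b(4) b'(4) z by (intro mult_mono) auto
  finally show ?thesis by (simp add: power2_eq_square)
qed

text \<open>Distinct points with Im z = 3, where \<open>T w\<close> contracts by 1/9, converging to
  3i inside the half-plane, so that the identity theorem applies.\<close>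

definition dpt :: "nat \<Rightarrow> complex" where "dpt i = 3 * \<i> + 1 / of_nat (Suc i)"

lemma Im_dpt [simp]: "Im (dpt i) = 3"
  by (simp add: dpt_def Im_divide)

lemma dpt_islimpt: "(3 * \<i>) islimpt range dpt"
proof -
  have "inj dpt" by (auto simp: dpt_def inj_def)
  moreover have "dpt \<longlonglongrightarrow> 3 * \<i>"
  proof -
    have "(\<lambda>n. 3 * \<i> + 1 / of_nat (Suc n)) \<longlonglongrightarrow> 3 * \<i> + 0"
      by (intro tendsto_intros LIMSEQ_Suc[OF lim_1_over_n])
    thus ?thesis by (simp add: dpt_def[abs_def])
  qed
  moreover have "dpt i \<noteq> 3 * \<i>" for i
    by (simp add: dpt_def del: of_nat_Suc)
  ultimately show ?thesis unfolding islimpt_sequential by (intro exI[of _ dpt]) auto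
qed

text \<open>Local boundedness for Montel's theorem. The bound 2 / Im z is that of a difference of
  two elements of H.\<close>

lemma bounded_on_compact_upper_half:
  assumes L: "compact L" "L \<subseteq> \<complex>\<^sub>+" and H: "\<And>h z. h \<in> H \<Longrightarrow> 0 < Im z \<Longrightarrow> cmod (h z) \<le> 2 / Im z"
  shows "\<exists>B. \<forall>h\<in>H. \<forall>z\<in>L. cmod (h z) \<le> B"
proof (cases "L = {}")
  case False
  have "continuous_on L Im" by (intro continuous_intros)
  then obtain a where a: "a \<in> L" "\<And>z. z \<in> L \<Longrightarrow> Im a \<le> Im z"
    using continuous_attains_inf[OF L(1) False] by blast
  have "0 < Im a" using a(1) L(2) by auto
  have "cmod (h z) \<le> 2 / Im a" if "h \<in> H" "z \<in> L" for h z
  proof -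
    have "cmod (h z) \<le> 2 / Im z" using H that L(2) by auto
    also have "\<dots> \<le> 2 / Im a" using a(2)[OF \<open>z \<in> L\<close>] \<open>0 < Im a\<close> by (intro divide_left_mono) auto
    finally show ?thesis .
  qed
  thus ?thesis by blast
qed simp

text \<open>Montel's theorem and the identity theorem: the points \<open>dpt i\<close> accumulate in the half-plane.\<close>
lemma small_on_compact:
  assumes K: "compact K" "K \<subseteq> \<complex>\<^sub>+" and e: "0 < e"
  obtains m \<delta> where "0 < \<delta>" "\<And>f. f holomorphic_on \<complex>\<^sub>+ \<Longrightarrow> (\<And>z. 0 < Im z \<Longrightarrow> cmod (f z) \<le> 2 / Im z)
     \<Longrightarrow> (\<And>i. i < m \<Longrightarrow> cmod (f (dpt i)) < \<delta>) \<Longrightarrow> (\<forall>z\<in>K. cmod (f z) < e)"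
proof (rule ccontr)
  assume no: "\<not> thesis"
  define \<H> where "\<H> = {f. f holomorphic_on \<complex>\<^sub>+ \<and> (\<forall>z. 0 < Im z \<longrightarrow> cmod (f z) \<le> 2 / Im z)}"
  \<comment> \<open>Failure for every m gives functions smaller and smaller at more and more points
    \<open>dpt i\<close>, yet never small on K. A locally uniform subsequential limit must vanish at
    all these points, hence identically.\<close>
  have "\<exists>f. f \<in> \<H> \<and> (\<forall>i<m. cmod (f (dpt i)) < 1 / real (Suc m)) \<and> \<not> (\<forall>z\<in>K. cmod (f z) < e)" for m
  proof (rule ccontr)
    assume "\<nexists>f. f \<in> \<H> \<and> (\<forall>i<m. cmod (f (dpt i)) < 1 / real (Suc m)) \<and> \<not> (\<forall>z\<in>K. cmod (f z) < e)"
    hence *: "\<forall>z\<in>K. cmod (f z) < e" if "f \<in> \<H>" "\<forall>i<m. cmod (f (dpt i)) < 1 / real (Suc m)" for f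
      using that by blast
    have thesis
    proof (rule that)
      show "0 < 1 / real (Suc m)" by simp
      fix f assume "f holomorphic_on \<complex>\<^sub>+" "\<And>z. 0 < Im z \<Longrightarrow> cmod (f z) \<le> 2 / Im z"
        "\<And>i. i < m \<Longrightarrow> cmod (f (dpt i)) < 1 / real (Suc m)"
      thus "\<forall>z\<in>K. cmod (f z) < e" by (intro *) (auto simp: \<H>_def)
    qed
    thus False using no by simp
  qed
  then obtain F where F: "\<And>m. F m \<in> \<H>" "\<And>m i. i < m \<Longrightarrow> cmod (F m (dpt i)) < 1 / real (Suc m)"
     "\<And>m. \<not> (\<forall>z\<in>K. cmod (F m z) < e)" by metis
  have bdd: "\<exists>B. \<forall>h\<in>\<H>. \<forall>z\<in>L. cmod (h z) \<le> B" if "compact L" "L \<subseteq> \<complex>\<^sub>+" for L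
    by (rule bounded_on_compact_upper_half[OF that]) (auto simp: \<H>_def)
  obtain g r where g: "g holomorphic_on \<complex>\<^sub>+" and r: "strict_mono (r :: nat \<Rightarrow> nat)"
    and lim: "\<And>x. x \<in> \<complex>\<^sub>+ \<Longrightarrow> (\<lambda>n. F (r n) x) \<longlonglongrightarrow> g x"
    and ulim: "\<And>K. compact K \<Longrightarrow> K \<subseteq> \<complex>\<^sub>+ \<Longrightarrow> uniform_limit K (F \<circ> r) g sequentially"
    by (rule Montel[OF open_upper_half, of \<H> F]) (use F(1) bdd in \<open>auto simp: \<H>_def\<close>)
  have gd: "g (dpt i) = 0" for i
  proof -
    have "(\<lambda>n. F (r n) (dpt i)) \<longlonglongrightarrow> 0"
    proof (rule Lim_null_comparison)
      show "\<forall>\<^sub>F n in sequentially. cmod (F (r n) (dpt i)) \<le> 1 / real (Suc n)"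
        using eventually_gt_at_top[of i]
      proof eventually_elim
        case (elim n)
        have "n \<le> r n" using r by (rule seq_suble)
        hence "cmod (F (r n) (dpt i)) < 1 / real (Suc (r n))" using F(2)[of i "r n"] elim by simp
        also have "\<dots> \<le> 1 / real (Suc n)" using \<open>n \<le> r n\<close> by (simp add: frac_le)
        finally show ?case by simp
      qed
      show "(\<lambda>n. 1 / real (Suc n)) \<longlonglongrightarrow> 0" using LIMSEQ_Suc[OF lim_1_over_n[where 'a=real]] by simp
    qed
    thus ?thesis using lim[of "dpt i"] LIMSEQ_unique by fastforce
  qed
  have g0: "g z = 0" if "0 < Im z" for z
    by (rule analytic_continuation[OF g open_upper_half connected_upper_half _ _ dpt_islimpt])
       (use that gd in auto)
  have "\<forall>\<^sub>F n in sequentially. \<forall>z\<in>K. dist ((F \<circ> r) n z) (g z) < e"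
    using ulim[OF K] e by (auto simp: uniform_limit_iff)
  then obtain n where "\<forall>z\<in>K. dist (F (r n) z) (g z) < e" by (auto simp: eventually_at_top_linorder)
  hence "\<forall>z\<in>K. cmod (F (r n) z) < e" using g0 K by (auto simp: dist_norm subset_iff)
  thus False using F(3) by blast
qed

section \<open>Borel sets of H through countably many evaluations\<close>

definition evH :: "(complex \<Rightarrow> complex) \<Rightarrow> nat \<Rightarrow> complex" where "evH f = (\<lambda>i. f (dpt i))"

lemma H_diff:
  assumes "f \<in> H_set" "g \<in> H_set"
  shows "(\<lambda>z. f z - g z) holomorphic_on \<complex>\<^sub>+" "0 < Im z \<Longrightarrow> cmod (f z - g z) \<le> 2 / Im z"
proof -
  show "(\<lambda>z. f z - g z) holomorphic_on \<complex>\<^sub>+" using assms by (intro holomorphic_intros H_setD(1))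
  assume z: "0 < Im z"
  have "cmod (f z - g z) \<le> cmod (f z) + cmod (g z)" by (rule norm_triangle_ineq4)
  also have "\<dots> \<le> 1 / Im z + 1 / Im z" using H_setD(3)[OF assms(1) z] H_setD(3)[OF assms(2) z] by (rule add_mono)
  finally show "cmod (f z - g z) \<le> 2 / Im z" by simp
qed

lemma H_open_subset: "H_open U \<Longrightarrow> U \<subseteq> H_set"
  by (simp add: H_open_def)

lemma space_H_borel [simp]: "space H_borel = H_set"
  unfolding H_borel_def by (rule space_measure_of) (auto dest: H_open_subset)

lemma sets_H_borel: "sets H_borel = sigma_sets H_set {U. H_open U}"
  unfolding H_borel_def by (rule sets_measure_of) (auto dest: H_open_subset)

lemma open_finite_box: "open {y::nat \<Rightarrow> complex. \<forall>i<m. cmod (y i - c i) < \<delta>}"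
proof -
  have "{y::nat \<Rightarrow> complex. \<forall>i<m. cmod (y i - c i) < \<delta>} = (\<Inter>i\<in>{..<m}. {y. cmod (y i - c i) < \<delta>})"
    by auto
  also have "open \<dots>"
    by (intro open_INT ballI open_Collect_less continuous_intros continuous_on_product_coordinates) auto
  finally show ?thesis .
qed

text \<open>On H, locally uniform convergence is already convergence at the points
  \<open>dpt i\<close>: apply \<open>small_on_compact\<close> to g - f. So H carries the topology
  induced by \<open>evH\<close> from a countable product.\<close>

lemma H_open_imp_evH:
  assumes U: "H_open U"
  obtains V where "open V" "U = {f\<in>H_set. evH f \<in> V}"
proof -
  have nbhd: "\<exists>m \<delta>. 0 < \<delta> \<and> {g\<in>H_set. \<forall>i<m. cmod (g (dpt i) - f (dpt i)) < \<delta>} \<subseteq> U" if f: "f \<in> U" for f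
  proof -
    obtain K e where K: "compact K" "K \<subseteq> \<complex>\<^sub>+" "0 < e" "{g\<in>H_set. \<forall>z\<in>K. cmod (g z - f z) < e} \<subseteq> U"
      using U f unfolding H_open_def by blast
    obtain m \<delta> where m: "0 < \<delta>" "\<And>f. f holomorphic_on \<complex>\<^sub>+ \<Longrightarrow> (\<And>z. 0 < Im z \<Longrightarrow> cmod (f z) \<le> 2 / Im z)
     \<Longrightarrow> (\<And>i. i < m \<Longrightarrow> cmod (f (dpt i)) < \<delta>) \<Longrightarrow> (\<forall>z\<in>K. cmod (f z) < e)"
      using small_on_compact[OF K(1-3)] by metis
    have "f \<in> H_set" using f U H_open_subset by auto
    have "g \<in> U" if g: "g \<in> H_set" "\<forall>i<m. cmod (g (dpt i) - f (dpt i)) < \<delta>" for g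
    proof -
      have "\<forall>z\<in>K. cmod (g z - f z) < e"
        by (rule m(2)) (use H_diff[OF g(1) \<open>f \<in> H_set\<close>] g in auto)
      thus ?thesis using K(4) g by auto
    qed
    thus ?thesis using m(1) by blast
  qed
  \<comment> \<open>The largest open set whose preimage under \<open>evH\<close> lies in U; this
    avoids choosing one box per point of U.\<close>
  define V where "V = \<Union>{B::(nat \<Rightarrow> complex) set. open B \<and> {g\<in>H_set. evH g \<in> B} \<subseteq> U}"
  show ?thesis
  proof (rule that)
    show "open V" unfolding V_def by (intro open_Union) auto
    show "U = {f\<in>H_set. evH f \<in> V}"
    proof (intro equalityI subsetI)
      fix f assume f: "f \<in> U"
      obtain m \<delta> where m: "0 < \<delta>" "{g\<in>H_set. \<forall>i<m. cmod (g (dpt i) - f (dpt i)) < \<delta>} \<subseteq> U"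
        using nbhd[OF f] by blast
      define B where "B = {y. \<forall>i<m. cmod (y i - f (dpt i)) < \<delta>}"
      have "open B" "{g\<in>H_set. evH g \<in> B} \<subseteq> U" "evH f \<in> B"
        using m open_finite_box[of m "\<lambda>i. f (dpt i)" \<delta>] by (auto simp: B_def evH_def)
      thus "f \<in> {f\<in>H_set. evH f \<in> V}" using f H_open_subset[OF U] unfolding V_def by blast
    next
      fix g assume "g \<in> {f\<in>H_set. evH f \<in> V}"
      thus "g \<in> U" unfolding V_def by blast
    qed
  qed
qed

lemma eval_measurable_H_borel [measurable]: "(\<lambda>f. f z) \<in> borel_measurable H_borel"
proof (cases "0 < Im z")
  case True
  show ?thesis
  proof (rule borel_measurableI)
    fix V :: "complex set" assume V: "open V"
    have "H_open {f\<in>H_set. f z \<in> V}"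
      unfolding H_open_def
    proof (intro conjI ballI)
      fix f assume f: "f \<in> {f\<in>H_set. f z \<in> V}"
      then obtain e where "0 < e" "\<And>y. dist y (f z) < e \<Longrightarrow> y \<in> V" using V unfolding open_dist by auto
      thus "\<exists>K e. compact K \<and> K \<subseteq> \<complex>\<^sub>+ \<and> 0 < e \<and> {g\<in>H_set. \<forall>z\<in>K. cmod (g z - f z) < e} \<subseteq> {f\<in>H_set. f z \<in> V}"
        using True by (intro exI[of _ "{z}"] exI[of _ e]) (auto simp: dist_norm)
    qed auto
    moreover have "(\<lambda>f. f z) -` V \<inter> space H_borel = {f\<in>H_set. f z \<in> V}" by auto
    ultimately show "(\<lambda>f. f z) -` V \<inter> space H_borel \<in> sets H_borel" by (simp add: sets_H_borel)
  qed
next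
  case False
  hence "f z = 0" if "f \<in> space H_borel" for f using that H_setD(4)[of f z] by auto
  thus ?thesis using measurable_cong[of H_borel "\<lambda>f. f z" "\<lambda>_. 0" borel] by simp
qed

text \<open>By \<open>H_open_imp_evH\<close> the generating sets are preimages under
  \<open>evH\<close>, so maps into H can be tested coordinate by coordinate.\<close>

lemma measurable_H_borelI:
  assumes g: "\<And>x. x \<in> space M \<Longrightarrow> g x \<in> H_set"
    and ev: "\<And>z. 0 < Im z \<Longrightarrow> (\<lambda>x. g x z) \<in> borel_measurable M"
  shows "g \<in> measurable M H_borel"
  unfolding H_borel_def
proof (rule measurable_measure_of)
  show "{U. H_open U} \<subseteq> Pow H_set" by (auto dest: H_open_subset)
  show "g \<in> space M \<rightarrow> H_set" using g by auto
  fix U assume "U \<in> {U. H_open U}"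
  then obtain V where V: "open V" "U = {f\<in>H_set. evH f \<in> V}" using H_open_imp_evH by blast
  have "(\<lambda>x. evH (g x)) \<in> borel_measurable M"
    unfolding evH_def by (intro measurable_coordinatewise_then_product ev) simp
  hence "(\<lambda>x. evH (g x)) -` V \<inter> space M \<in> sets M" using V(1) by (intro measurable_sets[of _ _ borel]) auto
  moreover have "g -` U \<inter> space M = (\<lambda>x. evH (g x)) -` V \<inter> space M" using g V by auto
  ultimately show "g -` U \<inter> space M \<in> sets M" by simp
qed

lemma evH_measurable [measurable]: "evH \<in> borel_measurable H_borel"
  unfolding evH_def by (intro measurable_coordinatewise_then_product eval_measurable_H_borel)

lemma H_open_Int: "H_open U \<Longrightarrow> H_open V \<Longrightarrow> H_open (U \<inter> V)"
  unfolding H_open_def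
proof (intro conjI ballI)
  fix f assume *: "U \<subseteq> H_set \<and> (\<forall>f\<in>U. \<exists>K e. compact K \<and> K \<subseteq> \<complex>\<^sub>+ \<and> 0 < e \<and> {g \<in> H_set. \<forall>z\<in>K. cmod (g z - f z) < e} \<subseteq> U)"
    "V \<subseteq> H_set \<and> (\<forall>f\<in>V. \<exists>K e. compact K \<and> K \<subseteq> \<complex>\<^sub>+ \<and> 0 < e \<and> {g \<in> H_set. \<forall>z\<in>K. cmod (g z - f z) < e} \<subseteq> V)"
    "f \<in> U \<inter> V"
  obtain K e where K: "compact K" "K \<subseteq> \<complex>\<^sub>+" "0 < e" "{g\<in>H_set. \<forall>z\<in>K. cmod (g z - f z) < e} \<subseteq> U" using * by blast
  obtain K' e' where K': "compact K'" "K' \<subseteq> \<complex>\<^sub>+" "0 < e'" "{g\<in>H_set. \<forall>z\<in>K'. cmod (g z - f z) < e'} \<subseteq> V" using * by blast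
  have "{g \<in> H_set. \<forall>z\<in>K \<union> K'. cmod (g z - f z) < min e e'} \<subseteq> U \<inter> V" using K(4) K'(4) by auto
  thus "\<exists>K e. compact K \<and> K \<subseteq> \<complex>\<^sub>+ \<and> 0 < e \<and> {g \<in> H_set. \<forall>z\<in>K. cmod (g z - f z) < e} \<subseteq> U \<inter> V"
    using K K' by (intro exI[of _ "K \<union> K'"] exI[of _ "min e e'"]) auto
qed auto

lemma H_open_H_set: "H_open H_set"
  unfolding H_open_def
  by (intro conjI ballI subset_refl exI[of _ "{}"] exI[of _ "1::real"]) auto

text \<open>Continuous functionals of \<open>evH\<close> approximate indicators of open sets from
  below, and the open sets of H are an intersection-stable generator. In this form, pointwise
  convergence of random elements of H will identify laws.\<close>

lemma prob_on_H_eqI: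
  assumes P: "prob_on_H P" and P': "prob_on_H P'"
    and eq: "\<And>h::(nat \<Rightarrow> complex) \<Rightarrow> real. continuous_on UNIV h \<Longrightarrow> (\<And>y. 0 \<le> h y \<and> h y \<le> 1) \<Longrightarrow>
       (\<integral>f. h (evH f) \<partial>P) = (\<integral>f. h (evH f) \<partial>P')"
  shows "P = P'"
proof -
  interpret P: prob_space P using P by (simp add: prob_on_H_def)
  interpret P': prob_space P' using P' by (simp add: prob_on_H_def)
  have [measurable_cong]: "sets P = sets H_borel" "sets P' = sets H_borel" using P P' by (auto simp: prob_on_H_def)
  have sp: "space P = H_set" "space P' = H_set" using sets_eq_imp_space_eq[of P H_borel] sets_eq_imp_space_eq[of P' H_borel]
    by (simp_all add: \<open>sets P = sets H_borel\<close> \<open>sets P' = sets H_borel\<close>)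
  have main: "measure P {f\<in>H_set. evH f \<in> V} = measure P' {f\<in>H_set. evH f \<in> V}" if V: "open V" for V
  proof (cases "V = UNIV")
    case True
    thus ?thesis using P.prob_space P'.prob_space by (simp add: sp)
  next
    case False
    \<comment> \<open>The case V = UNIV was set aside because \<open>infdist\<close> to the empty
      set is 0, which would make every \<open>h m\<close> vanish.\<close>
    define h where "h = (\<lambda>(m::nat) y. min 1 (real m * infdist y (- V)))"
    have hc: "continuous_on UNIV (h m)" for m unfolding h_def by (intro continuous_intros)
    have h01: "0 \<le> h m y \<and> h m y \<le> 1" for m y by (auto simp: h_def infdist_nonneg)
    have hlim: "(\<lambda>m. h m y) \<longlonglongrightarrow> indicator V y" for y
    proof (cases "y \<in> V")
      case True
      hence "infdist y (- V) > 0" using V False in_closed_iff_infdist_zero[of "- V" y] infdist_nonneg[of y "- V"]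
        by (auto simp: closed_Compl less_le)
      then obtain N :: nat where N: "1 < real N * infdist y (- V)" using reals_Archimedean3 by blast
      have "\<forall>\<^sub>F m in sequentially. h m y = 1"
        using eventually_ge_at_top[of N]
      proof eventually_elim
        case (elim m)
        have "real N * infdist y (- V) \<le> real m * infdist y (- V)" using elim by (intro mult_right_mono infdist_nonneg) auto
        thus ?case using N by (simp add: h_def)
      qed
      thus ?thesis using True by (simp add: tendsto_eventually)
    next
      case False
      thus ?thesis by (simp add: h_def)
    qed
    have gen: "(\<lambda>m. \<integral>f. h m (evH f) \<partial>M) \<longlonglongrightarrow> measure M {f\<in>H_set. evH f \<in> V}"
      if M: "prob_space M" "sets M = sets H_borel" for M
    proof -
      interpret M: prob_space M by fact
      note [measurable_cong] = M(2)
      have [measurable]: "h m \<in> borel_measurable borel" for m using hc by (rule borel_measurable_continuous_onI)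
      have [measurable]: "V \<in> sets borel" using V by simp
      have "(\<lambda>m. \<integral>f. h m (evH f) \<partial>M) \<longlonglongrightarrow> (\<integral>f. indicator V (evH f) \<partial>M)"
        by (rule integral_dominated_convergence[where w="\<lambda>_. 1"]) (use hlim h01 in auto)
      also have "(\<integral>f. indicator V (evH f) \<partial>M) = (\<integral>f. indicator {f\<in>H_set. evH f \<in> V} f \<partial>M :: real)"
        by (intro Bochner_Integration.integral_cong) (auto simp: indicator_def sets_eq_imp_space_eq[OF M(2)])
      also have "\<dots> = measure M {f\<in>H_set. evH f \<in> V}"
        by (simp add: sets_eq_imp_space_eq[OF M(2)] Int_absorb2 subset_eq)
      finally show ?thesis .
    qed
    have "(\<integral>f. h m (evH f) \<partial>P) = (\<integral>f. h m (evH f) \<partial>P')" for m by (intro eq hc h01)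
    moreover have "(\<lambda>m. \<integral>f. h m (evH f) \<partial>P) \<longlonglongrightarrow> measure P {f\<in>H_set. evH f \<in> V}"
      by (rule gen) (use P in \<open>simp_all add: prob_on_H_def\<close>)
    moreover have "(\<lambda>m. \<integral>f. h m (evH f) \<partial>P') \<longlonglongrightarrow> measure P' {f\<in>H_set. evH f \<in> V}"
      by (rule gen) (use P' in \<open>simp_all add: prob_on_H_def\<close>)
    ultimately show ?thesis by (simp add: LIMSEQ_unique)
  qed
  show ?thesis
  proof (rule measure_eqI_generator_eq[where E="{U. H_open U}" and \<Omega>=H_set and A="\<lambda>_::nat. H_set"])
    show "Int_stable {U. H_open U}" by (auto simp: Int_stable_def H_open_Int)
    show "{U. H_open U} \<subseteq> Pow H_set" by (auto dest: H_open_subset)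
    show "emeasure P U = emeasure P' U" if "U \<in> {U. H_open U}" for U
    proof -
      have "H_open U" using that by simp
      then obtain V where V: "open V" "U = {f\<in>H_set. evH f \<in> V}" by (rule H_open_imp_evH)
      show ?thesis unfolding V(2) P.emeasure_eq_measure P'.emeasure_eq_measure main[OF V(1)] ..
    qed
    show "sets P = sigma_sets H_set {U. H_open U}" "sets P' = sigma_sets H_set {U. H_open U}"
      using P P' by (auto simp: prob_on_H_def sets_H_borel)
    show "emeasure P H_set \<noteq> \<infinity>" by (simp add: P.emeasure_eq_measure)
  qed (auto simp: H_open_H_set)
qed

section \<open>The fixed point R\<close>

text \<open>Pointwise convergence suffices: by Montel a subsequence converges locally uniformly to a
  holomorphic function, which must be the pointwise limit.\<close>

lemma holomorphic_limit_H_set: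
  assumes F: "\<And>n. F n \<in> H_set" and lim: "\<And>z. 0 < Im z \<Longrightarrow> (\<lambda>n. F n z) \<longlonglongrightarrow> g z"
  shows "g holomorphic_on \<complex>\<^sub>+"
proof -
  have bnd: "cmod (h z) \<le> 2 / Im z" if "h \<in> H_set" "0 < Im z" for h z
  proof -
    have "1 / Im z \<le> 2 / Im z" using that by (intro divide_right_mono) auto
    thus ?thesis using H_setD(3)[OF that] by linarith
  qed
  have bdd: "\<exists>B. \<forall>h\<in>H_set. \<forall>z\<in>L. cmod (h z) \<le> B" if "compact L" "L \<subseteq> \<complex>\<^sub>+" for L
    by (rule bounded_on_compact_upper_half[OF that]) (rule bnd)
  obtain g' r where g': "g' holomorphic_on \<complex>\<^sub>+" and r: "strict_mono (r :: nat \<Rightarrow> nat)"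
    and lim': "\<And>x. x \<in> \<complex>\<^sub>+ \<Longrightarrow> (\<lambda>n. F (r n) x) \<longlonglongrightarrow> g' x"
    by (rule Montel[OF open_upper_half, of H_set F]) (use F bdd H_setD(1) in auto)
  have "g' z = g z" if "z \<in> \<complex>\<^sub>+" for z
    using LIMSEQ_unique[OF lim'[OF that] LIMSEQ_subseq_LIMSEQ[OF lim r, unfolded o_def]] that by simp
  thus ?thesis using g' holomorphic_transform by blast
qed

text \<open>New maps enter at the inside. This backward order is what makes the iterates converge
  for each fixed \<omega> instead of only in law.\<close>

primrec spine :: "nat \<Rightarrow> (nat \<Rightarrow> complex \<Rightarrow> complex) \<Rightarrow> (complex \<Rightarrow> complex) \<Rightarrow> complex \<Rightarrow> complex" where
  "spine 0 \<omega> x = x"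
| "spine (Suc k) \<omega> x = tmap (\<omega> 0) (spine k (\<lambda>i. \<omega> (Suc i)) x)"

lemma spine_in_H_set: "(\<And>i. \<omega> i \<in> H_set) \<Longrightarrow> x \<in> H_set \<Longrightarrow> spine k \<omega> x \<in> H_set"
  by (induction k arbitrary: \<omega>) (auto intro!: tmap_in_H_set)

lemma spine_add: "spine (k + j) \<omega> x = spine k \<omega> (spine j (\<lambda>i. \<omega> (k + i)) x)"
  by (induction k arbitrary: \<omega>) auto

lemma spine_contraction:
  assumes "\<And>i. \<omega> i \<in> H_set" "x \<in> H_set" "x' \<in> H_set" and z: "0 < Im z"
  shows "cmod (spine k \<omega> x z - spine k \<omega> x' z) \<le> 2 / Im z * (1 / (Im z)\<^sup>2) ^ k"
  using assms(1)
proof (induction k arbitrary: \<omega>)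
  case 0
  thus ?case using H_diff(2)[OF assms(2,3) z] by simp
next
  case (Suc k)
  let ?\<omega> = "\<lambda>i. \<omega> (Suc i)"
  have "spine k ?\<omega> x \<in> H_set" "spine k ?\<omega> x' \<in> H_set"
    using Suc.prems assms by (auto intro!: spine_in_H_set)
  hence nn: "0 \<le> Im (spine k ?\<omega> x z)" "0 \<le> Im (spine k ?\<omega> x' z)"
    using z H_setD(2) less_imp_le by blast+
  have "cmod (spine (Suc k) \<omega> x z - spine (Suc k) \<omega> x' z)
      \<le> cmod (spine k ?\<omega> x z - spine k ?\<omega> x' z) / (Im z)\<^sup>2"
    using inverse_diff_contraction[OF Suc.prems[of 0] z nn] z by (simp add: tmap_def)
  also have "\<dots> \<le> (2 / Im z * (1 / (Im z)\<^sup>2) ^ k) / (Im z)\<^sup>2"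
    using Suc.prems by (intro divide_right_mono Suc.IH) auto
  finally show ?case by (simp add: mult_ac)
qed

text \<open>At the given z the maps need not contract. The estimate is made at the points
  \<open>dpt i\<close> and carried over by \<open>small_on_compact\<close>, so that N depends
  neither on \<omega> nor on the starting points.\<close>

lemma spine_close:
  assumes z: "0 < Im z" and e: "0 < e"
  obtains N where "\<And>k \<omega> x x'. N \<le> k \<Longrightarrow> (\<And>i. \<omega> i \<in> H_set) \<Longrightarrow> x \<in> H_set \<Longrightarrow> x' \<in> H_set \<Longrightarrow>
     cmod (spine k \<omega> x z - spine k \<omega> x' z) < e"
proof -
  have K: "compact {z}" "{z} \<subseteq> \<complex>\<^sub>+" using z by auto
  obtain m \<delta> where m: "0 < \<delta>" "\<And>f. f holomorphic_on \<complex>\<^sub>+ \<Longrightarrow> (\<And>z. 0 < Im z \<Longrightarrow> cmod (f z) \<le> 2 / Im z)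
     \<Longrightarrow> (\<And>i. i < m \<Longrightarrow> cmod (f (dpt i)) < \<delta>) \<Longrightarrow> (\<forall>z\<in>{z}. cmod (f z) < e)"
    using small_on_compact[OF K e] by metis
  \<comment> \<open>The constants are 2 / Im z and 1 / (Im z)^2 of \<open>spine_contraction\<close>
    at Im z = 3.\<close>
  have "(\<lambda>k. 2 / 3 * (1 / 9 :: real) ^ k) \<longlonglongrightarrow> 2 / 3 * 0" by (intro tendsto_intros) auto
  hence "\<forall>\<^sub>F k in sequentially. 2 / 3 * (1 / 9 :: real) ^ k < \<delta>" using m(1) by (auto simp: order_tendsto_iff)
  then obtain N where N: "\<And>k. N \<le> k \<Longrightarrow> 2 / 3 * (1 / 9 :: real) ^ k < \<delta>" by (auto simp: eventually_at_top_linorder)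
  show ?thesis
  proof (rule that)
    fix k x x' and \<omega> :: "nat \<Rightarrow> complex \<Rightarrow> complex" assume *: "N \<le> k" "\<And>i. \<omega> i \<in> H_set" "x \<in> H_set" "x' \<in> H_set"
    have "\<forall>z\<in>{z}. cmod (spine k \<omega> x z - spine k \<omega> x' z) < e"
    proof (rule m(2))
      show "(\<lambda>z. spine k \<omega> x z - spine k \<omega> x' z) holomorphic_on \<complex>\<^sub>+"
        by (intro H_diff spine_in_H_set *)
      show "cmod (spine k \<omega> x z - spine k \<omega> x' z) \<le> 2 / Im z" if "0 < Im z" for z
        by (intro H_diff spine_in_H_set * that)
      show "cmod (spine k \<omega> x (dpt i) - spine k \<omega> x' (dpt i)) < \<delta>" for i
        using spine_contraction[of \<omega> x x' "dpt i" k, OF *(2-4)] N[OF *(1)] by simp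
    qed
    thus "cmod (spine k \<omega> x z - spine k \<omega> x' z) < e" by simp
  qed
qed

text \<open>Schur complement at a root, with \<open>s\<close> the sum of the resolvent entries of
  its children's subtrees.\<close>

definition neg_inverseH :: "(complex \<Rightarrow> complex) \<Rightarrow> complex \<Rightarrow> complex" where
  "neg_inverseH s = (\<lambda>z. if z \<in> \<complex>\<^sub>+ then - 1 / (z + s z) else 0)"

lemma neg_inverseH_in_H_set:
  assumes hol: "s holomorphic_on \<complex>\<^sub>+" and Im: "\<And>z. 0 < Im z \<Longrightarrow> 0 \<le> Im (s z)"
  shows "neg_inverseH s \<in> H_set"
proof -
  have "Im (- (z + s z)) \<le> - Im z" if "0 < Im z" for z using Im[OF that] by simp
  note bnd = Im_le_neg_imp[OF this]
  have eq: "- 1 / (z + s z) = 1 / (- (z + s z))" for z by (metis divide_minus_right minus_divide_left)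
  have "(\<lambda>z. 1 / (- (z + s z))) holomorphic_on \<complex>\<^sub>+"
    by (intro holomorphic_intros hol) (use bnd in auto)
  hence "neg_inverseH s holomorphic_on \<complex>\<^sub>+"
    by (rule holomorphic_transform) (simp only: neg_inverseH_def eq if_True)
  thus ?thesis using bnd unfolding H_set_def by (simp add: neg_inverseH_def eq del: minus_add_distrib)
qed

text \<open>The function -1/z of the one-vertex tree, a concrete starting point in H.\<close>

definition leafH :: "complex \<Rightarrow> complex" where "leafH = neg_inverseH (\<lambda>_. 0)"

lemma leafH_in_H_set: "leafH \<in> H_set"
  unfolding leafH_def by (rule neg_inverseH_in_H_set) auto

definition spine_lim :: "(nat \<Rightarrow> complex \<Rightarrow> complex) \<Rightarrow> complex \<Rightarrow> complex" where
  "spine_lim \<omega> = (\<lambda>z. if z \<in> \<complex>\<^sub>+ then lim (\<lambda>k. spine k \<omega> leafH z) else 0)"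

text \<open>The iterate at k >= N is the one at N from another starting point, so independence of
  the starting point gives the Cauchy property too. That the limit forgets \<open>x\<close> is the
  core of the uniqueness of R.\<close>

lemma spine_LIMSEQ:
  assumes \<omega>: "\<And>i. \<omega> i \<in> H_set" and x: "x \<in> H_set" and z: "0 < Im z"
  shows "(\<lambda>k. spine k \<omega> x z) \<longlonglongrightarrow> spine_lim \<omega> z"
proof -
  have close: "\<exists>N. \<forall>k\<ge>N. \<forall>y. y \<in> H_set \<longrightarrow> cmod (spine k \<omega> y z - spine k \<omega> leafH z) < e" if "0 < e" for e
  proof -
    obtain N where "\<And>k \<omega> x x'. N \<le> k \<Longrightarrow> (\<And>i. \<omega> i \<in> H_set) \<Longrightarrow> x \<in> H_set \<Longrightarrow> x' \<in> H_set \<Longrightarrow>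
     cmod (spine k \<omega> x z - spine k \<omega> x' z) < e"
      using spine_close[OF z \<open>0 < e\<close>] by metis
    thus ?thesis using \<omega> leafH_in_H_set by blast
  qed
  have "Cauchy (\<lambda>k. spine k \<omega> leafH z)"
  proof (rule metric_CauchyI)
    fix e :: real assume "0 < e"
    then obtain N where N: "\<And>k y. k \<ge> N \<Longrightarrow> y \<in> H_set \<Longrightarrow> cmod (spine k \<omega> y z - spine k \<omega> leafH z) < e / 2"
      using close[of "e / 2"] by auto
    have *: "cmod (spine k \<omega> leafH z - spine N \<omega> leafH z) < e / 2" if "N \<le> k" for k
    proof -
      have "spine k \<omega> leafH = spine N \<omega> (spine (k - N) (\<lambda>i. \<omega> (N + i)) leafH)"
        using spine_add[of N "k - N"] that by simp
      thus ?thesis using N[of N] spine_in_H_set[of "\<lambda>i. \<omega> (N + i)"] \<omega> leafH_in_H_set by simp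
    qed
    have "dist (spine k \<omega> leafH z) (spine l \<omega> leafH z) < e" if "N \<le> k" "N \<le> l" for k l
      using *[OF that(1)] *[OF that(2)] dist_triangle_half_r[of "spine N \<omega> leafH z" "spine k \<omega> leafH z" e "spine l \<omega> leafH z"]
      by (simp add: dist_norm norm_minus_commute)
    thus "\<exists>M. \<forall>m\<ge>M. \<forall>n\<ge>M. dist (spine m \<omega> leafH z) (spine n \<omega> leafH z) < e" by blast
  qed
  hence lim0: "(\<lambda>k. spine k \<omega> leafH z) \<longlonglongrightarrow> spine_lim \<omega> z"
    using z by (simp add: spine_lim_def Cauchy_convergent_iff convergent_LIMSEQ_iff)
  have "(\<lambda>k. spine k \<omega> x z - spine k \<omega> leafH z) \<longlonglongrightarrow> 0"
    unfolding LIMSEQ_iff using close x by simp blast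
  from tendsto_add[OF this lim0] show ?thesis by simp
qed

lemma spine_lim_Im_ge_0:
  assumes \<omega>: "\<And>i. \<omega> i \<in> H_set" and z: "0 < Im z"
  shows "0 \<le> Im (spine_lim \<omega> z)"
proof (rule tendsto_lowerbound[OF tendsto_Im[OF spine_LIMSEQ[OF assms(1) leafH_in_H_set z]]])
  show "\<forall>\<^sub>F k in sequentially. 0 \<le> Im (spine k \<omega> leafH z)"
    by (intro always_eventually allI less_imp_le H_setD(2)[OF spine_in_H_set[OF \<omega> leafH_in_H_set] z])
qed auto

lemma spine_lim_holomorphic:
  assumes \<omega>: "\<And>i. \<omega> i \<in> H_set"
  shows "spine_lim \<omega> holomorphic_on \<complex>\<^sub>+"
  by (rule holomorphic_limit_H_set[of "\<lambda>k. spine k \<omega> leafH"])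
     (use \<omega> leafH_in_H_set in \<open>auto intro!: spine_in_H_set spine_LIMSEQ\<close>)

lemma spine_lim_unfold:
  assumes \<omega>: "\<And>i. \<omega> i \<in> H_set"
  shows "spine_lim \<omega> = tmap (\<omega> 0) (spine_lim (\<lambda>i. \<omega> (Suc i)))"
proof
  fix z
  show "spine_lim \<omega> z = tmap (\<omega> 0) (spine_lim (\<lambda>i. \<omega> (Suc i))) z"
  proof (cases "0 < Im z")
    case z: True
    let ?L = "spine_lim (\<lambda>i. \<omega> (Suc i)) z"
    have "0 \<le> Im ?L" using \<omega> z by (intro spine_lim_Im_ge_0)
    hence ne: "1 / \<omega> 0 z - ?L \<noteq> 0"
      using Im_le_neg_imp(2)[OF H_set_Im_inverse_diff_le[OF \<omega> z] z] by blast
    have "(\<lambda>k. 1 / (1 / \<omega> 0 z - spine k (\<lambda>i. \<omega> (Suc i)) leafH z)) \<longlonglongrightarrow> 1 / (1 / \<omega> 0 z - ?L)"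
      by (intro tendsto_intros spine_LIMSEQ \<omega> leafH_in_H_set z ne)
    hence "(\<lambda>k. spine (Suc k) \<omega> leafH z) \<longlonglongrightarrow> tmap (\<omega> 0) (spine_lim (\<lambda>i. \<omega> (Suc i))) z"
      using z by (simp add: tmap_def)
    moreover have "(\<lambda>k. spine (Suc k) \<omega> leafH z) \<longlonglongrightarrow> spine_lim \<omega> z"
      by (rule LIMSEQ_Suc) (intro spine_LIMSEQ \<omega> leafH_in_H_set z)
    ultimately show ?thesis by (rule LIMSEQ_unique[rotated])
  qed (simp add: spine_lim_def tmap_def)
qed

text \<open>The limit itself inherits only Im >= 0; the strict inequality is regained by peeling off
  one more \<open>tmap\<close>.\<close>

lemma spine_lim_in_H_set: "(\<And>i. \<omega> i \<in> H_set) \<Longrightarrow> spine_lim \<omega> \<in> H_set"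
  by (subst spine_lim_unfold)
     (auto intro!: tmap_in_H_set_gen spine_lim_holomorphic spine_lim_Im_ge_0)

lemma measurable_tmap:
  assumes f: "f \<in> measurable M H_borel" and g: "g \<in> measurable M H_borel"
  shows "(\<lambda>s. tmap (f s) (g s)) \<in> measurable M H_borel"
proof (rule measurable_H_borelI)
  note [measurable] = f g
  show "tmap (f s) (g s) \<in> H_set" if "s \<in> space M" for s
    using that measurable_space[OF f] measurable_space[OF g] by (intro tmap_in_H_set) auto
  fix z :: complex assume "0 < Im z"
  thus "(\<lambda>s. tmap (f s) (g s) z) \<in> borel_measurable M" by (simp add: tmap_def)
qed

lemma measurable_shift:
  assumes "f \<in> measurable M (PiM UNIV (\<lambda>_::nat. N))"
  shows "(\<lambda>s i. f s (Suc i)) \<in> measurable M (PiM UNIV (\<lambda>_. N))"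
proof (rule measurable_PiM_single')
  note [measurable] = assms
  show "(\<lambda>s. f s (Suc i)) \<in> measurable M N" for i by measurable
  show "(\<lambda>s i. f s (Suc i)) \<in> space M \<rightarrow> (\<Pi>\<^sub>E i\<in>UNIV. space N)"
    using measurable_space[OF assms] by (auto simp: space_PiM PiE_iff)
qed

lemma measurable_spine:
  assumes f: "f \<in> measurable M (PiM UNIV (\<lambda>_::nat. H_borel))" and g: "g \<in> measurable M H_borel"
  shows "(\<lambda>s. spine k (f s) (g s)) \<in> measurable M H_borel"
  using f
proof (induction k arbitrary: f)
  case (Suc k)
  have [measurable]: "f \<in> measurable M (PiM UNIV (\<lambda>_::nat. H_borel))" by fact
  have "(\<lambda>s. f s 0) \<in> measurable M H_borel" by measurable
  thus ?case using Suc.IH[OF measurable_shift[OF Suc.prems]] by (simp add: measurable_tmap)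
qed (use g in simp)

lemma space_PiM_H_borelD: "\<omega> \<in> space (PiM UNIV (\<lambda>_::nat. H_borel)) \<Longrightarrow> \<omega> i \<in> H_set"
  by (auto simp: space_PiM)

lemma measurable_spine_lim: "spine_lim \<in> measurable (PiM UNIV (\<lambda>_::nat. H_borel)) H_borel"
proof (rule measurable_H_borelI)
  show "spine_lim \<omega> \<in> H_set" if "\<omega> \<in> space (PiM UNIV (\<lambda>_::nat. H_borel))" for \<omega>
    using space_PiM_H_borelD[OF that] by (rule spine_lim_in_H_set)
  fix z :: complex assume z: "0 < Im z"
  have [measurable]: "(\<lambda>\<omega>. spine k \<omega> leafH) \<in> measurable (PiM UNIV (\<lambda>_::nat. H_borel)) H_borel" for k
    using leafH_in_H_set by (intro measurable_spine) auto
  show "(\<lambda>\<omega>. spine_lim \<omega> z) \<in> borel_measurable (PiM UNIV (\<lambda>_::nat. H_borel))"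
  proof (rule borel_measurable_LIMSEQ_metric)
    show "(\<lambda>\<omega>. spine k \<omega> leafH z) \<in> borel_measurable (PiM UNIV (\<lambda>_::nat. H_borel))" for k by measurable
    show "(\<lambda>k. spine k \<omega> leafH z) \<longlonglongrightarrow> spine_lim \<omega> z" if "\<omega> \<in> space (PiM UNIV (\<lambda>_::nat. H_borel))" for \<omega>
      using space_PiM_H_borelD[OF that] by (intro spine_LIMSEQ leafH_in_H_set z)
  qed
qed

section \<open>Existence and uniqueness of the fixed point law\<close>

lemma X_fixed_point_altdef:
  "X_fixed_point Q R \<longleftrightarrow> prob_on_H R \<and> R = distr (Q \<Otimes>\<^sub>M R) H_borel (\<lambda>(w, x). tmap w x)"
  by (simp add: X_fixed_point_def tmap_def[abs_def])

context
  fixes Q assumes Q: "prob_on_H Q"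
begin

interpretation Q: prob_space Q using Q by (simp add: prob_on_H_def)

interpretation seq: sequence_space Q ..

lemma sets_Q [measurable_cong]: "sets Q = sets H_borel" using Q by (simp add: prob_on_H_def)

lemma space_Q: "space Q = H_set" using sets_eq_imp_space_eq[OF sets_Q] by simp

lemma sets_PiM_Q: "sets (PiM UNIV (\<lambda>_::nat. Q)) = sets (PiM UNIV (\<lambda>_::nat. H_borel))"
  by (intro sets_PiM_cong sets_Q refl)

lemma measurable_case_nat_Q: "(\<lambda>(w, \<omega>). case_nat w \<omega>) \<in> measurable (Q \<Otimes>\<^sub>M PiM UNIV (\<lambda>_::nat. Q)) (PiM UNIV (\<lambda>_::nat. Q))"
  by measurable

lemma nn_integral_PiM_Q_Suc:
  assumes [measurable]: "\<phi> \<in> borel_measurable (PiM UNIV (\<lambda>_::nat. Q))"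
  shows "(\<integral>\<^sup>+\<omega>. \<phi> \<omega> \<partial>PiM UNIV (\<lambda>_::nat. Q)) = (\<integral>\<^sup>+w. \<integral>\<^sup>+\<omega>. \<phi> (case_nat w \<omega>) \<partial>PiM UNIV (\<lambda>_. Q) \<partial>Q)"
  by (subst seq.PiM_iter[symmetric], subst nn_integral_distr, measurable)
     (simp add: seq.nn_integral_fst[symmetric])

definition "spine_law = distr (PiM UNIV (\<lambda>_::nat. Q)) H_borel spine_lim"

lemma measurable_spine_lim_Q [measurable]: "spine_lim \<in> measurable (PiM UNIV (\<lambda>_::nat. Q)) H_borel"
  using measurable_spine_lim measurable_cong_sets[OF sets_PiM_Q refl] by blast

lemma prob_on_H_spine_law: "prob_on_H spine_law"
  unfolding prob_on_H_def spine_law_def by (auto intro!: seq.prob_space_distr)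

lemma measurable_case_prod_tmap:
  assumes "sets R = sets H_borel"
  shows "(\<lambda>(w, x). tmap w x) \<in> measurable (Q \<Otimes>\<^sub>M R) H_borel"
proof -
  note [measurable_cong] = assms
  have "(\<lambda>s. tmap (fst s) (snd s)) \<in> measurable (Q \<Otimes>\<^sub>M R) H_borel"
    by (rule measurable_tmap) measurable
  thus ?thesis by (simp add: case_prod_beta')
qed

text \<open>Prepending an independent draw from \<open>Q\<close> to an i.i.d. sequence reproduces
  its law, and by \<open>spine_lim_unfold\<close> prepending \<open>w\<close> acts on the limit as
  \<open>tmap w\<close>.\<close>

lemma X_fixed_point_spine_law: "X_fixed_point Q spine_law"
  unfolding X_fixed_point_altdef
proof
  show "prob_on_H spine_law" by (rule prob_on_H_spine_law)
  let ?S = "PiM UNIV (\<lambda>_::nat. Q)"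
  have "prob_space spine_law" using prob_on_H_spine_law by (simp add: prob_on_H_def)
  then interpret R: prob_space spine_law .
  have sR [measurable_cong]: "sets spine_law = sets H_borel" by (simp add: spine_law_def)
  have id: "distr Q Q (\<lambda>x. x) = Q" by (rule distr_id)
  have "Q \<Otimes>\<^sub>M spine_law = distr Q Q (\<lambda>x. x) \<Otimes>\<^sub>M distr ?S H_borel spine_lim" by (simp add: spine_law_def)
  also have "\<dots> = distr (Q \<Otimes>\<^sub>M ?S) (Q \<Otimes>\<^sub>M H_borel) (\<lambda>(w, \<omega>). (w, spine_lim \<omega>))"
    by (rule pair_measure_distr)
       (use R.sigma_finite_measure_axioms in \<open>auto simp: spine_law_def\<close>)
  finally have "distr (Q \<Otimes>\<^sub>M spine_law) H_borel (\<lambda>(w, x). tmap w x)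
     = distr (Q \<Otimes>\<^sub>M ?S) H_borel ((\<lambda>(w, x). tmap w x) \<circ> (\<lambda>(w, \<omega>). (w, spine_lim \<omega>)))"
    by (simp add: distr_distr measurable_case_prod_tmap)
  also have "\<dots> = distr (Q \<Otimes>\<^sub>M ?S) H_borel (spine_lim \<circ> (\<lambda>(w, \<omega>). case_nat w \<omega>))"
  proof (rule distr_cong)
    fix p assume p: "p \<in> space (Q \<Otimes>\<^sub>M ?S)"
    obtain w \<omega> where [simp]: "p = (w, \<omega>)" by (cases p)
    have "w \<in> H_set" "\<And>i. \<omega> i \<in> H_set" using p by (auto simp: space_pair_measure space_PiM space_Q)
    hence "case_nat w \<omega> i \<in> H_set" for i by (cases i) auto
    from spine_lim_unfold[OF this]
    show "((\<lambda>(w, x). tmap w x) \<circ> (\<lambda>(w, \<omega>). (w, spine_lim \<omega>))) p = (spine_lim \<circ> (\<lambda>(w, \<omega>). case_nat w \<omega>)) p"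
      by simp
  qed auto
  also have "\<dots> = distr (distr (Q \<Otimes>\<^sub>M ?S) ?S (\<lambda>(w, \<omega>). case_nat w \<omega>)) H_borel spine_lim"
    by (rule distr_distr[symmetric]) measurable
  also have "\<dots> = spine_law" by (simp add: seq.PiM_iter spine_law_def)
  finally show "spine_law = distr (Q \<Otimes>\<^sub>M spine_law) H_borel (\<lambda>(w, x). tmap w x)" ..
qed

text \<open>The fixed point equation unrolled k times: X is equal in law to the spine of k
  independent draws from \<open>Q\<close> ended by an independent copy of X.\<close>

lemma X_fixed_point_spine:
  assumes R: "X_fixed_point Q R" and \<phi>: "\<phi> \<in> borel_measurable H_borel"
  shows "(\<integral>\<^sup>+x. \<phi> x \<partial>R) = (\<integral>\<^sup>+\<omega>. \<integral>\<^sup>+x. \<phi> (spine k \<omega> x) \<partial>R \<partial>PiM UNIV (\<lambda>_::nat. Q))"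
  using \<phi>
proof (induction k arbitrary: \<phi>)
  case 0
  thus ?case by (simp add: seq.emeasure_space_1)
next
  case (Suc k)
  have "prob_space R" and sR [measurable_cong]: "sets R = sets H_borel" using R by (auto simp: X_fixed_point_def prob_on_H_def)
  then interpret R: prob_space R by simp
  have spR: "space R = H_set" using sets_eq_imp_space_eq[OF sR] by simp
  note [measurable] = Suc.prems measurable_case_prod_tmap[OF sR]
  let ?S = "PiM UNIV (\<lambda>_::nat. Q)"
  have sp: "(\<lambda>s. spine k (f s) (g s)) \<in> measurable M H_borel"
    if "f \<in> measurable M ?S" "g \<in> measurable M R" for f g k and M :: "'c measure"
    by (rule measurable_spine) (use that in \<open>simp_all add: measurable_cong_sets[OF refl sets_PiM_Q] measurable_cong_sets[OF refl sR]\<close>)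
  have "(\<integral>\<^sup>+x. \<phi> x \<partial>R) = (\<integral>\<^sup>+x. \<phi> x \<partial>distr (Q \<Otimes>\<^sub>M R) H_borel (\<lambda>(w, x). tmap w x))"
    using R by (simp add: X_fixed_point_altdef)
  also have "\<dots> = (\<integral>\<^sup>+p. \<phi> ((\<lambda>(w, x). tmap w x) p) \<partial>(Q \<Otimes>\<^sub>M R))"
    by (rule nn_integral_distr) measurable
  also have "\<dots> = (\<integral>\<^sup>+w. \<integral>\<^sup>+x. \<phi> (tmap w x) \<partial>R \<partial>Q)"
    by (subst R.nn_integral_fst[symmetric]) auto
  also have "\<dots> = (\<integral>\<^sup>+w. \<integral>\<^sup>+\<omega>. \<integral>\<^sup>+x. \<phi> (tmap w (spine k \<omega> x)) \<partial>R \<partial>?S \<partial>Q)"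
  proof (rule nn_integral_cong)
    fix w assume "w \<in> space Q"
    hence "w \<in> H_set" by (simp add: space_Q)
    have "(\<lambda>x. tmap w x) \<in> measurable H_borel H_borel"
      using \<open>w \<in> H_set\<close> by (intro measurable_tmap) auto
    hence "(\<lambda>x. \<phi> (tmap w x)) \<in> borel_measurable H_borel" by measurable
    thus "(\<integral>\<^sup>+x. \<phi> (tmap w x) \<partial>R) = (\<integral>\<^sup>+\<omega>. \<integral>\<^sup>+x. \<phi> (tmap w (spine k \<omega> x)) \<partial>R \<partial>?S)"
      by (rule Suc.IH)
  qed
  also have "\<dots> = (\<integral>\<^sup>+w. \<integral>\<^sup>+\<omega>. \<integral>\<^sup>+x. \<phi> (spine (Suc k) (case_nat w \<omega>) x) \<partial>R \<partial>?S \<partial>Q)" by simp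
  also have "\<dots> = (\<integral>\<^sup>+\<omega>. \<integral>\<^sup>+x. \<phi> (spine (Suc k) \<omega> x) \<partial>R \<partial>?S)"
  proof (rule nn_integral_PiM_Q_Suc[symmetric])
    have "(\<lambda>p. spine (Suc k) (fst p) (snd p)) \<in> measurable (?S \<Otimes>\<^sub>M R) H_borel" by (rule sp) auto
    hence "(\<lambda>p. \<phi> (spine (Suc k) (fst p) (snd p))) \<in> borel_measurable (?S \<Otimes>\<^sub>M R)" by measurable
    thus "(\<lambda>\<omega>. \<integral>\<^sup>+x. \<phi> (spine (Suc k) \<omega> x) \<partial>R) \<in> borel_measurable ?S"
      by (intro R.borel_measurable_nn_integral) (simp add: case_prod_beta')
  qed
  finally show ?case .
qed

text \<open>The mean of a test functional equals that of its k-fold unrolling for every k; as k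
  grows the unrolling forgets its end point, and dominated convergence leaves the mean under
  \<open>spine_law\<close>.\<close>

lemma X_fixed_point_unique:
  assumes R: "X_fixed_point Q R"
  shows "R = spine_law"
proof (rule prob_on_H_eqI)
  show "prob_on_H R" using R by (simp add: X_fixed_point_def)
  show "prob_on_H spine_law" by (rule prob_on_H_spine_law)
  have "prob_space R" and sR [measurable_cong]: "sets R = sets H_borel" using R by (auto simp: X_fixed_point_def prob_on_H_def)
  then interpret R: prob_space R by simp
  have spR: "space R = H_set" using sets_eq_imp_space_eq[OF sR] by simp
  let ?S = "PiM UNIV (\<lambda>_::nat. Q)"
  interpret pair_prob_space ?S R ..
  have sp [measurable]: "(\<lambda>p. spine k (fst p) (snd p)) \<in> measurable (?S \<Otimes>\<^sub>M R) H_borel" for k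
    by (rule measurable_spine) (simp_all add: measurable_cong_sets[OF refl sets_PiM_Q[symmetric]] measurable_cong_sets[OF refl sR[symmetric]])
  fix h :: "(nat \<Rightarrow> complex) \<Rightarrow> real" assume h: "continuous_on UNIV h" "\<And>y. 0 \<le> h y \<and> h y \<le> 1"
  have [measurable]: "h \<in> borel_measurable borel" using h(1) by (rule borel_measurable_continuous_onI)
  have eq: "(\<integral>f. h (evH f) \<partial>R) = (\<integral>p. h (evH (spine k (fst p) (snd p))) \<partial>(?S \<Otimes>\<^sub>M R))" for k
  proof -
    have "(\<integral>f. h (evH f) \<partial>R) = enn2real (\<integral>\<^sup>+f. ennreal (h (evH f)) \<partial>R)"
      by (rule integral_eq_nn_integral) (use h in auto)
    also have "(\<integral>\<^sup>+f. ennreal (h (evH f)) \<partial>R) = (\<integral>\<^sup>+\<omega>. \<integral>\<^sup>+x. ennreal (h (evH (spine k \<omega> x))) \<partial>R \<partial>?S)"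
      by (rule X_fixed_point_spine[OF R]) measurable
    also have "\<dots> = (\<integral>\<^sup>+p. ennreal (h (evH (spine k (fst p) (snd p)))) \<partial>(?S \<Otimes>\<^sub>M R))"
      by (subst R.nn_integral_fst[symmetric]) auto
    also have "enn2real \<dots> = (\<integral>p. h (evH (spine k (fst p) (snd p))) \<partial>(?S \<Otimes>\<^sub>M R))"
      by (rule integral_eq_nn_integral[symmetric]) (use h in auto)
    finally show ?thesis .
  qed
  have lim: "(\<lambda>k. \<integral>p. h (evH (spine k (fst p) (snd p))) \<partial>(?S \<Otimes>\<^sub>M R)) \<longlonglongrightarrow> (\<integral>p. h (evH (spine_lim (fst p))) \<partial>(?S \<Otimes>\<^sub>M R))"
  proof (rule integral_dominated_convergence[where w="\<lambda>_. 1"])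
    show "AE p in ?S \<Otimes>\<^sub>M R. (\<lambda>k. h (evH (spine k (fst p) (snd p)))) \<longlonglongrightarrow> h (evH (spine_lim (fst p)))"
    proof (rule AE_I2)
      fix p assume "p \<in> space (?S \<Otimes>\<^sub>M R)"
      hence *: "\<And>i. fst p i \<in> H_set" "snd p \<in> H_set" by (auto simp: space_pair_measure space_PiM space_Q spR)
      have "(\<lambda>k. evH (spine k (fst p) (snd p))) \<longlonglongrightarrow> evH (spine_lim (fst p))"
        unfolding evH_def
        by (subst limitin_canonical_iff[symmetric], subst euclidean_product_topology[symmetric],
            subst limitin_componentwise) (use * in \<open>auto intro!: spine_LIMSEQ\<close>)
      moreover have "isCont h (evH (spine_lim (fst p)))" using h(1) by (simp add: continuous_on_eq_continuous_at)
      ultimately show "(\<lambda>k. h (evH (spine k (fst p) (snd p)))) \<longlonglongrightarrow> h (evH (spine_lim (fst p)))"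
        by (rule isCont_tendsto_compose[rotated])
    qed
  qed (use h in auto)
  have "(\<integral>f. h (evH f) \<partial>R) = (\<integral>p. h (evH (spine_lim (fst p))) \<partial>(?S \<Otimes>\<^sub>M R))"
    using lim eq by (simp add: LIMSEQ_const_iff flip: eq)
  also have "\<dots> = (\<integral>\<omega>. h (evH (spine_lim \<omega>)) \<partial>distr (?S \<Otimes>\<^sub>M R) ?S fst)"
    by (subst integral_distr) auto
  also have "distr (?S \<Otimes>\<^sub>M R) ?S fst = ?S" by (rule R.distr_pair_fst)
  also have "(\<integral>\<omega>. h (evH (spine_lim \<omega>)) \<partial>?S) = (\<integral>f. h (evH f) \<partial>spine_law)"
    unfolding spine_law_def by (subst integral_distr) auto
  finally show "(\<integral>f. h (evH f) \<partial>R) = (\<integral>f. h (evH f) \<partial>spine_law)" .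
qed

end

section \<open>Unordered trees and the Galton--Watson law\<close>

datatype utree = UNode "utree multiset"

primrec usize :: "utree \<Rightarrow> nat" where
  "usize (UNode M) = Suc (sum_mset (image_mset usize M))"

text \<open>Order of the automorphism group of the rooted tree: permute equal root subtrees, then
  act inside each of them.\<close>

primrec aut :: "utree \<Rightarrow> nat" where
  "aut (UNode M) = (\<Prod>t\<in>set_mset M. fact (count M t)) * prod_mset (image_mset aut M)"

text \<open>Root entry of the resolvent of a finite tree, by Schur complements. For fixed z it is a
  plain recursion on trees; \<open>wtH\<close> turns it into an element of H.\<close>

primrec wt :: "complex \<Rightarrow> utree \<Rightarrow> complex" where
  "wt z (UNode M) = - 1 / (z + sum_mset (image_mset (wt z) M))"

definition wtH :: "utree \<Rightarrow> complex \<Rightarrow> complex" where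
  "wtH t = (\<lambda>z. if z \<in> \<complex>\<^sub>+ then wt z t else 0)"

definition gw :: "utree \<Rightarrow> real" where
  "gw t = exp (- real (usize t)) / real (aut t)"

lemma aut_pos: "0 < aut t"
proof (induction t)
  case (UNode M)
  have "0 < prod_mset (image_mset aut M)"
    using UNode by (induction M) auto
  thus ?case by (simp add: prod_pos)
qed

lemma aut_add_mset: "aut (UNode (add_mset t M)) = Suc (count M t) * aut t * aut (UNode M)"
proof -
  let ?A = "insert t (set_mset M)"
  have "(\<Prod>x\<in>?A. fact (count (add_mset t M) x)) = fact (Suc (count M t)) * (\<Prod>x\<in>?A - {t}. fact (count M x) :: nat)"
    by (subst prod.remove[of _ t], simp, simp, intro arg_cong2[where f="(*)"] prod.cong refl) auto
  also have "\<dots> = Suc (count M t) * (\<Prod>x\<in>?A. fact (count M x))"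
    by (subst prod.remove[of ?A t]) (auto simp: algebra_simps)
  also have "(\<Prod>x\<in>?A. fact (count M x) :: nat) = (\<Prod>x\<in>set_mset M. fact (count M x))"
    by (rule prod.mono_neutral_right) (auto simp: not_in_iff)
  finally show ?thesis
    by (simp only: aut.simps set_mset_add_mset_insert image_mset_add_mset prod_mset.add_mset mult_ac)
qed

lemma gw_pos: "0 < gw t"
  by (simp add: gw_def aut_pos)

text \<open>exp (- size) is multiplicative except for the root, which is counted in
  \<open>UNode M\<close> on both sides; \<open>aut_add_mset\<close> supplies the multiplicity.
  Summed over pairs this becomes the Mecke formula for the children of the root.\<close>

lemma gw_add_mset: "real (Suc (count M t)) * gw (UNode (add_mset t M)) = gw t * gw (UNode M)"
proof -
  have "exp (- real (usize (UNode (add_mset t M)))) = exp (- real (usize t)) * exp (- real (usize (UNode M)))"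
    by (simp add: exp_add[symmetric])
  moreover have "real (aut (UNode (add_mset t M))) = real (Suc (count M t)) * (real (aut t) * real (aut (UNode M)))"
    unfolding aut_add_mset by (simp only: of_nat_mult mult.assoc)
  moreover have "c * (X / A) = e1 / a * (e2 / b)" if "X = e1 * e2" "A = c * (a * b)" "c \<noteq> 0" for c X A e1 e2 a b :: real
    using that by simp
  ultimately show ?thesis unfolding gw_def by (simp only: of_nat_eq_0_iff nat.distinct not_False_eq_True)
qed

lemma wtH_UNode: "wtH (UNode M) = neg_inverseH (\<lambda>z. \<Sum>t\<in>#M. wtH t z)"
  by (auto simp: wtH_def neg_inverseH_def fun_eq_iff)

lemma sum_mset_holomorphic:
  "(\<And>t. t \<in># M \<Longrightarrow> f t holomorphic_on S) \<Longrightarrow> (\<lambda>z. \<Sum>t\<in>#M. f t z) holomorphic_on S"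
  by (induction M) (auto intro!: holomorphic_intros)

lemma Im_sum_mset: "Im (\<Sum>t\<in>#M. f t) = (\<Sum>t\<in>#M. Im (f t))"
  by (induction M) auto

lemma sum_mset_nonneg: "(\<And>t. t \<in># M \<Longrightarrow> 0 \<le> f t) \<Longrightarrow> 0 \<le> (\<Sum>t\<in>#M. f t :: real)"
  by (induction M) auto

lemma wtH_in_H_set: "wtH t \<in> H_set"
proof (induction t)
  case (UNode M)
  show ?case unfolding wtH_UNode
  proof (rule neg_inverseH_in_H_set)
    show "(\<lambda>z. \<Sum>t\<in>#M. wtH t z) holomorphic_on \<complex>\<^sub>+"
      using UNode by (intro sum_mset_holomorphic H_setD(1)) auto
    show "0 \<le> Im (\<Sum>t\<in>#M. wtH t z)" if "0 < Im z" for z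
      unfolding Im_sum_mset using UNode H_setD(2) that by (intro sum_mset_nonneg) (auto intro: less_imp_le)
  qed
qed

section \<open>From unordered trees to ordered lists of root subtrees\<close>

definition poisw :: "nat \<Rightarrow> real" where "poisw k = exp (- 1) / fact k"

lemma poisw_nonneg: "0 \<le> poisw k" by (simp add: poisw_def)

text \<open>The factorial in the Poisson weight cancels the one in the number of orderings of
  \<open>M\<close>, leaving the multiplicity factorials of \<open>aut\<close>. So \<open>gw\<close>
  is the law of the tree with its ordering forgotten.\<close>

lemma gw_UNode:
  "gw (UNode M) = real (card (permutations_of_multiset M)) * (poisw (size M) * prod_mset (image_mset gw M))"
proof -
  have "prod_mset (image_mset gw M) = exp (- real (sum_mset (image_mset usize M))) / real (prod_mset (image_mset aut M))"
    by (induction M) (auto simp: gw_def exp_add[symmetric] field_simps)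
  moreover have "real (card (permutations_of_multiset M)) / fact (size M) = 1 / real (\<Prod>x\<in>set_mset M. fact (count M x))"
    using arg_cong[OF card_permutations_of_multiset_aux[of M], of real]
    by (simp add: field_simps del: of_nat_prod)
  ultimately show ?thesis
    unfolding gw_def usize.simps aut.simps poisw_def
    by (simp add: field_simps exp_add[symmetric] del: of_nat_prod of_nat_Suc) (simp add: exp_add[symmetric] exp_minus field_simps)
qed

lemma nn_integral_swap_count_space:
  fixes g :: "'a \<Rightarrow> 'b \<Rightarrow> ennreal"
  shows "(\<integral>\<^sup>+x. \<integral>\<^sup>+y. g x y \<partial>count_space UNIV \<partial>count_space UNIV) = (\<integral>\<^sup>+y. \<integral>\<^sup>+x. g x y \<partial>count_space UNIV \<partial>count_space UNIV)"
  using nn_integral_fst_count_space[of "\<lambda>(x, y). g x y"] nn_integral_snd_count_space[of "\<lambda>(x, y). g x y"] by simp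

lemma nn_integral_count_space_fibres:
  fixes g :: "'a \<Rightarrow> ennreal" and h :: "'a \<Rightarrow> 'b"
  shows "(\<integral>\<^sup>+x. g x \<partial>count_space UNIV) = (\<integral>\<^sup>+y. \<integral>\<^sup>+x. g x * indicator {x. h x = y} x \<partial>count_space UNIV \<partial>count_space UNIV)"
proof -
  have "(\<integral>\<^sup>+y. g x * indicator {x. h x = y} x \<partial>count_space UNIV) = g x" for x
    by (subst nn_integral_count_space'[where A="{h x}"]) auto
  thus ?thesis by (subst nn_integral_swap_count_space) simp
qed

lemma nn_integral_list_Cons:
  fixes g :: "'a list \<Rightarrow> ennreal"
  assumes "g [] = 0"
  shows "(\<integral>\<^sup>+ts. g ts \<partial>count_space UNIV) = (\<integral>\<^sup>+t. \<integral>\<^sup>+ts. g (t # ts) \<partial>count_space UNIV \<partial>count_space UNIV)"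
proof -
  have "(\<integral>\<^sup>+ts. g ts \<partial>count_space UNIV) = (\<integral>\<^sup>+ts. g ts \<partial>count_space (- {[]}))"
    by (rule nn_integral_count_space_eq) (use assms in auto)
  also have "\<dots> = (\<integral>\<^sup>+p. g ((\<lambda>(t, ts). t # ts) p) \<partial>count_space UNIV)"
    by (rule nn_integral_bij_count_space[symmetric])
       (auto simp: bij_betw_def inj_on_def neq_Nil_conv image_def)
  also have "\<dots> = (\<integral>\<^sup>+t. \<integral>\<^sup>+ts. g (t # ts) \<partial>count_space UNIV \<partial>count_space UNIV)"
    by (subst nn_integral_fst_count_space[symmetric]) simp
  finally show ?thesis .
qed

text \<open>Group the lists by their multiset: by \<open>gw_UNode\<close> each fibre consists of
  equal terms adding up to the weight of the unordered tree.\<close>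

lemma nn_integral_gw_UNode:
  fixes F :: "utree multiset \<Rightarrow> ennreal"
  shows "(\<integral>\<^sup>+M. ennreal (gw (UNode M)) * F M \<partial>count_space UNIV)
    = (\<integral>\<^sup>+ts. ennreal (poisw (length ts) * prod_list (map gw ts)) * F (mset ts) \<partial>count_space UNIV)"
proof -
  have nn: "0 \<le> prod_mset (image_mset gw M)" for M
    by (induction M) (auto simp: gw_pos less_imp_le)
  have "(\<integral>\<^sup>+ts. (ennreal (poisw (length ts) * prod_list (map gw ts)) * F (mset ts)) * indicator {ts. mset ts = M} ts \<partial>count_space UNIV)
      = ennreal (gw (UNode M)) * F M" for M
  proof -
    have "(\<integral>\<^sup>+ts. (ennreal (poisw (length ts) * prod_list (map gw ts)) * F (mset ts)) * indicator {ts. mset ts = M} ts \<partial>count_space UNIV)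
       = (\<Sum>ts\<in>permutations_of_multiset M. (ennreal (poisw (length ts) * prod_list (map gw ts)) * F (mset ts)) * indicator {ts. mset ts = M} ts)"
      by (rule nn_integral_count_space'[OF finite_permutations_of_multiset]) (auto simp: permutations_of_multiset_def)
    also have "\<dots> = (\<Sum>ts\<in>permutations_of_multiset M. ennreal (poisw (size M) * prod_mset (image_mset gw M)) * F M)"
    proof (rule sum.cong[OF refl])
      fix ts assume "ts \<in> permutations_of_multiset M"
      hence ts: "mset ts = M" by (simp add: permutations_of_multiset_def)
      hence "length ts = size M" by auto
      moreover have "prod_list (map gw ts) = prod_mset (image_mset gw M)" 
        unfolding ts[symmetric] by (simp add: prod_mset_prod_list[symmetric])
      ultimately show "(ennreal (poisw (length ts) * prod_list (map gw ts)) * F (mset ts)) * indicator {ts. mset ts = M} ts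
         = ennreal (poisw (size M) * prod_mset (image_mset gw M)) * F M" using ts by simp
    qed
    also have "\<dots> = ennreal (gw (UNode M)) * F M"
      using nn[of M] poisw_nonneg[of "size M"]
      by (simp add: gw_UNode[of M] ennreal_mult'[where a="real _"] ennreal_of_nat_eq_real_of_nat mult.assoc)
    finally show ?thesis .
  qed
  thus ?thesis
    by (subst nn_integral_count_space_fibres[where h=mset and g="\<lambda>ts. ennreal (poisw (length ts) * prod_list (map gw ts)) * F (mset ts)"]) simp
qed

definition listw :: "utree set \<Rightarrow> nat \<Rightarrow> utree list \<Rightarrow> ennreal" where
  "listw T k ts = ennreal (prod_list (map gw ts)) * indicator {ts. length ts = k \<and> set ts \<subseteq> T} ts"

lemma prod_list_gw_nonneg: "0 \<le> prod_list (map gw ts)"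
  by (induction ts) (auto simp: gw_pos less_imp_le)

lemma listw_Cons: "listw T (Suc k) (t # ts) = ennreal (gw t) * indicator T t * listw T k ts"
  using gw_pos[of t] prod_list_gw_nonneg
  by (auto simp: listw_def indicator_def ennreal_mult less_imp_le)

lemma listw_Nil: "listw T (Suc k) [] = 0"
  by (simp add: listw_def)

lemma nn_integral_listw:
  "(\<integral>\<^sup>+ts. listw T k ts \<partial>count_space UNIV) = (\<integral>\<^sup>+t. ennreal (gw t) * indicator T t \<partial>count_space UNIV) ^ k"
proof (induction k)
  case 0
  have "(\<integral>\<^sup>+ts. listw T 0 ts \<partial>count_space UNIV) = (\<Sum>ts\<in>{[]}. listw T 0 ts)"
    by (rule nn_integral_count_space') (auto simp: listw_def)
  thus ?case by (simp add: listw_def)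
next
  case (Suc k)
  have "(\<integral>\<^sup>+ts. listw T (Suc k) ts \<partial>count_space UNIV)
      = (\<integral>\<^sup>+t. \<integral>\<^sup>+ts. ennreal (gw t) * indicator T t * listw T k ts \<partial>count_space UNIV \<partial>count_space UNIV)"
    by (subst nn_integral_list_Cons) (simp_all add: listw_Nil listw_Cons)
  also have "\<dots> = (\<integral>\<^sup>+t. ennreal (gw t) * indicator T t \<partial>count_space UNIV) ^ Suc k"
    by (simp add: nn_integral_cmult nn_integral_multc Suc mult.commute)
  finally show ?case .
qed

lemma nn_integral_gw_UNode_restrict:
  fixes F :: "utree multiset \<Rightarrow> ennreal"
  shows "(\<integral>\<^sup>+M. ennreal (gw (UNode M)) * (indicator {M. set_mset M \<subseteq> T} M * F M) \<partial>count_space UNIV)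
    = (\<integral>\<^sup>+k. ennreal (poisw k) * (\<integral>\<^sup>+ts. listw T k ts * F (mset ts) \<partial>count_space UNIV) \<partial>count_space UNIV)"
proof -
  have "(\<integral>\<^sup>+k. ennreal (poisw k) * (\<integral>\<^sup>+ts. listw T k ts * F (mset ts) \<partial>count_space UNIV) \<partial>count_space UNIV)
     = (\<integral>\<^sup>+k. \<integral>\<^sup>+ts. ennreal (poisw k) * (listw T k ts * F (mset ts)) \<partial>count_space UNIV \<partial>count_space UNIV)"
    by (simp add: nn_integral_cmult)
  also have "\<dots> = (\<integral>\<^sup>+ts. \<integral>\<^sup>+k. ennreal (poisw k) * (listw T k ts * F (mset ts)) \<partial>count_space UNIV \<partial>count_space UNIV)"
    by (rule nn_integral_swap_count_space)
  also have "\<dots> = (\<integral>\<^sup>+ts. ennreal (poisw (length ts) * prod_list (map gw ts)) * (indicator {M. set_mset M \<subseteq> T} (mset ts) * F (mset ts)) \<partial>count_space UNIV)"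
  proof (rule nn_integral_cong)
    fix ts
    have "(\<integral>\<^sup>+k. ennreal (poisw k) * (listw T k ts * F (mset ts)) \<partial>count_space UNIV)
       = (\<Sum>k\<in>{length ts}. ennreal (poisw k) * (listw T k ts * F (mset ts)))"
      by (rule nn_integral_count_space') (auto simp: listw_def)
    also have "\<dots> = ennreal (poisw (length ts)) * ennreal (prod_list (map gw ts)) * (indicator {M. set_mset M \<subseteq> T} (mset ts) * F (mset ts))"
      by (auto simp: listw_def indicator_def mult_ac)
    also have "ennreal (poisw (length ts)) * ennreal (prod_list (map gw ts)) = ennreal (poisw (length ts) * prod_list (map gw ts))"
      by (simp add: ennreal_mult prod_list_gw_nonneg poisw_nonneg)
    finally show "(\<integral>\<^sup>+k. ennreal (poisw k) * (listw T k ts * F (mset ts)) \<partial>count_space UNIV)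
      = ennreal (poisw (length ts) * prod_list (map gw ts)) * (indicator {M. set_mset M \<subseteq> T} (mset ts) * F (mset ts))" .
  qed
  finally show ?thesis by (simp add: nn_integral_gw_UNode)
qed

section \<open>Trees of height below \<open>d\<close> and extinction\<close>

primrec hset :: "nat \<Rightarrow> utree set" where
  "hset 0 = {}"
| "hset (Suc d) = {UNode M |M. set_mset M \<subseteq> hset d}"

lemma hset_mono: "hset d \<subseteq> hset (Suc d)"
  by (induction d) auto

lemma hset_mono': "d \<le> d' \<Longrightarrow> hset d \<subseteq> hset d'"
  by (rule lift_Suc_mono_le[of hset]) (use hset_mono in auto)

lemma ex_hset: "\<exists>d. t \<in> hset d"
proof (induction t)
  case (UNode M)
  then obtain D where D: "\<And>t. t \<in># M \<Longrightarrow> t \<in> hset (D t)" by metis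
  have "set_mset M \<subseteq> hset (Max (D ` set_mset M))"
  proof
    fix t assume "t \<in># M"
    hence "D t \<le> Max (D ` set_mset M)" by (intro Max_ge) auto
    thus "t \<in> hset (Max (D ` set_mset M))" using D[OF \<open>t \<in># M\<close>] hset_mono' by blast
  qed
  hence "UNode M \<in> hset (Suc (Max (D ` set_mset M)))" by auto
  thus ?case by blast
qed

lemma bij_UNode: "bij UNode"
  by (auto simp: bij_def inj_def) (metis utree.exhaust rangeI)

lemma nn_integral_utree:
  "(\<integral>\<^sup>+t. F t \<partial>count_space UNIV) = (\<integral>\<^sup>+M. F (UNode M) \<partial>count_space UNIV)"
  by (rule nn_integral_bij_count_space[OF bij_UNode, symmetric])

lemma nn_integral_hset_Suc:
  fixes F :: "utree \<Rightarrow> ennreal"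
  shows "(\<integral>\<^sup>+t. ennreal (gw t) * (indicator (hset (Suc d)) t * F t) \<partial>count_space UNIV)
    = (\<integral>\<^sup>+k. ennreal (poisw k) * (\<integral>\<^sup>+ts. listw (hset d) k ts * F (UNode (mset ts)) \<partial>count_space UNIV) \<partial>count_space UNIV)"
proof -
  have "(\<integral>\<^sup>+t. ennreal (gw t) * (indicator (hset (Suc d)) t * F t) \<partial>count_space UNIV)
    = (\<integral>\<^sup>+M. ennreal (gw (UNode M)) * (indicator {M. set_mset M \<subseteq> hset d} M * F (UNode M)) \<partial>count_space UNIV)"
    by (subst nn_integral_utree) (auto intro!: nn_integral_cong simp: indicator_def)
  thus ?thesis by (simp only: nn_integral_gw_UNode_restrict)
qed

lemma nn_integral_hset_SUP:
  fixes F :: "utree \<Rightarrow> ennreal"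
  shows "(\<integral>\<^sup>+t. ennreal (gw t) * F t \<partial>count_space UNIV) = (SUP d. \<integral>\<^sup>+t. ennreal (gw t) * (indicator (hset d) t * F t) \<partial>count_space UNIV)"
proof -
  have "(SUP d. ennreal (gw t) * (indicator (hset d) t * F t)) = ennreal (gw t) * F t" for t
  proof (rule antisym)
    show "(SUP d. ennreal (gw t) * (indicator (hset d) t * F t)) \<le> ennreal (gw t) * F t"
      by (intro SUP_least) (auto simp: indicator_def)
    obtain d where "t \<in> hset d" using ex_hset by blast
    thus "ennreal (gw t) * F t \<le> (SUP d. ennreal (gw t) * (indicator (hset d) t * F t))"
      by (intro SUP_upper2[of d]) auto
  qed
  moreover have "incseq (\<lambda>d t. ennreal (gw t) * (indicator (hset d) t * F t))"
    using hset_mono by (auto simp: incseq_Suc_iff le_fun_def indicator_def intro!: mult_left_mono)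
  ultimately show ?thesis
    by (subst nn_integral_monotone_convergence_SUP[symmetric]) auto
qed

text \<open>Iterates from 0 of the Poisson(1) generating function exp (s - 1): the probability of
  extinction by generation \<open>d\<close>.\<close>

primrec extinct :: "nat \<Rightarrow> real" where
  "extinct 0 = 0"
| "extinct (Suc d) = exp (extinct d - 1)"

lemma extinct_bounds: "0 \<le> extinct d \<and> extinct d \<le> 1"
  by (induction d) auto

text \<open>Criticality is used here: the limit solves L = exp (L - 1), that is ln L = L - 1, where
  the logarithm meets its tangent only at 1.\<close>

lemma extinct_tendsto: "extinct \<longlonglongrightarrow> 1"
proof -
  have "incseq extinct"
  proof (rule incseq_SucI)
    show "extinct d \<le> extinct (Suc d)" for d by (induction d) auto
  qed
  moreover have "bdd_above (range extinct)" using extinct_bounds by (auto simp: bdd_above_def)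
  ultimately obtain L where L: "extinct \<longlonglongrightarrow> L" using LIMSEQ_incseq_SUP by blast
  have "(\<lambda>d. exp (extinct d - 1)) \<longlonglongrightarrow> exp (L - 1)" by (intro tendsto_intros L)
  moreover have "(\<lambda>d. extinct (Suc d)) \<longlonglongrightarrow> L" using L by (rule LIMSEQ_Suc)
  ultimately have "L = exp (L - 1)" using LIMSEQ_unique by auto
  hence "0 < L" "ln L = L - 1" by (metis exp_gt_zero, metis ln_exp)
  hence "L = 1" by (rule ln_eq_minus_one)
  thus ?thesis using L by simp
qed

lemma nn_integral_gw_hset: "(\<integral>\<^sup>+t. ennreal (gw t) * indicator (hset d) t \<partial>count_space UNIV) = ennreal (extinct d)"
proof (induction d)
  case (Suc d)
  have "(\<integral>\<^sup>+t. ennreal (gw t) * indicator (hset (Suc d)) t \<partial>count_space UNIV)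
     = (\<integral>\<^sup>+k. ennreal (poisw k) * ennreal (extinct d) ^ k \<partial>count_space UNIV)"
    using nn_integral_hset_Suc[of d "\<lambda>_. 1"] by (simp add: nn_integral_listw Suc)
  also have "\<dots> = (\<Sum>k. ennreal (poisw k * extinct d ^ k))"
    using extinct_bounds[of d] by (simp add: nn_integral_count_space_nat ennreal_mult poisw_nonneg ennreal_power)
  also have "\<dots> = ennreal (extinct (Suc d))"
  proof (rule suminf_ennreal_eq)
    have "(\<lambda>k. exp (- 1) * (extinct d ^ k /\<^sub>R fact k)) sums (exp (- 1) * exp (extinct d))"
      by (intro sums_mult exp_converges)
    thus "(\<lambda>k. poisw k * extinct d ^ k) sums extinct (Suc d)"
      by (simp add: poisw_def exp_diff exp_minus field_simps)
    show "0 \<le> poisw k * extinct d ^ k" for k using extinct_bounds[of d] by (simp add: poisw_def)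
  qed
  finally show ?case .
qed simp

text \<open>Total mass one is almost sure extinction: the trees of height below \<open>d\<close>
  have mass \<open>extinct d\<close> and exhaust all trees.\<close>

lemma nn_integral_gw: "(\<integral>\<^sup>+t. ennreal (gw t) \<partial>count_space UNIV) = 1"
proof -
  have "(\<lambda>d. ennreal (extinct d)) \<longlonglongrightarrow> ennreal 1" by (intro tendsto_intros extinct_tendsto)
  moreover have "incseq (\<lambda>d. ennreal (extinct d))"
  proof (rule incseq_SucI)
    show "ennreal (extinct d) \<le> ennreal (extinct (Suc d))" for d
      unfolding nn_integral_gw_hset[symmetric] using hset_mono[of d]
      by (intro nn_integral_mono) (auto simp: indicator_def)
  qed
  ultimately have "(SUP d. ennreal (extinct d)) = 1" using LIMSEQ_SUP LIMSEQ_unique ennreal_1 by metis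
  thus ?thesis using nn_integral_hset_SUP[of "\<lambda>_. 1"] by (simp add: nn_integral_gw_hset)
qed

definition gw_pmf :: "utree pmf" where "gw_pmf = embed_pmf gw"

lemma pmf_gw_pmf [simp]: "pmf gw_pmf t = gw t"
  unfolding gw_pmf_def by (rule pmf_embed_pmf) (auto simp: less_imp_le gw_pos nn_integral_gw)

section \<open>Identification of Q\<close>

text \<open>Hybrid sequences: the first entries come from given trees, the rest stay free. They
  allow the coordinates drawn from \<open>Q\<close> to be exchanged for trees one at a time.\<close>

primrec prep :: "utree list \<Rightarrow> (nat \<Rightarrow> complex \<Rightarrow> complex) \<Rightarrow> nat \<Rightarrow> complex \<Rightarrow> complex" where
  "prep [] \<omega> = \<omega>"
| "prep (t # ts) \<omega> = case_nat (wtH t) (prep ts \<omega>)"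

lemma sum_prep: "(\<Sum>i<length ts. prep ts \<omega> i z) = (\<Sum>t\<in>#mset ts. wtH t z)"
  by (induction ts) (simp_all add: sum.lessThan_Suc_shift del: sum.lessThan_Suc)

definition gw_map :: "nat \<Rightarrow> (nat \<Rightarrow> complex \<Rightarrow> complex) \<Rightarrow> complex \<Rightarrow> complex" where
  "gw_map k ws = neg_inverseH (\<lambda>z. \<Sum>i<k. ws i z)"

lemma gw_map_prep: "gw_map (length ts) (prep ts \<omega>) = wtH (UNode (mset ts))"
  by (simp add: gw_map_def wtH_UNode sum_prep)

lemma gw_map_in_H_set:
  assumes "\<And>i. ws i \<in> H_set"
  shows "gw_map k ws \<in> H_set"
  unfolding gw_map_def
proof (rule neg_inverseH_in_H_set)
  show "(\<lambda>z. \<Sum>i<k. ws i z) holomorphic_on \<complex>\<^sub>+" using assms by (intro holomorphic_intros H_setD(1))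
  show "0 \<le> Im (\<Sum>i<k. ws i z)" if "0 < Im z" for z
    unfolding Im_sum using H_setD(2)[OF assms that] by (intro sum_nonneg) (simp add: less_imp_le)
qed

context
  fixes Q assumes GW: "GW_resolvent_fixed_point Q"
begin

lemma prob_on_H_Q: "prob_on_H Q" using GW by (simp add: GW_resolvent_fixed_point_def)

interpretation Q: prob_space Q using prob_on_H_Q by (simp add: prob_on_H_def)

interpretation seq: sequence_space Q ..

lemmas sQ [measurable_cong] = sets_Q[OF prob_on_H_Q]

abbreviation "SQ \<equiv> PiM UNIV (\<lambda>_::nat. Q)"

lemma measurable_gw_map: "gw_map k \<in> measurable SQ H_borel"
proof (rule measurable_H_borelI)
  show "gw_map k ws \<in> H_set" if "ws \<in> space SQ" for ws
    using that by (intro gw_map_in_H_set) (auto simp: space_PiM space_Q[OF prob_on_H_Q])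
  have "(\<lambda>ws. ws i) \<in> measurable SQ Q" for i by measurable
  hence [measurable]: "(\<lambda>ws. ws i z) \<in> borel_measurable SQ" for i z
    by (rule measurable_compose) (simp add: measurable_cong_sets[OF sQ refl])
  show "(\<lambda>ws. gw_map k ws z) \<in> borel_measurable SQ" if "0 < Im z" for z
    using that by (simp add: gw_map_def neg_inverseH_def) measurable
qed

lemma measurable_gw_map_pair: "(\<lambda>(k, ws). gw_map k ws) \<in> measurable (measure_pmf (poisson_pmf 1) \<Otimes>\<^sub>M SQ) H_borel"
proof -
  have "sets (measure_pmf (poisson_pmf 1) \<Otimes>\<^sub>M SQ) = sets (count_space UNIV \<Otimes>\<^sub>M SQ)"
    by (intro sets_pair_measure_cong) auto
  moreover have "(\<lambda>(k, ws). gw_map k ws) \<in> measurable (count_space UNIV \<Otimes>\<^sub>M SQ) H_borel"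
    by (rule measurable_pair_measure_countable1) (auto intro: measurable_gw_map)
  ultimately show ?thesis using measurable_cong_sets[OF _ refl] by blast
qed

lemma Q_eq: "Q = distr (measure_pmf (poisson_pmf 1) \<Otimes>\<^sub>M SQ) H_borel (\<lambda>(k, ws). gw_map k ws)"
  using GW by (simp add: GW_resolvent_fixed_point_def gw_map_def neg_inverseH_def)

lemma nn_integral_Q:
  assumes [measurable]: "\<psi> \<in> borel_measurable H_borel"
  shows "(\<integral>\<^sup>+w. \<psi> w \<partial>Q) = (\<integral>\<^sup>+k. ennreal (poisw k) * (\<integral>\<^sup>+ws. \<psi> (gw_map k ws) \<partial>SQ) \<partial>count_space UNIV)"
proof -
  note [measurable] = measurable_gw_map_pair
  have "(\<integral>\<^sup>+w. \<psi> w \<partial>Q) = (\<integral>\<^sup>+p. \<psi> ((\<lambda>(k, ws). gw_map k ws) p) \<partial>(measure_pmf (poisson_pmf 1) \<Otimes>\<^sub>M SQ))"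
    using arg_cong[OF Q_eq, of "\<lambda>M. \<integral>\<^sup>+w. \<psi> w \<partial>M"] nn_integral_distr[OF measurable_gw_map_pair, of \<psi>]
    by simp
  also have "\<dots> = (\<integral>\<^sup>+k. \<integral>\<^sup>+ws. \<psi> (gw_map k ws) \<partial>SQ \<partial>measure_pmf (poisson_pmf 1))"
    by (subst seq.nn_integral_fst[symmetric]) auto
  also have "\<dots> = (\<integral>\<^sup>+k. ennreal (poisw k) * (\<integral>\<^sup>+ws. \<psi> (gw_map k ws) \<partial>SQ) \<partial>count_space UNIV)"
    by (simp add: nn_integral_measure_pmf poisw_def)
  finally show ?thesis .
qed

text \<open>\<open>Q\<close> dominates the law of \<open>wtH\<close> restricted to trees of height below \<open>d\<close>, by induction on \<open>d\<close>;
  as the Galton--Watson tree is finite, nothing is lost in the limit \<open>d \<rightarrow> \<infinity>\<close>.\<close>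
definition dominates :: "utree set \<Rightarrow> bool" where
  "dominates T \<longleftrightarrow> (\<forall>\<psi>\<in>borel_measurable H_borel.
     (\<integral>\<^sup>+t. ennreal (gw t) * (indicator T t * \<psi> (wtH t)) \<partial>count_space UNIV) \<le> (\<integral>\<^sup>+w. \<psi> w \<partial>Q))"

lemma measurable_case_nat_const:
  assumes "w \<in> H_set" shows "case_nat w \<in> measurable SQ SQ"
proof -
  have "(\<lambda>\<omega>. (\<lambda>(w, \<omega>). case_nat w \<omega>) (w, \<omega>)) \<in> measurable SQ SQ"
    by (rule measurable_compose[OF _ measurable_case_nat_Q[OF prob_on_H_Q]])
       (use assms in \<open>simp add: space_Q[OF prob_on_H_Q]\<close>)
  thus ?thesis by simp
qed

text \<open>Tensorises the domination: each step uses the hypothesis for one coordinate only, while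
  the tail remains an i.i.d. sequence from \<open>Q\<close>.\<close>

lemma dominates_list:
  assumes dom: "dominates T" and \<phi>: "\<phi> \<in> borel_measurable SQ"
  shows "(\<integral>\<^sup>+ts. listw T k ts * (\<integral>\<^sup>+\<omega>. \<phi> (prep ts \<omega>) \<partial>SQ) \<partial>count_space UNIV) \<le> (\<integral>\<^sup>+\<omega>. \<phi> \<omega> \<partial>SQ)"
  using \<phi>
proof (induction k arbitrary: \<phi>)
  case 0
  have "(\<integral>\<^sup>+ts. listw T 0 ts * (\<integral>\<^sup>+\<omega>. \<phi> (prep ts \<omega>) \<partial>SQ) \<partial>count_space UNIV)
     = (\<Sum>ts\<in>{[]}. listw T 0 ts * (\<integral>\<^sup>+\<omega>. \<phi> (prep ts \<omega>) \<partial>SQ))"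
    by (rule nn_integral_count_space') (auto simp: listw_def)
  thus ?case by (simp add: listw_def)
next
  case (Suc k)
  note [measurable] = Suc.prems
  \<comment> \<open>With all later coordinates integrated out, a functional of the first one is
    left, to which \<open>dominates T\<close> applies.\<close>
  define \<psi> where "\<psi> = (\<lambda>w. \<integral>\<^sup>+\<omega>. \<phi> (case_nat w \<omega>) \<partial>SQ)"
  have \<psi>m: "\<psi> \<in> borel_measurable H_borel"
  proof -
    have "(\<lambda>p. \<phi> ((\<lambda>(w, \<omega>). case_nat w \<omega>) p)) \<in> borel_measurable (Q \<Otimes>\<^sub>M SQ)" by measurable
    hence "(\<lambda>(w, \<omega>). \<phi> (case_nat w \<omega>)) \<in> borel_measurable (Q \<Otimes>\<^sub>M SQ)" by (simp add: case_prod_beta')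
    hence "\<psi> \<in> borel_measurable Q" unfolding \<psi>_def by (rule seq.borel_measurable_nn_integral)
    thus ?thesis by (simp add: measurable_cong_sets[OF sQ refl])
  qed
  have "(\<integral>\<^sup>+ts. listw T (Suc k) ts * (\<integral>\<^sup>+\<omega>. \<phi> (prep ts \<omega>) \<partial>SQ) \<partial>count_space UNIV)
     = (\<integral>\<^sup>+t. \<integral>\<^sup>+ts. (ennreal (gw t) * indicator T t) * (listw T k ts * (\<integral>\<^sup>+\<omega>. \<phi> (case_nat (wtH t) (prep ts \<omega>)) \<partial>SQ)) \<partial>count_space UNIV \<partial>count_space UNIV)"
    by (subst nn_integral_list_Cons) (simp_all add: listw_Nil listw_Cons mult.assoc)
  also have "\<dots> = (\<integral>\<^sup>+t. ennreal (gw t) * (indicator T t * (\<integral>\<^sup>+ts. listw T k ts * (\<integral>\<^sup>+\<omega>. \<phi> (case_nat (wtH t) (prep ts \<omega>)) \<partial>SQ) \<partial>count_space UNIV)) \<partial>count_space UNIV)"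
    by (simp add: nn_integral_cmult mult.assoc)
  also have "\<dots> \<le> (\<integral>\<^sup>+t. ennreal (gw t) * (indicator T t * \<psi> (wtH t)) \<partial>count_space UNIV)"
  proof (intro nn_integral_mono mult_left_mono)
    fix t
    have "(\<lambda>\<omega>. \<phi> (case_nat (wtH t) \<omega>)) \<in> borel_measurable SQ"
      by (rule measurable_compose[OF measurable_case_nat_const[OF wtH_in_H_set] Suc.prems])
    thus "(\<integral>\<^sup>+ts. listw T k ts * (\<integral>\<^sup>+\<omega>. \<phi> (case_nat (wtH t) (prep ts \<omega>)) \<partial>SQ) \<partial>count_space UNIV) \<le> \<psi> (wtH t)"
      unfolding \<psi>_def by (rule Suc.IH)
  qed auto
  also have "\<dots> \<le> (\<integral>\<^sup>+w. \<psi> w \<partial>Q)" using dom \<psi>m by (auto simp: dominates_def)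
  also have "\<dots> = (\<integral>\<^sup>+\<omega>. \<phi> \<omega> \<partial>SQ)"
    unfolding \<psi>_def by (rule nn_integral_PiM_Q_Suc[OF prob_on_H_Q, symmetric]) fact
  finally show ?case .
qed

lemma dominates_hset: "dominates (hset d)"
proof (induction d)
  case 0
  show ?case by (simp add: dominates_def)
next
  case (Suc d)
  show ?case unfolding dominates_def
  proof
    fix \<psi> :: "(complex \<Rightarrow> complex) \<Rightarrow> ennreal" assume \<psi>: "\<psi> \<in> borel_measurable H_borel"
    have "(\<integral>\<^sup>+t. ennreal (gw t) * (indicator (hset (Suc d)) t * \<psi> (wtH t)) \<partial>count_space UNIV)
      = (\<integral>\<^sup>+k. ennreal (poisw k) * (\<integral>\<^sup>+ts. listw (hset d) k ts * \<psi> (wtH (UNode (mset ts))) \<partial>count_space UNIV) \<partial>count_space UNIV)"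
      by (rule nn_integral_hset_Suc)
    also have "\<dots> \<le> (\<integral>\<^sup>+k. ennreal (poisw k) * (\<integral>\<^sup>+ws. \<psi> (gw_map k ws) \<partial>SQ) \<partial>count_space UNIV)"
    proof (intro nn_integral_mono mult_left_mono)
      fix k
      have "(\<integral>\<^sup>+ts. listw (hset d) k ts * \<psi> (wtH (UNode (mset ts))) \<partial>count_space UNIV)
         = (\<integral>\<^sup>+ts. listw (hset d) k ts * (\<integral>\<^sup>+\<omega>. \<psi> (gw_map k (prep ts \<omega>)) \<partial>SQ) \<partial>count_space UNIV)"
      proof (rule nn_integral_cong)
        fix ts
        \<comment> \<open>\<open>gw_map k\<close> reads only the first k entries, and these are the
          trees of \<open>ts\<close>; integrating over the tail of mass one changes nothing.\<close>
        show "listw (hset d) k ts * \<psi> (wtH (UNode (mset ts))) = listw (hset d) k ts * (\<integral>\<^sup>+\<omega>. \<psi> (gw_map k (prep ts \<omega>)) \<partial>SQ)"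
        proof (cases "length ts = k")
          case True
          thus ?thesis by (simp add: gw_map_prep[of ts, unfolded True] seq.emeasure_space_1)
        qed (simp add: listw_def)
      qed
      also have "\<dots> \<le> (\<integral>\<^sup>+ws. \<psi> (gw_map k ws) \<partial>SQ)"
        by (rule dominates_list[OF Suc]) (rule measurable_compose[OF measurable_gw_map \<psi>])
      finally show "(\<integral>\<^sup>+ts. listw (hset d) k ts * \<psi> (wtH (UNode (mset ts))) \<partial>count_space UNIV) \<le> (\<integral>\<^sup>+ws. \<psi> (gw_map k ws) \<partial>SQ)" .
    qed auto
    also have "\<dots> = (\<integral>\<^sup>+w. \<psi> w \<partial>Q)" by (rule nn_integral_Q[OF \<psi>, symmetric])
    finally show "(\<integral>\<^sup>+t. ennreal (gw t) * (indicator (hset (Suc d)) t * \<psi> (wtH t)) \<partial>count_space UNIV) \<le> (\<integral>\<^sup>+w. \<psi> w \<partial>Q)" .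
  qed
qed

text \<open>Domination between two probability measures is equality: the inequality for
  \<open>A\<close> and for its complement must both be sharp.\<close>

lemma GW_fixed_point_eq: "Q = distr (measure_pmf gw_pmf) H_borel wtH"
proof (rule measure_eqI)
  let ?P = "distr (measure_pmf gw_pmf) H_borel wtH"
  have m: "wtH \<in> measurable (measure_pmf gw_pmf) H_borel" by (simp add: wtH_in_H_set)
  interpret P: prob_space ?P by (rule measure_pmf.prob_space_distr[OF m])
  show "sets Q = sets ?P" by (simp add: sQ)
  have le: "emeasure ?P A \<le> emeasure Q A" if A: "A \<in> sets H_borel" for A
  proof -
    have "emeasure ?P A = (\<integral>\<^sup>+w. indicator A w \<partial>?P)" using A by simp
    also have "\<dots> = (\<integral>\<^sup>+t. indicator A (wtH t) \<partial>measure_pmf gw_pmf)"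
      by (rule nn_integral_distr[OF m]) (use A in simp)
    also have "\<dots> = (\<integral>\<^sup>+t. ennreal (gw t) * indicator A (wtH t) \<partial>count_space UNIV)"
      by (simp add: nn_integral_measure_pmf)
    also have "\<dots> = (SUP d. \<integral>\<^sup>+t. ennreal (gw t) * (indicator (hset d) t * indicator A (wtH t)) \<partial>count_space UNIV)"
      by (rule nn_integral_hset_SUP)
    also have "\<dots> \<le> (\<integral>\<^sup>+w. indicator A w \<partial>Q)"
      by (intro SUP_least dominates_hset[unfolded dominates_def, rule_format]) (use A in simp)
    also have "\<dots> = emeasure Q A" using A by (simp add: sQ)
    finally show ?thesis .
  qed
  fix A assume "A \<in> sets Q"
  hence A: "A \<in> sets H_borel" by (simp add: sQ)
  have AQ: "A \<in> Q.events" "A \<in> P.events" using A by (simp_all add: sQ)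
  have "P.prob A \<le> Q.prob A"
    using le[OF A] by (simp add: P.emeasure_eq_measure Q.emeasure_eq_measure)
  moreover have "P.prob (space ?P - A) \<le> Q.prob (space Q - A)"
    using le[of "H_set - A"] A sets.compl_sets[OF A]
    by (simp add: P.emeasure_eq_measure Q.emeasure_eq_measure space_Q[OF prob_on_H_Q])
  ultimately have "P.prob A = Q.prob A" using P.prob_compl[OF AQ(2)] Q.prob_compl[OF AQ(1)] by simp
  thus "emeasure Q A = emeasure ?P A" by (simp add: P.emeasure_eq_measure Q.emeasure_eq_measure)
qed

end

section \<open>The mean of X(z) as a mean logarithmic derivative\<close>

text \<open>Unconditional summation permits the reindexing and regrouping of double sums over pairs
  of trees in the Mecke formula.\<close>

lemma pmf_has_sum:
  fixes f :: "'a \<Rightarrow> complex"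
  assumes "\<And>x. cmod (f x) \<le> B"
  shows "((\<lambda>x. pmf p x *\<^sub>R f x) has_sum measure_pmf.expectation p f) UNIV"
proof -
  have "integrable (measure_pmf p) f"
    by (rule measure_pmf.integrable_const_bound[where B=B]) (use assms in auto)
  hence "integrable (density (count_space UNIV) (\<lambda>x. ennreal (pmf p x))) f"
    by (simp add: measure_pmf_eq_density)
  hence abs: "Infinite_Set_Sum.abs_summable_on (\<lambda>x. pmf p x *\<^sub>R f x) UNIV"
    unfolding Infinite_Set_Sum.abs_summable_on_def by (subst (asm) integrable_density) auto
  have "measure_pmf.expectation p f = infsetsum (\<lambda>x. pmf p x *\<^sub>R f x) UNIV"
    unfolding infsetsum_def measure_pmf_eq_density by (subst integral_density) auto
  also have "\<dots> = infsum (\<lambda>x. pmf p x *\<^sub>R f x) UNIV" by (rule infsetsum_infsum[OF abs])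
  moreover have "(\<lambda>x. pmf p x *\<^sub>R f x) summable_on UNIV"
    using abs abs_summable_equivalent abs_summable_summable by blast
  ultimately show ?thesis by simp
qed

primrec kids :: "utree \<Rightarrow> utree multiset" where "kids (UNode M) = M"

lemma UNode_kids [simp]: "UNode (kids t) = t"
  by (cases t) simp

lemma sum_mset_count:
  fixes f :: "'a \<Rightarrow> complex"
  assumes "finite A" "set_mset M \<subseteq> A"
  shows "(\<Sum>t\<in>#M. f t) = (\<Sum>t\<in>A. of_nat (count M t) * f t)"
  using assms(2)
proof (induction M)
  case (add x M)
  have "(\<Sum>t\<in>A. of_nat (count (add_mset x M) t) * f t) = (\<Sum>t\<in>A. of_nat (count M t) * f t + (if x = t then f t else 0))"
    by (intro sum.cong) (auto simp: algebra_simps)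
  also have "\<dots> = (\<Sum>t\<in>A. of_nat (count M t) * f t) + f x"
    using add.prems assms(1) by (simp add: sum.distrib sum.delta')
  finally show ?case using add by simp
qed simp

text \<open>Sums the identity \<open>gw_add_mset\<close> over all pairs of a tree and one of its root subtrees.\<close>
lemma gw_mecke:
  fixes F :: "utree \<Rightarrow> utree \<Rightarrow> complex"
  assumes F: "\<And>s t. cmod (F s t) \<le> B" and
    G: "\<And>\<tau>. cmod (\<Sum>t\<in>#kids \<tau>. F (UNode (kids \<tau> - {#t#})) t) \<le> C"
  shows "measure_pmf.expectation gw_pmf (\<lambda>\<tau>. \<Sum>t\<in>#kids \<tau>. F (UNode (kids \<tau> - {#t#})) t)
     = measure_pmf.expectation gw_pmf (\<lambda>t. measure_pmf.expectation gw_pmf (\<lambda>s. F s t))"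
proof -
  \<comment> \<open>The sum over independent pairs (t, s) is evaluated twice: as an iterated
    expectation, and after grafting t to the root of s.\<close>
  define S where "S = measure_pmf.expectation (pair_pmf gw_pmf gw_pmf) (\<lambda>(t, s). F s t)"
  have "((\<lambda>p. pmf (pair_pmf gw_pmf gw_pmf) p *\<^sub>R (case p of (t, s) \<Rightarrow> F s t)) has_sum S) UNIV"
    unfolding S_def by (rule pmf_has_sum[where B=B]) (use F in \<open>auto split: prod.split\<close>)
  moreover have "(\<lambda>p. pmf (pair_pmf gw_pmf gw_pmf) p *\<^sub>R (case p of (t, s) \<Rightarrow> F s t)) = (\<lambda>(t, s). (gw t * gw s) *\<^sub>R F s t)"
    by (auto simp: fun_eq_iff pmf_pair)
  ultimately have S: "((\<lambda>(t, s). (gw t * gw s) *\<^sub>R F s t) has_sum S) UNIV" by simp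
  define E where "E = (\<lambda>t. measure_pmf.expectation gw_pmf (\<lambda>s. F s t))"
  have EB: "cmod (E t) \<le> B" for t
  proof -
    have "0 \<le> B" using F[of undefined undefined] norm_ge_zero order_trans by blast
    have "cmod (E t) \<le> measure_pmf.expectation gw_pmf (\<lambda>s. cmod (F s t))"
      unfolding E_def by (rule integral_norm_bound)
    also have "\<dots> \<le> measure_pmf.expectation gw_pmf (\<lambda>s. B)"
      by (intro integral_mono measure_pmf.integrable_const_bound[where B=B]) (use F \<open>0 \<le> B\<close> in auto)
    finally show ?thesis by simp
  qed
  have "((\<lambda>t. gw t *\<^sub>R E t) has_sum S) UNIV"
  proof (rule has_sum_SigmaD[where B="\<lambda>_. UNIV"])
    show "((\<lambda>(t, s). (gw t * gw s) *\<^sub>R F s t) has_sum S) (UNIV \<times> UNIV)" using S by simp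
    fix t
    have "((\<lambda>s. gw s *\<^sub>R F s t) has_sum E t) UNIV"
      using pmf_has_sum[of "\<lambda>s. F s t" B gw_pmf] F by (simp add: E_def)
    from has_sum_scaleR[OF this, of "gw t"]
    show "((\<lambda>s. case (t, s) of (t, s) \<Rightarrow> (gw t * gw s) *\<^sub>R F s t) has_sum gw t *\<^sub>R E t) UNIV" by simp
  qed
  moreover have "((\<lambda>t. gw t *\<^sub>R E t) has_sum measure_pmf.expectation gw_pmf E) UNIV"
    using pmf_has_sum[of E B gw_pmf] EB by simp
  ultimately have SE: "S = measure_pmf.expectation gw_pmf E" using has_sum_unique by blast
  define G where "G = (\<lambda>\<tau>. \<Sum>t\<in>#kids \<tau>. F (UNode (kids \<tau> - {#t#})) t)"
  \<comment> \<open>Grafting is a bijection onto pairs of a tree and one of the distinct subtrees at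
    its root.\<close>
  define h where "h = (\<lambda>(t, s). (UNode (add_mset t (kids s)), t))"
  \<comment> \<open>The range of \<open>h\<close> lists a repeated root subtree once; the factor
    \<open>count\<close> restores its multiplicity.\<close>
  define f where "f = (\<lambda>(\<tau>, t). (gw \<tau> * real (count (kids \<tau>) t)) *\<^sub>R F (UNode (kids \<tau> - {#t#})) t)"
  have bij: "bij_betw h UNIV (SIGMA \<tau>:UNIV. set_mset (kids \<tau>))"
    unfolding bij_betw_def
  proof
    show "inj h"
    proof (rule injI)
      fix p q assume "h p = h q"
      thus "p = q" by (cases p; cases q) (auto simp: h_def, metis UNode_kids)
    qed
    show "range h = (SIGMA \<tau>:UNIV. set_mset (kids \<tau>))"
    proof (intro equalityI subsetI)
      fix p assume "p \<in> (SIGMA \<tau>:UNIV. set_mset (kids \<tau>))"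
      then obtain \<tau> t where "p = (\<tau>, t)" "t \<in># kids \<tau>" by auto
      hence "p = h (t, UNode (kids \<tau> - {#t#}))" by (simp add: h_def)
      thus "p \<in> range h" by blast
    qed (auto simp: h_def)
  qed
  have "f (h p) = (case p of (t, s) \<Rightarrow> (gw t * gw s) *\<^sub>R F s t)" for p
  proof -
    obtain t s where p: "p = (t, s)" by (cases p)
    have "real (Suc (count (kids s) t)) * gw (UNode (add_mset t (kids s))) = gw t * gw s"
      using gw_add_mset[of "kids s" t] by simp
    thus ?thesis by (simp add: p f_def h_def mult.commute)
  qed
  hence "((\<lambda>p. f (h p)) has_sum S) UNIV" using S by simp
  hence "(f has_sum S) (SIGMA \<tau>:UNIV. set_mset (kids \<tau>))" using has_sum_reindex_bij_betw[OF bij] by blast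
  hence "((\<lambda>\<tau>. gw \<tau> *\<^sub>R G \<tau>) has_sum S) UNIV"
  proof (rule has_sum_SigmaD)
    fix \<tau>
    have "((\<lambda>t. f (\<tau>, t)) has_sum (\<Sum>t\<in>set_mset (kids \<tau>). f (\<tau>, t))) (set_mset (kids \<tau>))" by simp
    also have "(\<Sum>t\<in>set_mset (kids \<tau>). f (\<tau>, t)) = gw \<tau> *\<^sub>R G \<tau>"
      by (simp add: f_def G_def sum_mset_count[OF finite_set_mset subset_refl] scaleR_sum_right scaleR_conv_of_real mult.assoc sum_distrib_left)
    finally show "((\<lambda>t. f (\<tau>, t)) has_sum gw \<tau> *\<^sub>R G \<tau>) (set_mset (kids \<tau>))" .
  qed
  moreover have "((\<lambda>\<tau>. gw \<tau> *\<^sub>R G \<tau>) has_sum measure_pmf.expectation gw_pmf G) UNIV"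
    using pmf_has_sum[of G C gw_pmf] G by (simp add: G_def)
  ultimately have "S = measure_pmf.expectation gw_pmf G" using has_sum_unique by blast
  thus ?thesis using SE by (simp add: G_def E_def)
qed

section \<open>Derivatives of W in z\<close>

definition dwt :: "complex \<Rightarrow> utree \<Rightarrow> complex" where "dwt z t = deriv (wtH t) z"

lemma wtH_eq: "0 < Im z \<Longrightarrow> wtH t z = wt z t"
  by (simp add: wtH_def)

lemma wt_props:
  assumes z: "0 < Im z"
  shows "0 < Im (wt z t)" "cmod (wt z t) \<le> 1 / Im z" "wt z t \<noteq> 0"
  using H_setD(2,3,5)[OF wtH_in_H_set[of t] z] by (auto simp: wtH_eq[OF z])

lemma cmod_dwt_le: 
  assumes z: "0 < Im z"
  shows "cmod (dwt z t) \<le> Im (wt z t) / Im z"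
  using cmod_deriv_le_upper_half[OF H_setD(1,2)[OF wtH_in_H_set[of t]] z]
  by (simp add: dwt_def wtH_eq[OF z])

text \<open>Follows from the Schwarz-Pick derivative bound because Im W <= |W|. Being uniform in the
  tree, it makes W' / W a bounded test function for the whole limit argument.\<close>

lemma cmod_dwt_div_wt_le: 
  assumes z: "0 < Im z"
  shows "cmod (dwt z t / wt z t) \<le> 1 / Im z"
proof -
  have "cmod (dwt z t) \<le> cmod (wt z t) / Im z"
    using cmod_dwt_le[OF z, of t] abs_Im_le_cmod[of "wt z t"] z
    by (intro order_trans[OF cmod_dwt_le[OF z]] divide_right_mono) auto
  thus ?thesis using wt_props(3)[OF z, of t] z by (simp add: norm_divide divide_simps mult_ac)
qed

lemma wtH_has_field_derivative:
  "0 < Im z \<Longrightarrow> (wtH t has_field_derivative dwt z t) (at z)"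
  unfolding dwt_def using holomorphic_derivI[OF H_setD(1)[OF wtH_in_H_set] open_upper_half] by simp

lemma sum_mset_has_field_derivative:
  "(\<And>t. t \<in># M \<Longrightarrow> (f t has_field_derivative f' t) F) \<Longrightarrow>
    ((\<lambda>z. \<Sum>t\<in>#M. f t z) has_field_derivative (\<Sum>t\<in>#M. f' t)) F"
  by (induction M) (auto intro!: derivative_intros)

lemma dwt_UNode:
  assumes z: "0 < Im z"
  shows "dwt z (UNode M) = (wt z (UNode M))\<^sup>2 * (1 + (\<Sum>t\<in>#M. dwt z t))"
proof -
  let ?s = "\<lambda>z. \<Sum>t\<in>#M. wtH t z"
  have s: "(?s has_field_derivative (\<Sum>t\<in>#M. dwt z t)) (at z)"
    by (intro sum_mset_has_field_derivative wtH_has_field_derivative z)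
  have w: "wt z (UNode M) = - 1 / (z + ?s z)" using wtH_eq[OF z, of "UNode M"] z
    by (simp add: wtH_UNode neg_inverseH_def)
  have ne: "z + ?s z \<noteq> 0" using wt_props(3)[OF z, of "UNode M"] unfolding w by auto
  have "((\<lambda>z. - 1 / (z + ?s z)) has_field_derivative (1 + (\<Sum>t\<in>#M. dwt z t)) / (z + ?s z)\<^sup>2) (at z)"
    by (rule derivative_eq_intros s refl ne | simp add: power2_eq_square)+
  hence "(wtH (UNode M) has_field_derivative (1 + (\<Sum>t\<in>#M. dwt z t)) / (z + ?s z)\<^sup>2) (at z)"
    by (rule has_field_derivative_transform_within_open[OF _ open_upper_half])
       (use z in \<open>auto simp: wtH_UNode neg_inverseH_def\<close>)
  hence "dwt z (UNode M) = (1 + (\<Sum>t\<in>#M. dwt z t)) / (z + ?s z)\<^sup>2"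
    unfolding dwt_def by (rule DERIV_imp_deriv)
  thus ?thesis unfolding w by (simp only: power_divide) simp
qed

text \<open>-1 / W is additive over the children of the root, so splitting one child off is exactly
  the map of the fixed point equation.\<close>

lemma wt_eq_tmap:
  assumes z: "0 < Im z" and t: "t \<in># kids \<tau>"
  shows "wt z \<tau> = 1 / (1 / wt z (UNode (kids \<tau> - {#t#})) - wt z t)"
proof -
  obtain N where N: "kids \<tau> = add_mset t N" using t by (metis mset_add)
  hence \<tau>: "\<tau> = UNode (add_mset t N)" by (metis UNode_kids)
  have "- 1 / (z + (wt z t + y)) = 1 / (1 / (- 1 / (z + y)) - wt z t)" for y
  proof -
    have "1 / (- 1 / (z + y)) - wt z t = - (z + (wt z t + y))" by simp
    thus ?thesis by (metis minus_divide_left minus_divide_right)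
  qed
  thus ?thesis by (simp add: \<tau>)
qed

lemma measurable_eval_R:
  assumes "sets R = sets H_borel"
  shows "(\<lambda>f. f z :: complex) \<in> borel_measurable R"
  using assms eval_measurable_H_borel measurable_cong_sets by blast

text \<open>Partial fractions. With u = 1 / w - x and a a value of X, the square of T w x times the
  integrand of phi at T w x becomes a difference of two simple resolvents.\<close>

lemma resolvent_identity:
  fixes u a :: complex
  assumes "u \<noteq> 0" "a \<noteq> 0" "u - a \<noteq> 0"
  shows "1 / (1 / a - 1 / u) * (1 / u)\<^sup>2 = 1 / (u - a) - 1 / u"
proof -
  have "1 / a - 1 / u = (u - a) / (a * u)" using assms by (simp add: field_simps)
  thus ?thesis using assms by (simp add: field_simps power2_eq_square)
qed

section \<open>The averaged resolvent and the mean of X(z)\<close>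

context
  fixes Q R z assumes GW: "GW_resolvent_fixed_point Q" and R: "X_fixed_point Q R" and z: "0 < Im z"
begin

text \<open>The function phi of the overview at the fixed \<open>z\<close>; \<open>resavg 0\<close>
  is the mean of X(z).\<close>

definition "resavg x = (\<integral>f. 1 / (1 / f z - x) \<partial>R)"

interpretation R: prob_space R using R by (simp add: X_fixed_point_def prob_on_H_def)

lemma sets_R [measurable_cong]: "sets R = sets H_borel" using R by (simp add: X_fixed_point_def prob_on_H_def)

lemma space_R: "space R = H_set" using sets_eq_imp_space_eq[OF sets_R] by simp

lemmas eval_R [measurable] = measurable_eval_R[OF sets_R]

lemma cmod_inverse_diff_le:
  "w \<in> H_set \<Longrightarrow> 0 \<le> Im x \<Longrightarrow> cmod (1 / (1 / w z - x)) \<le> 1 / Im z"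
  using Im_le_neg_imp(4)[OF H_set_Im_inverse_diff_le[OF _ z] z] .

lemma cmod_inverse_wt_diff_le:
  "0 \<le> Im x \<Longrightarrow> cmod (1 / (1 / wt z s - x)) \<le> 1 / Im z"
  using cmod_inverse_diff_le[OF wtH_in_H_set[of s]] by (simp add: wtH_eq[OF z])

lemma Im_inverse_wt_diff:
  assumes "0 \<le> Im x"
  shows "1 / wt z s - x \<noteq> 0" "0 < Im (1 / (1 / wt z s - x))"
  using Im_le_neg_imp(2,3)[OF H_set_Im_inverse_diff_le[OF wtH_in_H_set[of s] z assms] z]
  by (simp_all add: wtH_eq[OF z])

lemma cmod_resavg_le:
  assumes "0 \<le> Im x"
  shows "cmod (resavg x) \<le> 1 / Im z"
proof -
  have "cmod (resavg x) \<le> (\<integral>f. cmod (1 / (1 / f z - x)) \<partial>R)" unfolding resavg_def by (rule integral_norm_bound)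
  also have "\<dots> \<le> (\<integral>f. 1 / Im z \<partial>R)"
    using cmod_inverse_diff_le[OF _ assms] z
    by (intro integral_mono_AE R.integrable_const_bound[where B="1 / Im z"] AE_I2) (auto simp: space_R)
  finally show ?thesis by (simp add: R.prob_space)
qed

text \<open>The fixed point equation says that 1 / X has the law of 1 / W - X1 with W and X1
  independent; by \<open>GW_fixed_point_eq\<close>, W may be sampled from
  \<open>gw_pmf\<close>.\<close>

lemma resavg_fixed_point:
  assumes x: "0 \<le> Im x"
  shows "resavg x = measure_pmf.expectation gw_pmf (\<lambda>s. \<integral>f. 1 / (1 / wt z s - f z - x) \<partial>R)"
proof -
  have Q: "prob_on_H Q" by (rule prob_on_H_Q[OF GW])
  interpret Q: prob_space Q using Q by (simp add: prob_on_H_def)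
  note [measurable_cong] = sets_Q[OF Q]
  note [measurable] = measurable_case_prod_tmap[OF Q sets_R]
  interpret QR: pair_prob_space Q R ..
  have [measurable]: "(\<lambda>p. fst p z) \<in> borel_measurable (Q \<Otimes>\<^sub>M R)" "(\<lambda>p. snd p z) \<in> borel_measurable (Q \<Otimes>\<^sub>M R)"
    by (rule measurable_compose[OF measurable_fst measurable_eval_R[OF sets_Q[OF Q]]])
       (rule measurable_compose[OF measurable_snd eval_R])
  have "resavg x = (\<integral>f. 1 / (1 / f z - x) \<partial>distr (Q \<Otimes>\<^sub>M R) H_borel (\<lambda>(w, x). tmap w x))"
    unfolding resavg_def using R by (simp add: X_fixed_point_altdef)
  also have "\<dots> = (\<integral>p. 1 / (1 / ((\<lambda>(w, x). tmap w x) p) z - x) \<partial>(Q \<Otimes>\<^sub>M R))"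
    by (rule integral_distr) measurable
  also have "\<dots> = (\<integral>p. 1 / (1 / fst p z - snd p z - x) \<partial>(Q \<Otimes>\<^sub>M R))"
    by (intro Bochner_Integration.integral_cong) (use z in \<open>auto simp: tmap_def\<close>)
  also have "\<dots> = (\<integral>w. \<integral>f. 1 / (1 / w z - f z - x) \<partial>R \<partial>Q)"
  proof (subst QR.integral_fst'[symmetric])
    show "integrable (Q \<Otimes>\<^sub>M R) (\<lambda>p. 1 / (1 / fst p z - snd p z - x))"
    proof (rule QR.integrable_const_bound[where B="1 / Im z"])
      show "AE p in Q \<Otimes>\<^sub>M R. cmod (1 / (1 / fst p z - snd p z - x)) \<le> 1 / Im z"
      proof (rule AE_I2)
        fix p assume "p \<in> space (Q \<Otimes>\<^sub>M R)"
        hence *: "fst p \<in> H_set" "snd p \<in> H_set" by (auto simp: space_pair_measure space_R space_Q[OF Q])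
        have "0 \<le> Im (snd p z + x)" using H_setD(2)[OF *(2) z] x by simp
        from cmod_inverse_diff_le[OF *(1) this] show "cmod (1 / (1 / fst p z - snd p z - x)) \<le> 1 / Im z"
          by (simp add: diff_diff_eq)
      qed
    qed measurable
  qed simp
  also have "\<dots> = (\<integral>w. \<integral>f. 1 / (1 / w z - f z - x) \<partial>R \<partial>distr (measure_pmf gw_pmf) H_borel wtH)"
    using GW_fixed_point_eq[OF GW] by simp
  also have "\<dots> = measure_pmf.expectation gw_pmf (\<lambda>s. \<integral>f. 1 / (1 / wtH s z - f z - x) \<partial>R)"
  proof (rule integral_distr)
    show "wtH \<in> measurable (measure_pmf gw_pmf) H_borel" by (simp add: wtH_in_H_set)
    show "(\<lambda>w. \<integral>f. 1 / (1 / w z - f z - x) \<partial>R) \<in> borel_measurable H_borel" by measurable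
  qed
  finally show ?thesis by (simp add: wtH_eq[OF z])
qed

lemma resavg_tmap:
  assumes x: "0 \<le> Im x"
  shows "resavg (1 / (1 / wt z s - x)) * (1 / (1 / wt z s - x))\<^sup>2
     = (\<integral>f. 1 / (1 / wt z s - f z - x) \<partial>R) - 1 / (1 / wt z s - x)"
proof -
  define u where "u = 1 / wt z s - x"
  have u: "u \<noteq> 0" unfolding u_def by (rule Im_inverse_wt_diff[OF x])
  have int: "integrable R (\<lambda>f. 1 / (u - f z))"
  proof (rule R.integrable_const_bound[where B="1 / Im z"])
    show "AE f in R. cmod (1 / (u - f z)) \<le> 1 / Im z"
    proof (rule AE_I2)
      fix f assume "f \<in> space R"
      hence "0 \<le> Im (x + f z)" using H_setD(2)[OF _ z, of f] x by (simp add: space_R less_imp_le)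
      from cmod_inverse_wt_diff_le[OF this] show "cmod (1 / (u - f z)) \<le> 1 / Im z" by (simp add: u_def diff_diff_eq)
    qed
  qed measurable
  have "resavg (1 / u) * (1 / u)\<^sup>2 = (\<integral>f. 1 / (1 / f z - 1 / u) * (1 / u)\<^sup>2 \<partial>R)"
    unfolding resavg_def by (simp only: integral_mult_left_zero)
  also have "\<dots> = (\<integral>f. 1 / (u - f z) - 1 / u \<partial>R)"
  proof (rule Bochner_Integration.integral_cong[OF refl])
    fix f assume "f \<in> space R"
    hence f: "f \<in> H_set" by (simp add: space_R)
    have "0 \<le> Im (x + f z)" using H_setD(2)[OF f z] x by simp
    hence "u - f z \<noteq> 0" using Im_inverse_wt_diff(1)[of "x + f z" s] by (simp add: u_def diff_diff_eq)
    thus "1 / (1 / f z - 1 / u) * (1 / u)\<^sup>2 = 1 / (u - f z) - 1 / u"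
      using H_setD(5)[OF f z] u by (intro resolvent_identity)
  qed
  also have "\<dots> = (\<integral>f. 1 / (u - f z) \<partial>R) - 1 / u"
    using int by (subst Bochner_Integration.integral_diff) (auto simp: R.prob_space)
  also have "(\<integral>f. 1 / (u - f z) \<partial>R) = (\<integral>f. 1 / (1 / wt z s - f z - x) \<partial>R)"
    by (simp add: u_def algebra_simps)
  finally show ?thesis by (simp add: u_def)
qed

lemma integrable_gw_pmf_bounded:
  fixes f :: "utree \<Rightarrow> complex"
  shows "(\<And>t. cmod (f t) \<le> B) \<Longrightarrow> integrable (measure_pmf gw_pmf) f"
  by (rule measure_pmf.integrable_const_bound[where B=B]) auto

text \<open>Averaging \<open>resavg_tmap\<close> over \<open>s\<close> reproduces phi through the
  fixed point equation. This is the only consequence of that equation used in the mean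
  computation.\<close>

lemma expectation_resavg_tmap:
  assumes x: "0 \<le> Im x"
  shows "measure_pmf.expectation gw_pmf (\<lambda>s. resavg (1 / (1 / wt z s - x)) * (1 / (1 / wt z s - x))\<^sup>2)
    = resavg x - measure_pmf.expectation gw_pmf (\<lambda>s. 1 / (1 / wt z s - x))"
proof -
  have "cmod (\<integral>f. 1 / (1 / wt z s - f z - x) \<partial>R) \<le> 1 / Im z * (1 / Im z)\<^sup>2 + 1 / Im z" for s
  proof -
    let ?T = "1 / (1 / wt z s - x)"
    have "(\<integral>f. 1 / (1 / wt z s - f z - x) \<partial>R) = resavg ?T * ?T\<^sup>2 + ?T"
      by (simp only: resavg_tmap[OF x]) simp
    also have "cmod \<dots> \<le> cmod (resavg ?T) * (cmod ?T)\<^sup>2 + cmod ?T"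
      by (metis norm_mult norm_power norm_triangle_ineq)
    also have "\<dots> \<le> 1 / Im z * (1 / Im z)\<^sup>2 + 1 / Im z"
      using cmod_resavg_le[OF less_imp_le[OF Im_inverse_wt_diff(2)[OF x, of s]]] cmod_inverse_wt_diff_le[OF x, of s] z
      by (intro add_mono mult_mono power_mono) auto
    finally show ?thesis .
  qed
  thus ?thesis unfolding resavg_tmap[OF x]
    using cmod_inverse_wt_diff_le[OF x]
    by (subst Bochner_Integration.integral_diff) (auto intro!: integrable_gw_pmf_bounded simp: resavg_fixed_point[OF x])
qed

text \<open>Write T = T(W_s, W_t) for independent trees s and t, and W' for the derivative at t. The
  Mecke formula with weight T W' gives E[W' / W] - E[W] = E[T W']. With weight phi(T) T^2 W' the
  terms E[phi(W) W'] cancel by \<open>expectation_resavg_tmap\<close>, leaving E[phi(W) W^2] =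
  E[T W']. At x = 0 that lemma says E[phi(W) W^2] = phi(0) - E[W], and phi(0) = E X.\<close>

lemma expectation_dwt_div_wt:
  "measure_pmf.expectation gw_pmf (\<lambda>t. dwt z t / wt z t) = (\<integral>f. f z \<partial>R)"
proof -
  let ?E = "measure_pmf.expectation gw_pmf" and ?\<eta> = "1 / Im z"
  define T where "T = (\<lambda>s t. 1 / (1 / wt z s - wt z t))"
  have \<eta>: "0 \<le> ?\<eta>" using z by simp
  have Im_wt: "0 \<le> Im (wt z t)" for t using wt_props(1)[OF z, of t] by simp
  have T: "wt z \<tau> = T (UNode (kids \<tau> - {#t#})) t" if "t \<in># kids \<tau>" for \<tau> t
    using wt_eq_tmap[OF z that] by (simp add: T_def)
  have Tb: "cmod (T s t) \<le> ?\<eta>" "0 \<le> Im (T s t)" for s t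
    using cmod_inverse_wt_diff_le[OF Im_wt] Im_inverse_wt_diff(2)[OF Im_wt, THEN less_imp_le] by (auto simp: T_def)
  have dw: "cmod (dwt z t) \<le> ?\<eta> * ?\<eta>" for t
  proof -
    have "cmod (dwt z t) \<le> Im (wt z t) / Im z" by (rule cmod_dwt_le[OF z])
    also have "\<dots> \<le> ?\<eta> / Im z" using wt_props(2)[OF z, of t] abs_Im_le_cmod[of "wt z t"] z
      by (intro divide_right_mono) auto
    finally show ?thesis by simp
  qed
  have dwt: "dwt z \<tau> = (wt z \<tau>)\<^sup>2 * (1 + (\<Sum>t\<in>#kids \<tau>. dwt z t))" for \<tau>
    using dwt_UNode[OF z, of "kids \<tau>"] by simp
  have resavgw: "cmod (resavg (wt z t)) \<le> ?\<eta>" for t by (rule cmod_resavg_le[OF Im_wt])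
  have mult_b: "cmod (p * q) \<le> P * Q'" if "cmod p \<le> P" "cmod q \<le> Q'" for p q P Q'
    unfolding norm_mult using that norm_ge_zero order_trans by (intro mult_mono) blast+
  have sq_b: "cmod (p\<^sup>2) \<le> P\<^sup>2" if "cmod p \<le> P" for p P
    unfolding norm_power using that by (intro power_mono) auto

  have s1: "(\<Sum>t\<in>#kids \<tau>. T (UNode (kids \<tau> - {#t#})) t * dwt z t) = dwt z \<tau> / wt z \<tau> - wt z \<tau>" for \<tau>
  proof -
    have "(\<Sum>t\<in>#kids \<tau>. T (UNode (kids \<tau> - {#t#})) t * dwt z t) = (\<Sum>t\<in>#kids \<tau>. wt z \<tau> * dwt z t)"
      by (intro arg_cong[of _ _ sum_mset] image_mset_cong) (simp add: T)
    also have "\<dots> = wt z \<tau> * (\<Sum>t\<in>#kids \<tau>. dwt z t)" by (simp add: sum_mset_distrib_left multiset.map_comp o_def)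
    also have "\<dots> = dwt z \<tau> / wt z \<tau> - wt z \<tau>"
      using wt_props(3)[OF z, of \<tau>] unfolding dwt[of \<tau>] by (simp add: field_simps power2_eq_square)
    finally show ?thesis .
  qed
  have b1: "cmod (dwt z \<tau> / wt z \<tau> - wt z \<tau>) \<le> ?\<eta> + ?\<eta>" for \<tau>
    using norm_triangle_ineq4[of "dwt z \<tau> / wt z \<tau>" "wt z \<tau>"] cmod_dwt_div_wt_le[OF z, of \<tau>] wt_props(2)[OF z, of \<tau>] by linarith
  have "?E (\<lambda>\<tau>. \<Sum>t\<in>#kids \<tau>. T (UNode (kids \<tau> - {#t#})) t * dwt z t) = ?E (\<lambda>t. ?E (\<lambda>s. T s t * dwt z t))"
    by (rule gw_mecke[where B="?\<eta> * (?\<eta> * ?\<eta>)" and C="?\<eta> + ?\<eta>"]) (simp_all only: s1 b1 mult_b[OF Tb(1) dw])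
  hence eq1: "?E (\<lambda>\<tau>. dwt z \<tau> / wt z \<tau>) - ?E (wt z) = ?E (\<lambda>t. ?E (\<lambda>s. T s t) * dwt z t)"
    unfolding s1 using cmod_dwt_div_wt_le[OF z] wt_props(2)[OF z]
    by (subst (asm) Bochner_Integration.integral_diff) (auto intro!: integrable_gw_pmf_bounded)

  have s2: "(\<Sum>t\<in>#kids \<tau>. resavg (T (UNode (kids \<tau> - {#t#})) t) * (T (UNode (kids \<tau> - {#t#})) t)\<^sup>2 * dwt z t)
     = resavg (wt z \<tau>) * dwt z \<tau> - resavg (wt z \<tau>) * (wt z \<tau>)\<^sup>2" for \<tau>
  proof -
    have "(\<Sum>t\<in>#kids \<tau>. resavg (T (UNode (kids \<tau> - {#t#})) t) * (T (UNode (kids \<tau> - {#t#})) t)\<^sup>2 * dwt z t)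
        = (\<Sum>t\<in>#kids \<tau>. resavg (wt z \<tau>) * (wt z \<tau>)\<^sup>2 * dwt z t)"
      by (intro arg_cong[of _ _ sum_mset] image_mset_cong) (simp add: T)
    also have "\<dots> = resavg (wt z \<tau>) * (wt z \<tau>)\<^sup>2 * (\<Sum>t\<in>#kids \<tau>. dwt z t)" by (simp add: sum_mset_distrib_left multiset.map_comp o_def)
    also have "\<dots> = resavg (wt z \<tau>) * dwt z \<tau> - resavg (wt z \<tau>) * (wt z \<tau>)\<^sup>2"
      unfolding dwt[of \<tau>] by (simp add: algebra_simps)
    finally show ?thesis .
  qed
  have b2: "cmod (resavg (wt z \<tau>) * dwt z \<tau>) \<le> ?\<eta> * (?\<eta> * ?\<eta>)" for \<tau> by (rule mult_b[OF resavgw dw])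
  have b3: "cmod (resavg (wt z \<tau>) * (wt z \<tau>)\<^sup>2) \<le> ?\<eta> * ?\<eta>\<^sup>2" for \<tau> by (rule mult_b[OF resavgw sq_b[OF wt_props(2)[OF z]]])
  have b4: "cmod (resavg (wt z \<tau>) * dwt z \<tau> - resavg (wt z \<tau>) * (wt z \<tau>)\<^sup>2) \<le> ?\<eta> * (?\<eta> * ?\<eta>) + ?\<eta> * ?\<eta>\<^sup>2" for \<tau>
    using norm_triangle_ineq4[of "resavg (wt z \<tau>) * dwt z \<tau>" "resavg (wt z \<tau>) * (wt z \<tau>)\<^sup>2"] b2[of \<tau>] b3[of \<tau>] by linarith
  have "?E (\<lambda>\<tau>. \<Sum>t\<in>#kids \<tau>. resavg (T (UNode (kids \<tau> - {#t#})) t) * (T (UNode (kids \<tau> - {#t#})) t)\<^sup>2 * dwt z t)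
     = ?E (\<lambda>t. ?E (\<lambda>s. resavg (T s t) * (T s t)\<^sup>2 * dwt z t))"
    by (rule gw_mecke[where B="?\<eta> * ?\<eta>\<^sup>2 * (?\<eta> * ?\<eta>)" and C="?\<eta> * (?\<eta> * ?\<eta>) + ?\<eta> * ?\<eta>\<^sup>2"])
       (simp_all only: s2 b4 mult_b[OF mult_b[OF cmod_resavg_le[OF Tb(2)] sq_b[OF Tb(1)]] dw])
  hence "?E (\<lambda>\<tau>. resavg (wt z \<tau>) * dwt z \<tau>) - ?E (\<lambda>\<tau>. resavg (wt z \<tau>) * (wt z \<tau>)\<^sup>2)
     = ?E (\<lambda>t. ?E (\<lambda>s. resavg (T s t) * (T s t)\<^sup>2) * dwt z t)"
    unfolding s2
    by (subst (asm) Bochner_Integration.integral_diff)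
       (auto intro!: integrable_gw_pmf_bounded[OF b2] integrable_gw_pmf_bounded[OF b3])
  also have "\<dots> = ?E (\<lambda>t. (resavg (wt z t) - ?E (\<lambda>s. T s t)) * dwt z t)"
    unfolding T_def using expectation_resavg_tmap[OF Im_wt] by simp
  also have "\<dots> = ?E (\<lambda>t. resavg (wt z t) * dwt z t) - ?E (\<lambda>t. ?E (\<lambda>s. T s t) * dwt z t)"
  proof -
    have "cmod (?E (\<lambda>s. T s t)) \<le> ?\<eta>" for t
    proof -
      have "cmod (?E (\<lambda>s. T s t)) \<le> ?E (\<lambda>s. cmod (T s t))" by (rule integral_norm_bound)
      also have "\<dots> \<le> ?E (\<lambda>s. ?\<eta>)" using Tb(1) \<eta>
        by (intro integral_mono measure_pmf.integrable_const_bound[where B="?\<eta>"]) auto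
      finally show ?thesis by simp
    qed
    from mult_b[OF this dw] have "integrable (measure_pmf gw_pmf) (\<lambda>t. ?E (\<lambda>s. T s t) * dwt z t)"
      by (rule integrable_gw_pmf_bounded)
    thus ?thesis
      by (simp only: left_diff_distrib) (rule Bochner_Integration.integral_diff[OF integrable_gw_pmf_bounded[OF b2]])
  qed
  finally have eq2: "?E (\<lambda>\<tau>. resavg (wt z \<tau>) * (wt z \<tau>)\<^sup>2) = ?E (\<lambda>t. ?E (\<lambda>s. T s t) * dwt z t)" by simp
  have eq3: "?E (\<lambda>\<tau>. resavg (wt z \<tau>) * (wt z \<tau>)\<^sup>2) = resavg 0 - ?E (wt z)"
    using expectation_resavg_tmap[of 0] by simp
  have "?E (\<lambda>\<tau>. dwt z \<tau> / wt z \<tau>) - ?E (wt z) = resavg 0 - ?E (wt z)"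
    by (rule trans[OF eq1 trans[OF eq2[symmetric] eq3]])
  hence "?E (\<lambda>\<tau>. dwt z \<tau> / wt z \<tau>) = resavg 0" by simp
  thus ?thesis by (simp add: resavg_def)
qed

end

section \<open>Counting rooted forests\<close>

text \<open>A forest on \<open>V\<close> with set of roots \<open>R\<close> is encoded by its parent map, which is made total by
  fixing the roots and all points outside \<open>V\<close>.\<close>
definition forest :: "nat set \<Rightarrow> nat set \<Rightarrow> (nat \<Rightarrow> nat) set" where
  "forest V R = {f. (\<forall>x\<in>V - R. f x \<in> V) \<and> (\<forall>x. x \<notin> V - R \<longrightarrow> f x = x) \<and> (\<forall>x\<in>V. \<exists>k. (f ^^ k) x \<in> R)}"

lemma forestD:
  assumes "f \<in> forest V R"
  shows "x \<in> V - R \<Longrightarrow> f x \<in> V" "x \<notin> V - R \<Longrightarrow> f x = x" "x \<in> V \<Longrightarrow> \<exists>k. (f ^^ k) x \<in> R"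
  using assms by (auto simp: forest_def)

lemma forestI:
  assumes "\<And>x. x \<in> V \<Longrightarrow> x \<notin> R \<Longrightarrow> f x \<in> V" "\<And>x. x \<notin> V - R \<Longrightarrow> f x = x" "\<And>x. x \<in> V \<Longrightarrow> \<exists>k. (f ^^ k) x \<in> R"
  shows "f \<in> forest V R"
  using assms by (auto simp: forest_def)

lemma finite_forest:
  assumes "finite V" shows "finite (forest V R)"
proof (rule inj_on_finite)
  show "inj_on (\<lambda>f. restrict f V) (forest V R)"
  proof (rule inj_onI)
    fix f g assume fg: "f \<in> forest V R" "g \<in> forest V R" "restrict f V = restrict g V"
    show "f = g"
    proof
      fix x show "f x = g x"
        using fun_cong[OF fg(3), of x] forestD(2)[OF fg(1), of x] forestD(2)[OF fg(2), of x]
        by (cases "x \<in> V") auto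
    qed
  qed
  show "(\<lambda>f. restrict f V) ` forest V R \<subseteq> V \<rightarrow>\<^sub>E V" by (auto simp: forest_def)
  show "finite (V \<rightarrow>\<^sub>E V)" using assms by (intro finite_PiE) auto
qed

text \<open>Until the first visit to \<open>T\<close> the two orbits coincide. This carries the
  reachability of roots between a forest and its pieces.\<close>

lemma funpow_transfer:
  assumes "\<And>x. x \<in> D \<Longrightarrow> x \<notin> T \<Longrightarrow> g x = f x \<and> f x \<in> D" and "x \<in> D" "(f ^^ k) x \<in> T"
  shows "\<exists>j. (g ^^ j) x \<in> T"
  using assms(2,3)
proof (induction k arbitrary: x)
  case 0
  thus ?case by (auto intro: exI[of _ 0])
next
  case (Suc k)
  show ?case
  proof (cases "x \<in> T")
    case False
    have "(f ^^ k) (f x) \<in> T" using Suc.prems(2) by (simp add: funpow_swap1)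
    then obtain j where "(g ^^ j) (g x) \<in> T" using Suc.IH[of "f x"] assms(1)[OF Suc.prems(1) False] by auto
    hence "(g ^^ Suc j) x \<in> T" by (simp add: funpow_swap1)
    thus ?thesis by blast
  qed (auto intro: exI[of _ 0])
qed

lemma sum_Pow_card:
  fixes F :: "nat \<Rightarrow> nat"
  assumes "finite M"
  shows "(\<Sum>J\<in>Pow M. F (card J)) = (\<Sum>j\<le>card M. (card M choose j) * F j)"
proof -
  have "(\<Sum>J\<in>Pow M. F (card J)) = (\<Sum>j\<le>card M. \<Sum>J\<in>{J\<in>Pow M. card J = j}. F (card J))"
    using assms by (intro sum.group[symmetric]) (auto intro: card_mono)
  also have "\<dots> = (\<Sum>j\<le>card M. (card M choose j) * F j)"
    using n_subsets[OF assms] by (intro sum.cong) auto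
  finally show ?thesis .
qed

text \<open>Peel off the roots: \<open>J\<close> is the set of their children.\<close>
lemma card_forest_peel:
  assumes V: "finite V" and R: "R \<subseteq> V"
  shows "card (forest V R) = (\<Sum>J\<in>Pow (V - R). card R ^ card J * card (forest (V - R) J))"
proof -
  let ?S = "SIGMA J:Pow (V - R). (J \<rightarrow>\<^sub>E R) \<times> forest (V - R) J"
  \<comment> \<open>\<open>\<alpha>\<close> records the children of the roots, their parents, and
    the rest as a forest rooted at those children; \<open>\<beta>\<close> reassembles the
    three.\<close>
  define \<alpha> where "\<alpha> = (\<lambda>f::nat\<Rightarrow>nat. ({x\<in>V - R. f x \<in> R}, restrict f {x\<in>V - R. f x \<in> R}, \<lambda>x. if x \<in> V - R \<and> f x \<notin> R then f x else x))"
  define \<beta> where "\<beta> = (\<lambda>(J, g, h) (x::nat). if x \<in> J then g x else h x :: nat)"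
  have "bij_betw \<alpha> (forest V R) ?S"
  proof (rule bij_betw_byWitness[where f'=\<beta>])
    show "\<forall>f\<in>forest V R. \<beta> (\<alpha> f) = f"
      by (auto simp: \<alpha>_def \<beta>_def fun_eq_iff dest: forestD(2))
    show "\<forall>p\<in>?S. \<alpha> (\<beta> p) = p"
    proof
      fix p assume "p \<in> ?S"
      then obtain J g h where p: "p = (J, g, h)" "J \<subseteq> V - R" "g \<in> J \<rightarrow>\<^sub>E R" "h \<in> forest (V - R) J" by auto
      have 1: "{x\<in>V - R. \<beta> p x \<in> R} = J"
        using p forestD(1)[OF p(4)] by (auto simp: \<beta>_def split: if_splits)
      have 2: "restrict (\<beta> p) J = g" using p(3) by (auto simp: p(1) \<beta>_def fun_eq_iff PiE_def extensional_def)
      have 3: "(if x \<in> V - R \<and> \<beta> p x \<notin> R then \<beta> p x else x) = h x" for x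
      proof -
        have "x \<in> V - R \<and> \<beta> p x \<notin> R \<longleftrightarrow> x \<in> V - R - J" using 1 by auto
        thus ?thesis using forestD(2)[OF p(4), of x] by (auto simp: p(1) \<beta>_def)
      qed
      show "\<alpha> (\<beta> p) = p" unfolding \<alpha>_def 1 2 3 by (simp add: p(1))
    qed
    show "\<alpha> ` forest V R \<subseteq> ?S"
    proof (rule image_subsetI)
      fix f assume f: "f \<in> forest V R"
      let ?J = "{x\<in>V - R. f x \<in> R}" and ?h = "\<lambda>x. if x \<in> V - R \<and> f x \<notin> R then f x else x"
      have "?h \<in> forest (V - R) ?J"
      proof (rule forestI)
        fix x assume x: "x \<in> V - R"
        obtain k where k: "(f ^^ k) x \<in> R" using forestD(3)[OF f] x by auto
        \<comment> \<open>The last vertex of the orbit before it enters \<open>R\<close> belongs to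
          \<open>?J\<close>.\<close>
        have "\<exists>k. (f ^^ k) x \<in> ?J"
          using x k
        proof (induction k arbitrary: x)
          case (Suc k)
          show ?case
          proof (cases "f x \<in> R")
            case True
            thus ?thesis using Suc.prems by (intro exI[of _ 0]) auto
          next
            case False
            have "(f ^^ k) (f x) \<in> R" using Suc.prems(2) by (simp add: funpow_swap1)
            then obtain j where "(f ^^ j) (f x) \<in> ?J" using Suc.IH[of "f x"] False forestD(1)[OF f Suc.prems(1)] by auto
            thus ?thesis by (intro exI[of _ "Suc j"]) (simp add: funpow_swap1)
          qed
        qed auto
        then obtain k where "(f ^^ k) x \<in> ?J" ..
        thus "\<exists>k. (?h ^^ k) x \<in> ?J"
          by (rule funpow_transfer[of "V - R", rotated 2]) (use x forestD(1)[OF f] in auto)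
      qed (use forestD(1)[OF f] in auto)
      thus "\<alpha> f \<in> ?S" by (auto simp: \<alpha>_def)
    qed
    show "\<beta> ` ?S \<subseteq> forest V R"
    proof (rule image_subsetI)
      fix p assume "p \<in> ?S"
      then obtain J g h where p: "p = (J, g, h)" "J \<subseteq> V - R" "g \<in> J \<rightarrow>\<^sub>E R" "h \<in> forest (V - R) J" by auto
      show "\<beta> p \<in> forest V R"
      proof (rule forestI)
        fix x assume x: "x \<in> V" "x \<notin> R"
        show "\<beta> p x \<in> V" using x p R forestD(1)[OF p(4), of x] by (auto simp: \<beta>_def PiE_iff)
      next
        fix x assume "x \<notin> V - R"
        thus "\<beta> p x = x" using p forestD(2)[OF p(4), of x] by (auto simp: \<beta>_def)
      next
        fix x assume x: "x \<in> V"
        show "\<exists>k. (\<beta> p ^^ k) x \<in> R"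
        proof (cases "x \<in> R")
          case False
          then obtain k where k: "(h ^^ k) x \<in> J" using forestD(3)[OF p(4)] x by auto
          have "\<exists>j. (\<beta> p ^^ j) x \<in> J"
            by (rule funpow_transfer[of "V - R" _ _ h, OF _ _ k]) (use p x False forestD(1)[OF p(4)] in \<open>auto simp: \<beta>_def\<close>)
          then obtain j where j: "(\<beta> p ^^ j) x \<in> J" ..
          hence "(\<beta> p ^^ Suc j) x \<in> R" using p by (auto simp: \<beta>_def PiE_iff)
          thus ?thesis by blast
        qed (auto intro: exI[of _ 0])
      qed
    qed
  qed
  hence "card (forest V R) = card ?S" by (rule bij_betw_same_card)
  also have "\<dots> = (\<Sum>J\<in>Pow (V - R). card ((J \<rightarrow>\<^sub>E R) \<times> forest (V - R) J))"
    using V R by (intro card_SigmaI) (auto intro!: finite_cartesian_product finite_PiE finite_forest dest: finite_subset)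
  also have "\<dots> = (\<Sum>J\<in>Pow (V - R). card R ^ card J * card (forest (V - R) J))"
  proof (rule sum.cong[OF refl])
    fix J assume "J \<in> Pow (V - R)"
    hence "finite J" using V finite_subset by blast
    thus "card ((J \<rightarrow>\<^sub>E R) \<times> forest (V - R) J) = card R ^ card J * card (forest (V - R) J)"
      by (simp add: card_cartesian_product card_PiE)
  qed
  finally show ?thesis .
qed

lemma forest_self: "forest V V = {\<lambda>x. x}"
  by (auto simp: forest_def intro: exI[of _ 0])

lemma forest_empty: "V \<noteq> {} \<Longrightarrow> forest V {} = {}"
  by (auto simp: forest_def)

text \<open>Cayley's formula r n^(n - r - 1) for forests with r given roots, multiplied by n to keep
  exponents natural when r = n. After peeling off the roots, the induction step is the binomial
  theorem.\<close>

lemma card_forest: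
  assumes "finite V" "R \<subseteq> V" "R \<noteq> {}"
  shows "card (forest V R) * card V = card R * card V ^ card (V - R)"
  using assms
proof (induction "card (V - R)" arbitrary: V R rule: less_induct)
  case less
  note V = less.prems
  let ?M = "V - R" let ?m = "card ?M" let ?r = "card R"
  have fin: "finite ?M" "finite R" using V finite_subset by auto
  have cV: "card V = ?r + ?m" using V fin by (metis Diff_partition card_Diff_subset card_mono le_add_diff_inverse)
  show ?case
  proof (cases "?m = 0")
    case True
    hence "V = R" using fin V by auto
    thus ?thesis by (simp add: forest_self)
  next
    case False
    then obtain n where n: "?m = Suc n" using not0_implies_Suc by blast
    \<comment> \<open>The factor \<open>?m\<close> brings each term into the form of the induction
      hypothesis. J = {} carries no forest, in agreement with the factor
      \<open>card J\<close>.\<close>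
    have "card (forest V R) * ?m = (\<Sum>J\<in>Pow ?M. ?r ^ card J * (card (forest ?M J) * ?m))"
      unfolding card_forest_peel[OF V(1,2)] by (simp add: sum_distrib_right mult.assoc)
    also have "\<dots> = (\<Sum>J\<in>Pow ?M. ?r ^ card J * (card J * ?m ^ (?m - card J)))"
    proof (rule sum.cong[OF refl])
      fix J assume J: "J \<in> Pow ?M"
      show "?r ^ card J * (card (forest ?M J) * ?m) = ?r ^ card J * (card J * ?m ^ (?m - card J))"
      proof (cases "J = {}")
        case True
        have "?M \<noteq> {}" using False by (metis card.empty)
        thus ?thesis using True by (simp add: forest_empty)
      next
        case ne: False
        have "finite J" using J fin finite_subset by blast
        hence "card J > 0" "card (?M - J) = ?m - card J" using J ne by (auto simp: card_Diff_subset card_gt_0_iff)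
        moreover have "card (?M - J) < ?m" using calculation False by simp
        ultimately show ?thesis using less.hyps[of ?M J] J ne fin by simp
      qed
    qed
    also have "\<dots> = (\<Sum>j\<le>?m. (?m choose j) * (?r ^ j * (j * ?m ^ (?m - j))))"
      by (rule sum_Pow_card[OF fin(1)])
    also have "\<dots> = (\<Sum>j\<le>n. (Suc n choose Suc j) * (?r ^ Suc j * (Suc j * ?m ^ (n - j))))"
      unfolding n by (subst sum.atMost_Suc_shift) simp
    also have "\<dots> = (\<Sum>j\<le>n. ?m * ?r * ((n choose j) * ?r ^ j * ?m ^ (n - j)))"
    proof (rule sum.cong[OF refl])
      fix j
      \<comment> \<open>Absorbing the factor \<open>Suc j\<close> into the binomial coefficient
        turns the sum into the expansion of \<open>(?r + ?m) ^ n\<close>.\<close>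
      have "Suc j * (Suc n choose Suc j) = Suc n * (n choose j)" by (rule Suc_times_binomial)
      hence "?r ^ Suc j * ?m ^ (n - j) * (Suc j * (Suc n choose Suc j)) = ?r ^ Suc j * ?m ^ (n - j) * (?m * (n choose j))"
        by (simp only: n)
      thus "(Suc n choose Suc j) * (?r ^ Suc j * (Suc j * ?m ^ (n - j))) = ?m * ?r * ((n choose j) * ?r ^ j * ?m ^ (n - j))"
        by (simp only: mult_ac power_Suc)
    qed
    also have "\<dots> = ?m * ?r * (?r + ?m) ^ n"
      by (simp add: binomial_ring sum_distrib_left)
    finally have "card (forest V R) = ?r * (?r + ?m) ^ n" using False by simp
    thus ?thesis unfolding cV by (simp only: n power_Suc mult_ac)
  qed
qed

lemma card_forest_root:
  assumes "finite V" "r \<in> V"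
  shows "real (card (forest V {r})) = real (card V) ^ (card V - 1) / real (card V)"
proof -
  have "card (forest V {r}) * card V = card V ^ (card V - 1)"
    using card_forest[of V "{r}"] assms by simp
  hence "real (card (forest V {r})) * real (card V) = real (card V) ^ (card V - 1)"
    by (metis of_nat_mult of_nat_power)
  moreover have "card V > 0" using assms by (auto simp: card_gt_0_iff)
  ultimately show ?thesis by (simp add: field_simps)
qed

section \<open>Descendant subtrees and their shapes\<close>

definition desc :: "(nat \<Rightarrow> nat) \<Rightarrow> nat \<Rightarrow> nat set" where
  "desc f v = {u. \<exists>k. (f ^^ k) u = v}"

text \<open>The clause \<open>u \<noteq> v\<close> discards the fixed points that
  \<open>forest\<close> places at the roots and outside \<open>V\<close>.\<close>

definition ch :: "(nat \<Rightarrow> nat) \<Rightarrow> nat \<Rightarrow> nat set" where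
  "ch f v = {u. f u = v \<and> u \<noteq> v}"

text \<open>Isomorphism type of the subtree of descendants of a vertex. The recursion runs down the
  child relation, which is well-founded for forests but not for every map; hence
  \<open>wfrec\<close>.\<close>

definition shape :: "(nat \<Rightarrow> nat) \<Rightarrow> nat \<Rightarrow> utree" where
  "shape f = wfrec {(u, v). u \<in> ch f v} (\<lambda>s v. UNode (image_mset s (mset_set (ch f v))))"

lemma shape_unfold_wf:
  assumes "wf {(u, v). u \<in> ch f v}"
  shows "shape f v = UNode (image_mset (shape f) (mset_set (ch f v)))"
proof -
  \<comment> \<open>\<open>cut\<close> changes values only off the children of \<open>v\<close>, and
    \<open>mset_set\<close> of an infinite set is empty.\<close>
  have *: "image_mset (cut g {(u, v). u \<in> ch f v} v) (mset_set (ch f v)) = image_mset g (mset_set (ch f v))" for g :: "nat \<Rightarrow> utree"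
    by (rule image_mset_cong) (metis (mono_tags, lifting) case_prodI cut_apply elem_mset_set infinite_set_mset_mset_set empty_iff mem_Collect_eq finite_set_mset mset_set.infinite set_mset_empty)
  show ?thesis
    by (subst def_wfrec[OF shape_def[THEN eq_reflection] assms]) (simp add: *)
qed

lemma self_in_desc: "v \<in> desc f v"
  by (auto simp: desc_def intro: exI[of _ 0])

lemma desc_step: "f u \<in> desc f v \<Longrightarrow> u \<in> desc f v"
  unfolding desc_def by simp (metis funpow_swap1 funpow.simps(2) comp_apply)

lemma desc_cases: "u \<in> desc f v \<Longrightarrow> u = v \<or> f u \<in> desc f v"
proof -
  assume "u \<in> desc f v"
  then obtain k where "(f ^^ k) u = v" by (auto simp: desc_def)
  thus ?thesis by (cases k) (auto simp: desc_def funpow_swap1)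
qed

lemma desc_trans: "u \<in> desc f v \<Longrightarrow> v \<in> desc f w \<Longrightarrow> u \<in> desc f w"
  unfolding desc_def by simp (metis funpow_add comp_apply)

lemma ch_in_desc: "u \<in> ch f v \<Longrightarrow> u \<in> desc f v"
  by (rule desc_step) (simp add: ch_def self_in_desc)

text \<open>The ancestors of \<open>w\<close> are the points of its orbit, hence a chain.\<close>

lemma desc_linear:
  assumes "w \<in> desc f u" "w \<in> desc f v"
  shows "u \<in> desc f v \<or> v \<in> desc f u"
proof -
  obtain i j where ij: "(f ^^ i) w = u" "(f ^^ j) w = v" using assms by (auto simp: desc_def)
  show ?thesis
  proof (cases "i \<le> j")
    case True
    hence "(f ^^ (j - i)) u = v" using ij funpow_add[of "j - i" i f] by (auto simp: fun_eq_iff)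
    thus ?thesis by (auto simp: desc_def)
  next
    case False
    hence "(f ^^ (i - j)) v = u" using ij funpow_add[of "i - j" j f] by (auto simp: fun_eq_iff)
    thus ?thesis by (auto simp: desc_def)
  qed
qed

lemma desc_subset_closed:
  assumes "\<And>x. x \<notin> D \<Longrightarrow> f x \<notin> D" "v \<in> D"
  shows "desc f v \<subseteq> D"
proof
  fix u assume "u \<in> desc f v"
  then obtain k where "(f ^^ k) u = v" by (auto simp: desc_def)
  thus "u \<in> D" using assms(2)
  proof (induction k arbitrary: u)
    case (Suc k)
    thus ?case using assms(1) by (metis comp_apply funpow_Suc_right)
  qed auto
qed

locale rooted =
  fixes V :: "nat set" and r :: nat and f :: "nat \<Rightarrow> nat"
  assumes fin: "finite V" and r: "r \<in> V" and f: "f \<in> forest V {r}"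
begin

lemma f_in: "x \<in> V \<Longrightarrow> f x \<in> V"
  using forestD(1,2)[OF f, of x] by (cases "x = r") auto

lemma f_out: "x \<notin> V \<Longrightarrow> f x = x"
  using forestD(2)[OF f, of x] by auto

lemma f_root: "f r = r"
  using forestD(2)[OF f, of r] by auto

lemma funpow_root: "(f ^^ k) r = r"
  by (induction k) (auto simp: f_root)

lemma reach: "x \<in> V \<Longrightarrow> x \<in> desc f r"
  using forestD(3)[OF f, of x] by (auto simp: desc_def)

lemma desc_subset: "v \<in> V \<Longrightarrow> desc f v \<subseteq> V"
  by (rule desc_subset_closed) (auto simp: f_out)

lemma finite_desc: "v \<in> V \<Longrightarrow> finite (desc f v)"
  using desc_subset fin finite_subset by blast

text \<open>If j steps lead from \<open>x\<close> to the root, then j rounds of the cycle end both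
  at \<open>x\<close> and at the root.\<close>

lemma fixed_imp_root:
  assumes "x \<in> V" "(f ^^ Suc k) x = x"
  shows "x = r"
proof -
  obtain j where j: "(f ^^ j) x = r" using reach[OF assms(1)] by (auto simp: desc_def)
  have "(f ^^ (Suc k * m)) x = x" for m
  proof (induction m)
    case (Suc m)
    thus ?case by (simp only: mult_Suc_right funpow_add comp_apply assms(2))
  qed simp
  hence "x = (f ^^ (Suc k * j)) x" by simp
  also have "Suc k * j = k * j + j" by simp
  also have "(f ^^ (k * j + j)) x = r" by (simp add: funpow_add j funpow_root)
  finally show ?thesis .
qed

lemma ch_in: "u \<in> ch f v \<Longrightarrow> u \<in> V - {r} \<and> v \<in> V"
  using forestD(1,2)[OF f, of u] by (cases "u \<in> V - {r}") (auto simp: ch_def)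

lemma finite_ch: "finite (ch f v)"
  using ch_in fin finite_subset[of "ch f v" V] by blast

lemma desc_antisym:
  assumes "u \<in> desc f v" "v \<in> desc f u" "u \<in> V"
  shows "u = v"
proof -
  obtain i j where ij: "(f ^^ i) u = v" "(f ^^ j) v = u" using assms by (auto simp: desc_def)
  hence "(f ^^ (j + i)) u = u" by (simp add: funpow_add)
  show ?thesis
  proof (cases "j + i")
    case 0
    thus ?thesis using ij by simp
  next
    case (Suc k)
    hence "u = r" using fixed_imp_root assms(3) \<open>(f ^^ (j + i)) u = u\<close> by metis
    thus ?thesis using ij funpow_root by simp
  qed
qed

lemma ch_not_desc: "u \<in> ch f v \<Longrightarrow> v \<notin> desc f u"
  using desc_antisym[of u v] ch_in_desc ch_in by (auto simp: ch_def)

lemma card_desc_less: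
  assumes "u \<in> desc f v" "u \<noteq> v" "v \<in> V"
  shows "card (desc f u) < card (desc f v)"
proof (rule psubset_card_mono[OF finite_desc[OF assms(3)]])
  have "u \<in> V" using assms desc_subset by blast
  hence "v \<notin> desc f u" using desc_antisym assms by blast
  thus "desc f u \<subset> desc f v" using desc_trans[OF _ assms(1)] self_in_desc by blast
qed

lemma wf_ch: "wf {(u, v). u \<in> ch f v}"
proof (rule wf_subset[OF wf_measure])
  show "{(u, v). u \<in> ch f v} \<subseteq> Wellfounded.measure (\<lambda>v. card (desc f v))"
    using card_desc_less ch_in_desc ch_in by (fastforce simp: ch_def)
qed

lemma shape_unfold: "shape f v = UNode (image_mset (shape f) (mset_set (ch f v)))"
  by (rule shape_unfold_wf[OF wf_ch])

lemma desc_eq_UN: "desc f v = insert v (\<Union>u\<in>ch f v. desc f u)"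
proof (intro equalityI subsetI)
  fix w assume "w \<in> desc f v"
  then obtain k where "(f ^^ k) w = v" by (auto simp: desc_def)
  thus "w \<in> insert v (\<Union>u\<in>ch f v. desc f u)"
  proof (induction k arbitrary: w)
    case (Suc k)
    hence "f w \<in> insert v (\<Union>u\<in>ch f v. desc f u)" by (simp add: funpow_swap1)
    thus ?case
    proof
      assume "f w = v"
      thus ?thesis using self_in_desc[of w f] by (cases "w = v") (auto simp: ch_def)
    qed (use desc_step in blast)
  qed simp
next
  fix w assume "w \<in> insert v (\<Union>u\<in>ch f v. desc f u)"
  thus "w \<in> desc f v" using self_in_desc ch_in_desc desc_trans by blast
qed

lemma usize_shape: "v \<in> V \<Longrightarrow> usize (shape f v) = card (desc f v)"
proof (induction v rule: wf_induct_rule[OF wf_ch])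
  case (1 v)
  have chV: "u \<in> V" if "u \<in> ch f v" for u using ch_in that by blast
  have "usize (shape f v) = Suc (\<Sum>u\<in>ch f v. usize (shape f u))"
    by (subst shape_unfold) (simp add: sum_unfold_sum_mset multiset.map_comp o_def)
  also have "(\<Sum>u\<in>ch f v. usize (shape f u)) = (\<Sum>u\<in>ch f v. card (desc f u))"
    using 1 chV by (intro sum.cong) auto
  also have "\<dots> = card (\<Union>u\<in>ch f v. desc f u)"
  proof (rule card_UN_disjoint[symmetric])
    show "finite (ch f v)" by (rule finite_ch)
    show "\<forall>u\<in>ch f v. finite (desc f u)" using finite_desc chV by blast
    \<comment> \<open>If u lay properly below its sibling u', so would its parent v, which is also
      the parent of u'.\<close>
    have *: False if "u \<in> ch f v" "u' \<in> ch f v" "u \<noteq> u'" "u \<in> desc f u'" for u u'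
      using desc_cases[OF that(4)] that ch_not_desc[OF that(2)] by (auto simp: ch_def)
    show "\<forall>u\<in>ch f v. \<forall>u'\<in>ch f v. u \<noteq> u' \<longrightarrow> desc f u \<inter> desc f u' = {}"
      using * desc_linear by blast
  qed
  also have "Suc \<dots> = card (insert v (\<Union>u\<in>ch f v. desc f u))"
    using ch_not_desc finite_ch finite_desc chV by (subst card_insert_disjoint) auto
  also have "\<dots> = card (desc f v)" by (simp flip: desc_eq_UN)
  finally show ?case .
qed

end

text \<open>\<open>D\<close> is closed under children, so two maps that differ elsewhere, as after
  grafting, have equal shapes throughout \<open>D\<close>.\<close>

lemma shape_cong:
  assumes "wf {(u, v). u \<in> ch f v}" "wf {(u, v). u \<in> ch g v}"
    and D: "\<And>u. u \<in> D \<Longrightarrow> ch f u = ch g u" "\<And>u. u \<in> D \<Longrightarrow> ch g u \<subseteq> D" and "v \<in> D"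
  shows "shape f v = shape g v"
  using \<open>v \<in> D\<close>
proof (induction v rule: wf_induct_rule[OF assms(2)])
  case (1 v)
  have "shape f u = shape g u" if "u \<in># mset_set (ch g v)" for u
  proof -
    have "u \<in> ch g v" using that by (metis elem_mset_set empty_iff mset_set.infinite set_mset_empty)
    thus ?thesis using 1 D(2)[of v] by auto
  qed
  hence "image_mset (shape f) (mset_set (ch g v)) = image_mset (shape g) (mset_set (ch g v))"
    by (rule image_mset_cong)
  thus ?case
    by (subst shape_unfold_wf[OF assms(1)], subst shape_unfold_wf[OF assms(2)]) (simp add: D(1)[OF 1(2)])
qed

section \<open>Cutting a tree above a vertex and grafting it back\<close>

definition glue :: "nat set \<Rightarrow> nat \<Rightarrow> (nat \<Rightarrow> nat) \<Rightarrow> nat \<Rightarrow> (nat \<Rightarrow> nat) \<Rightarrow> nat \<Rightarrow> nat" where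
  "glue S v h y g = (\<lambda>x. if x = v then y else if x \<in> S then h x else g x)"

locale split =
  fixes V :: "nat set" and r :: nat and S :: "nat set" and v :: nat
  assumes fin: "finite V" and r: "r \<in> V" and S: "S \<subseteq> V - {r}" and v: "v \<in> S"
begin

lemma finS: "finite S" using S fin finite_subset by auto

lemma rVS: "r \<in> V - S" using r S by auto

lemma glue_props:
  assumes h: "h \<in> forest S {v}" and y: "y \<in> V - S" and g: "g \<in> forest (V - S) {r}"
  shows "glue S v h y g \<in> forest V {r}" "desc (glue S v h y g) v = S"
proof -
  interpret h: rooted S v h using finS v h by unfold_locales
  interpret g: rooted "V - S" r g using fin rVS g by unfold_locales auto
  let ?F = "glue S v h y g"
  have out: "?F x \<notin> S" if "x \<notin> S" for x
    using that v g.f_in[of x] g.f_out[of x] by (cases "x \<in> V") (auto simp: glue_def)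
  have reach_g: "\<exists>k. (?F ^^ k) x = r" if "x \<in> V - S" for x
  proof -
    have "x \<in> desc g r" by (rule g.reach[OF that])
    then obtain k where k: "(g ^^ k) x \<in> {r}" by (auto simp: desc_def)
    have "\<exists>j. (?F ^^ j) x \<in> {r}"
      by (rule funpow_transfer[OF _ that k]) (use v g.f_in in \<open>auto simp: glue_def\<close>)
    thus ?thesis by simp
  qed
  have reach_h: "\<exists>k. (?F ^^ k) x = v" if "x \<in> S" for x
  proof -
    have "x \<in> desc h v" by (rule h.reach[OF that])
    then obtain k where k: "(h ^^ k) x \<in> {v}" by (auto simp: desc_def)
    have "\<exists>j. (?F ^^ j) x \<in> {v}"
      by (rule funpow_transfer[OF _ that k]) (use v h.f_in in \<open>auto simp: glue_def\<close>)
    thus ?thesis by simp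
  qed
  show "?F \<in> forest V {r}"
  proof (rule forestI)
    fix x assume "x \<in> V" "x \<notin> {r}"
    thus "?F x \<in> V" using y S h.f_in[of x] g.f_in[of x] by (auto simp: glue_def)
  next
    fix x assume "x \<notin> V - {r}"
    hence "x \<notin> S" "x \<noteq> v" "x \<notin> V - S - {r}" using S v by auto
    thus "?F x = x" using forestD(2)[OF g, of x] by (simp add: glue_def)
  next
    fix x assume x: "x \<in> V"
    show "\<exists>k. (?F ^^ k) x \<in> {r}"
    proof (cases "x \<in> S")
      case True
      then obtain j where j: "(?F ^^ j) x = v" using reach_h by blast
      obtain k where k: "(?F ^^ k) y = r" using reach_g[OF y] by blast
      have "?F v = y" by (simp add: glue_def)
      hence "(?F ^^ (k + Suc j)) x = r" by (simp only: funpow_add funpow.simps comp_apply j k)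
      thus ?thesis by blast
    qed (use reach_g x in auto)
  qed
  show "desc ?F v = S"
  proof
    show "desc ?F v \<subseteq> S" by (rule desc_subset_closed[OF out v])
    show "S \<subseteq> desc ?F v" using reach_h by (auto simp: desc_def)
  qed
qed

definition lower :: "(nat \<Rightarrow> nat) \<Rightarrow> nat \<Rightarrow> nat" where "lower f = (\<lambda>x. if x \<in> S - {v} then f x else x)"
definition upper :: "(nat \<Rightarrow> nat) \<Rightarrow> nat \<Rightarrow> nat" where "upper f = (\<lambda>x. if x \<in> V - S - {r} then f x else x)"

lemma split_props:
  assumes f: "f \<in> forest V {r}" and d: "desc f v = S"
  shows "lower f \<in> forest S {v}" "f v \<in> V - S" "upper f \<in> forest (V - S) {r}"
    "glue S v (lower f) (f v) (upper f) = f"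
proof -
  interpret f: rooted V r f using fin r f by unfold_locales
  have inS: "f x \<in> S" if "x \<in> S" "x \<noteq> v" for x using that d desc_cases by blast
  have outS: "f x \<notin> S" if "x \<notin> S" for x using that d desc_step by blast
  show "lower f \<in> forest S {v}"
  proof (rule forestI)
    fix x assume x: "x \<in> S"
    then obtain k where k: "(f ^^ k) x \<in> {v}" using d by (auto simp: desc_def)
    show "\<exists>k. (lower f ^^ k) x \<in> {v}"
      by (rule funpow_transfer[OF _ x k]) (use inS in \<open>auto simp: lower_def\<close>)
  qed (use inS in \<open>auto simp: lower_def\<close>)
  show "f v \<in> V - S"
  proof
    show "f v \<in> V" using f.f_in v S by auto
    show "f v \<notin> S"
    proof
      assume "f v \<in> S"
      then obtain k where "(f ^^ k) (f v) = v" using d by (auto simp: desc_def)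
      hence "(f ^^ Suc k) v = v" by (simp add: funpow_swap1)
      hence "v = r" using f.fixed_imp_root v S by blast
      thus False using v S by auto
    qed
  qed
  show "upper f \<in> forest (V - S) {r}"
  proof (rule forestI)
    fix x assume x: "x \<in> V - S"
    then obtain k where k: "(f ^^ k) x \<in> {r}" using f.reach by (auto simp: desc_def)
    show "\<exists>k. (upper f ^^ k) x \<in> {r}"
      by (rule funpow_transfer[OF _ x k]) (use outS f.f_in in \<open>auto simp: upper_def\<close>)
  qed (use outS f.f_in in \<open>auto simp: upper_def\<close>)
  show "glue S v (lower f) (f v) (upper f) = f"
    using f.f_out f.f_root v by (auto simp: glue_def lower_def upper_def fun_eq_iff)
qed

lemma lower_glue: "h \<in> forest S {v} \<Longrightarrow> lower (glue S v h y g) = h"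
  using forestD(2)[of h S "{v}"] v by (auto simp: glue_def lower_def fun_eq_iff)

lemma upper_glue: "g \<in> forest (V - S) {r} \<Longrightarrow> upper (glue S v h y g) = g"
  using forestD(2)[of g "V - S" "{r}"] v by (auto simp: glue_def upper_def fun_eq_iff)

text \<open>Cutting the edge above \<open>v\<close> leaves three independent choices: a tree on
  \<open>S\<close> rooted at \<open>v\<close>, the parent of \<open>v\<close>, and a tree on the
  rest. The counts with prescribed shapes below all start from this.\<close>

lemma bij_glue:
  "bij_betw (\<lambda>(h, y, g). glue S v h y g) (forest S {v} \<times> (V - S) \<times> forest (V - S) {r})
     {f\<in>forest V {r}. desc f v = S}"
proof (rule bij_betw_byWitness[where f'="\<lambda>f. (lower f, f v, upper f)"])
  show "\<forall>p\<in>forest S {v} \<times> (V - S) \<times> forest (V - S) {r}.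
      (\<lambda>f. (lower f, f v, upper f)) ((\<lambda>(h, y, g). glue S v h y g) p) = p"
    by (auto simp: lower_glue upper_glue) (simp add: glue_def)
  show "\<forall>f\<in>{f\<in>forest V {r}. desc f v = S}. (\<lambda>(h, y, g). glue S v h y g) (lower f, f v, upper f) = f"
    by (auto simp: split_props(4))
  show "(\<lambda>(h, y, g). glue S v h y g) ` (forest S {v} \<times> (V - S) \<times> forest (V - S) {r}) \<subseteq> {f\<in>forest V {r}. desc f v = S}"
    by (auto simp: glue_props)
  show "(\<lambda>f. (lower f, f v, upper f)) ` {f\<in>forest V {r}. desc f v = S} \<subseteq> forest S {v} \<times> (V - S) \<times> forest (V - S) {r}"
    using split_props by auto
qed

text \<open>In the third claim \<open>S\<close> is grafted below \<open>u\<close>, so the subtree of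
  \<open>u\<close> contains it properly. Hence \<open>u\<close> cannot have the same shape as
  \<open>v\<close>, which settles the second-moment count.\<close>

lemma shape_glue:
  assumes h: "h \<in> forest S {v}" and y: "y \<in> V - S" and g: "g \<in> forest (V - S) {r}"
  shows "shape (glue S v h y g) v = shape h v"
    and "u \<in> V - S \<Longrightarrow> y \<notin> desc g u \<Longrightarrow> shape (glue S v h y g) u = shape g u"
    and "u \<in> V - S \<Longrightarrow> y \<in> desc g u \<Longrightarrow> card S < usize (shape (glue S v h y g) u)"
    and "ch (glue S v h r g) r = insert v (ch g r)" "v \<notin> ch g r"
proof -
  let ?F = "glue S v h y g"
  interpret h: rooted S v h using finS v h by unfold_locales
  interpret g: rooted "V - S" r g using fin rVS g by unfold_locales auto
  interpret F: rooted V r ?F using fin r glue_props[OF assms] by unfold_locales auto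
  have chS: "ch ?F u = ch h u" if "u \<in> S" for u
  proof (intro equalityI subsetI)
    fix x assume x: "x \<in> ch ?F u"
    have "x \<in> desc ?F v" using desc_step[of ?F x v] x that glue_props(2)[OF assms] by (simp add: ch_def)
    hence "x \<in> S" using glue_props(2)[OF assms] by simp
    thus "x \<in> ch h u" using x y that by (auto simp: ch_def glue_def split: if_splits)
  next
    fix x assume x: "x \<in> ch h u"
    thus "x \<in> ch ?F u" using h.ch_in[OF x] by (auto simp: ch_def glue_def)
  qed
  show "shape ?F v = shape h v"
    by (rule shape_cong[OF F.wf_ch h.wf_ch, of S]) (use chS h.ch_in v in auto)
  have chD: "ch ?F u = ch g u" if "u \<in> V - S" "u \<noteq> y" for u
  proof (intro equalityI subsetI)
    fix x assume x: "x \<in> ch ?F u"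
    have "x \<noteq> v" using x that by (auto simp: ch_def glue_def)
    moreover have "x \<notin> S" using x that h.f_in[of x] \<open>x \<noteq> v\<close> by (auto simp: ch_def glue_def)
    ultimately show "x \<in> ch g u" using x by (auto simp: ch_def glue_def)
  next
    fix x assume x: "x \<in> ch g u"
    thus "x \<in> ch ?F u" using g.ch_in[OF x] v by (auto simp: ch_def glue_def)
  qed
  show "shape ?F u = shape g u" if u: "u \<in> V - S" "y \<notin> desc g u"
  proof (rule shape_cong[OF F.wf_ch g.wf_ch, of "desc g u"])
    show "u \<in> desc g u" by (rule self_in_desc)
    fix w assume w: "w \<in> desc g u"
    show "ch ?F w = ch g w" using w u g.desc_subset[OF u(1)] by (intro chD) auto
    show "ch g w \<subseteq> desc g u" using w ch_in_desc desc_trans by blast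
  qed
  show "card S < usize (shape ?F u)" if u: "u \<in> V - S" "y \<in> desc g u"
  proof -
    have eq: "?F x = g x" if "x \<in> V - S" for x using that v by (auto simp: glue_def)
    obtain k where k: "(g ^^ k) y = u" using u by (auto simp: desc_def)
    have pow: "(?F ^^ k) x = (g ^^ k) x \<and> (g ^^ k) x \<in> V - S" if "x \<in> V - S" for x
    proof (induction k)
      case (Suc k)
      thus ?case using eq g.f_in by simp
    qed (use that in simp)
    have "y \<in> desc ?F u" using pow[OF y] k by (auto simp: desc_def)
    hence "v \<in> desc ?F u" using desc_step[of ?F v u] by (simp add: glue_def[of S v h y g])
    moreover have "v \<noteq> u" using u v by auto
    ultimately have "card (desc ?F v) < card (desc ?F u)" using u by (intro F.card_desc_less) auto
    thus ?thesis using F.usize_shape[of u] u glue_props(2)[OF assms] by simp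
  qed
  show "v \<notin> ch g r" using g.ch_in v by blast
  show "ch (glue S v h r g) r = insert v (ch g r)"
  proof (intro equalityI subsetI)
    fix x assume x: "x \<in> ch (glue S v h r g) r"
    have "x \<notin> S" if "x \<noteq> v" using x that h.f_in[of x] rVS by (auto simp: ch_def glue_def)
    thus "x \<in> insert v (ch g r)" using x by (auto simp: ch_def glue_def split: if_splits)
  next
    fix x assume x: "x \<in> insert v (ch g r)"
    thus "x \<in> ch (glue S v h r g) r" using g.ch_in[of x r] v S by (auto simp: ch_def glue_def)
  qed
qed

lemma shape_glue_root:
  assumes h: "h \<in> forest S {v}" and g: "g \<in> forest (V - S) {r}"
  shows "shape (glue S v h r g) r = UNode (add_mset (shape h v) (kids (shape g r)))"
proof -
  let ?F = "glue S v h r g"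
  interpret g: rooted "V - S" r g using fin rVS g by unfold_locales auto
  interpret F: rooted V r ?F using fin r glue_props[OF h rVS g] by unfold_locales auto
  have "shape ?F u = shape g u" if "u \<in># mset_set (ch g r)" for u
  proof -
    have "u \<in> ch g r" using that g.finite_ch by simp
    thus ?thesis using shape_glue(2)[OF h rVS g, of u] g.ch_in g.ch_not_desc by auto
  qed
  hence "image_mset (shape ?F) (mset_set (ch g r)) = kids (shape g r)"
    by (subst g.shape_unfold) (auto intro: image_mset_cong)
  thus ?thesis
    using shape_glue(4,5)[OF h rVS g] shape_glue(1)[OF h rVS g] g.finite_ch
    by (subst F.shape_unfold) simp
qed

end

section \<open>Counting trees with prescribed subtree shapes\<close>

lemma usize_pos: "0 < usize t"
  by (cases t) simp

lemma card_subsets_containing: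
  assumes "finite A" "v \<in> A" "0 < s"
  shows "card {S. S \<subseteq> A \<and> v \<in> S \<and> card S = s} = (card A - 1) choose (s - 1)"
proof -
  have "bij_betw (insert v) {S. S \<subseteq> A - {v} \<and> card S = s - 1} {S. S \<subseteq> A \<and> v \<in> S \<and> card S = s}"
  proof (rule bij_betw_byWitness[where f'="\<lambda>S. S - {v}"])
    show "insert v ` {S. S \<subseteq> A - {v} \<and> card S = s - 1} \<subseteq> {S. S \<subseteq> A \<and> v \<in> S \<and> card S = s}"
    proof (rule image_subsetI)
      fix S assume S: "S \<in> {S. S \<subseteq> A - {v} \<and> card S = s - 1}"
      hence "finite S" "v \<notin> S" using assms finite_subset[of S A] by auto
      thus "insert v S \<in> {S. S \<subseteq> A \<and> v \<in> S \<and> card S = s}" using S assms by auto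
    qed
    show "(\<lambda>S. S - {v}) ` {S. S \<subseteq> A \<and> v \<in> S \<and> card S = s} \<subseteq> {S. S \<subseteq> A - {v} \<and> card S = s - 1}" by auto
  qed auto
  from bij_betw_same_card[OF this]
  have "card {S. S \<subseteq> A \<and> v \<in> S \<and> card S = s} = card {S. S \<subseteq> A - {v} \<and> card S = s - 1}" ..
  thus ?thesis using n_subsets[of "A - {v}" "s - 1"] assms by simp
qed

definition shaped :: "nat set \<Rightarrow> nat \<Rightarrow> nat \<Rightarrow> utree \<Rightarrow> (nat \<Rightarrow> nat) set" where
  "shaped V r v \<tau> = {f\<in>forest V {r}. shape f v = \<tau>}"

lemma finite_shaped: "finite V \<Longrightarrow> finite (shaped V r v \<tau>)"
  unfolding shaped_def using finite_forest by auto

lemma glue_at: "glue S v h y g v = y"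
  by (simp add: glue_def)

context split
begin

lemma card_shaped_desc:
  "card {f\<in>shaped V r v \<tau>. desc f v = S} = card (shaped S v v \<tau>) * card (V - S) * card (forest (V - S) {r})"
proof -
  let ?X = "shaped S v v \<tau> \<times> (V - S) \<times> forest (V - S) {r}"
  have im: "(\<lambda>(h, y, g). glue S v h y g) ` ?X = {f\<in>shaped V r v \<tau>. desc f v = S}"
  proof (intro equalityI subsetI)
    fix f assume "f \<in> (\<lambda>(h, y, g). glue S v h y g) ` ?X"
    thus "f \<in> {f\<in>shaped V r v \<tau>. desc f v = S}"
      by (auto simp: shaped_def glue_props shape_glue(1))
  next
    fix f assume "f \<in> {f\<in>shaped V r v \<tau>. desc f v = S}"
    hence f: "f \<in> forest V {r}" "desc f v = S" "shape f v = \<tau>" by (auto simp: shaped_def)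
    note sp = split_props[OF f(1,2)]
    have "shape (lower f) v = \<tau>" using shape_glue(1)[OF sp(1-3)] sp(4) f(3) by simp
    hence "(lower f, f v, upper f) \<in> ?X" using sp by (auto simp: shaped_def)
    thus "f \<in> (\<lambda>(h, y, g). glue S v h y g) ` ?X" using sp(4) by (force simp: image_iff)
  qed
  have inj: "inj_on (\<lambda>(h, y, g). glue S v h y g) ?X"
    by (rule inj_on_subset[OF bij_betw_imp_inj_on[OF bij_glue]]) (auto simp: shaped_def)
  have "card {f\<in>shaped V r v \<tau>. desc f v = S} = card ?X" using card_image[OF inj] unfolding im .
  thus ?thesis by (simp add: card_cartesian_product mult.assoc)
qed

text \<open>With graft point \<open>r\<close> the vertex \<open>v\<close> becomes a child of the
  root, and the shape at the root gains exactly the subtree of \<open>v\<close>.\<close>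

lemma card_shaped_child:
  "card {f\<in>shaped V r r (UNode (add_mset t N)). v \<in> ch f r \<and> shape f v = t \<and> desc f v = S}
     = card (shaped S v v t) * card (shaped (V - S) r r (UNode N))"
proof -
  let ?X = "shaped S v v t \<times> shaped (V - S) r r (UNode N)"
  let ?Y = "{f\<in>shaped V r r (UNode (add_mset t N)). v \<in> ch f r \<and> shape f v = t \<and> desc f v = S}"
  have vr: "v \<noteq> r" using v S by auto
  have im: "(\<lambda>(h, g). glue S v h r g) ` ?X = ?Y"
  proof (intro equalityI subsetI)
    fix f assume "f \<in> (\<lambda>(h, g). glue S v h r g) ` ?X"
    then obtain h g where hg: "h \<in> forest S {v}" "shape h v = t" "g \<in> forest (V - S) {r}" "shape g r = UNode N" "f = glue S v h r g"
      by (auto simp: shaped_def)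
    show "f \<in> ?Y"
      using glue_props[OF hg(1) rVS hg(3)] shape_glue(1)[OF hg(1) rVS hg(3)] shape_glue_root[OF hg(1,3)] hg vr
      by (auto simp: shaped_def ch_def glue_at)
  next
    fix f assume "f \<in> ?Y"
    hence f: "f \<in> forest V {r}" "desc f v = S" "shape f r = UNode (add_mset t N)" "f v = r" "shape f v = t"
      by (auto simp: shaped_def ch_def)
    note sp = split_props[OF f(1,2)]
    have eq: "glue S v (lower f) r (upper f) = f" using sp(4) f(4) by simp
    have 1: "shape (lower f) v = t" using shape_glue(1)[OF sp(1) rVS sp(3)] eq f(5) by simp
    have "kids (shape (upper f) r) = N" using shape_glue_root[OF sp(1,3)] eq f(3) 1 by simp
    hence "shape (upper f) r = UNode N" by (metis UNode_kids)
    hence "(lower f, upper f) \<in> ?X" using sp 1 by (auto simp: shaped_def)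
    thus "f \<in> (\<lambda>(h, g). glue S v h r g) ` ?X" using eq by (force simp: image_iff)
  qed
  have inj: "inj_on (\<lambda>(h, g). glue S v h r g) ?X"
  proof (rule inj_onI)
    fix p q assume pq: "p \<in> ?X" "q \<in> ?X" "(\<lambda>(h, g). glue S v h r g) p = (\<lambda>(h, g). glue S v h r g) q"
    obtain h g h' g' where p: "p = (h, g)" "q = (h', g')" by (cases p; cases q)
    have "lower (glue S v h r g) = lower (glue S v h' r g')" "upper (glue S v h r g) = upper (glue S v h' r g')"
      using pq(3) p by auto
    thus "p = q" using pq(1,2) p lower_glue upper_glue by (auto simp: shaped_def)
  qed
  have "card ?Y = card ?X" using card_image[OF inj] unfolding im .
  thus ?thesis by (simp add: card_cartesian_product)
qed

text \<open>Graft \<open>S\<close> to a tree that already has the shape at \<open>v'\<close>. The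
  graft point must avoid the \<open>card S\<close> descendants of \<open>v'\<close>, since otherwise
  the subtree of \<open>v'\<close> would grow.\<close>

lemma card_shaped_pair:
  assumes v': "v' \<in> V - S - {r}" and \<tau>: "usize \<tau> = card S"
  shows "card {f\<in>shaped V r v \<tau>. desc f v = S \<and> shape f v' = \<tau>}
     = card (shaped S v v \<tau>) * ((card V - card S - card S) * card (shaped (V - S) r v' \<tau>))"
proof -
  let ?G = "SIGMA g:shaped (V - S) r v' \<tau>. (V - S) - desc g v'"
  let ?X = "shaped S v v \<tau> \<times> ?G"
  let ?Y = "{f\<in>shaped V r v \<tau>. desc f v = S \<and> shape f v' = \<tau>}"
  have v'S: "v' \<in> V - S" using v' by auto
  have im: "(\<lambda>(h, g, y). glue S v h y g) ` ?X = ?Y"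
  proof (intro equalityI subsetI)
    fix f assume "f \<in> (\<lambda>(h, g, y). glue S v h y g) ` ?X"
    then obtain h g y where hg: "h \<in> forest S {v}" "shape h v = \<tau>" "g \<in> forest (V - S) {r}" "shape g v' = \<tau>"
       "y \<in> V - S" "y \<notin> desc g v'" "f = glue S v h y g"
      by (auto simp: shaped_def)
    show "f \<in> ?Y"
      using glue_props[OF hg(1,5,3)] shape_glue(1)[OF hg(1,5,3)] shape_glue(2)[OF hg(1,5,3) v'S hg(6)] hg
      by (auto simp: shaped_def)
  next
    fix f assume "f \<in> ?Y"
    hence f: "f \<in> forest V {r}" "desc f v = S" "shape f v = \<tau>" "shape f v' = \<tau>" by (auto simp: shaped_def)
    note sp = split_props[OF f(1,2)]
    have 1: "shape (lower f) v = \<tau>" using shape_glue(1)[OF sp(1-3)] sp(4) f(3) by simp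
    have 2: "f v \<notin> desc (upper f) v'"
      using shape_glue(3)[OF sp(1-3) v'S] sp(4) f(4) \<tau> by auto
    have 3: "shape (upper f) v' = \<tau>" using shape_glue(2)[OF sp(1-3) v'S 2] sp(4) f(4) by simp
    have "(lower f, upper f, f v) \<in> ?X" using sp 1 2 3 by (auto simp: shaped_def)
    thus "f \<in> (\<lambda>(h, g, y). glue S v h y g) ` ?X" using sp(4) by (force simp: image_iff)
  qed
  have inj: "inj_on (\<lambda>(h, g, y). glue S v h y g) ?X"
  proof (rule inj_onI)
    fix p q assume pq: "p \<in> ?X" "q \<in> ?X" "(\<lambda>(h, g, y). glue S v h y g) p = (\<lambda>(h, g, y). glue S v h y g) q"
    obtain h g y h' g' y' where p: "p = (h, g, y)" "q = (h', g', y')" by (cases p; cases q)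
    have "glue S v h y g = glue S v h' y' g'" using pq(3) p by auto
    hence "(h, y, g) = (h', y', g')"
      using inj_onD[OF bij_betw_imp_inj_on[OF bij_glue], of "(h, y, g)" "(h', y', g')"] pq(1,2) p by (auto simp: shaped_def)
    thus "p = q" using p by simp
  qed
  have "card ?Y = card ?X" using card_image[OF inj] unfolding im .
  also have "\<dots> = card (shaped S v v \<tau>) * card ?G" by (simp add: card_cartesian_product)
  also have "card ?G = (\<Sum>g\<in>shaped (V - S) r v' \<tau>. card ((V - S) - desc g v'))"
    using fin finite_shaped by (intro card_SigmaI) auto
  also have "\<dots> = (\<Sum>g\<in>shaped (V - S) r v' \<tau>. card V - card S - card S)"
  proof (rule sum.cong[OF refl])
    fix g assume g: "g \<in> shaped (V - S) r v' \<tau>"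
    interpret g: rooted "V - S" r g using fin rVS g by unfold_locales (auto simp: shaped_def)
    have "card (desc g v') = card S" using g.usize_shape[OF v'S] g \<tau> by (simp add: shaped_def)
    moreover have "card (V - S) = card V - card S" using S finS by (intro card_Diff_subset) auto
    ultimately show "card ((V - S) - desc g v') = card V - card S - card S"
      using card_Diff_subset[OF g.finite_desc[OF v'S] g.desc_subset[OF v'S]] by simp
  qed
  finally show ?thesis by (simp add: mult.commute)
qed

end

text \<open>A shape of size s has s! / aut labellings, a fraction 1/s of them with the given root
  label. The proof counts pairs of a tree and a child \<open>c\<close> of the root with subtree
  \<open>t\<close> in two ways; removing that subtree matches the recursion of
  \<open>aut\<close>.\<close>

lemma card_shaped_root:
  assumes "finite S" "v \<in> S" "card S = usize \<tau>"
  shows "real (card (shaped S v v \<tau>)) = fact (card S - 1) / real (aut \<tau>)"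
  using assms
proof (induction "usize \<tau>" arbitrary: \<tau> S v rule: less_induct)
  case less
  note S = less.prems
  obtain M where \<tau>: "\<tau> = UNode M" by (cases \<tau>)
  show ?case
  proof (cases "M = {#}")
    case True
    hence "card S = 1" using S \<tau> by simp
    hence Sv: "S = {v}" using S(2) by (metis card_1_singletonE singletonD)
    interpret rooted S v "\<lambda>x. x" using S Sv forest_self[of S] by unfold_locales auto
    have "shape (\<lambda>x. x) v = UNode {#}" by (subst shape_unfold) (simp add: ch_def)
    hence "shaped S v v \<tau> = {\<lambda>x. x}" unfolding shaped_def Sv forest_self using True \<tau> by auto
    thus ?thesis using \<tau> True Sv by simp
  next
    case False
    then obtain t N where M: "M = add_mset t N" by (metis multiset_cases)
    define a where "a = usize t"
    have apos: "0 < a" by (simp add: a_def usize_pos)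
    have sz: "card S = a + usize (UNode N)" using S(3) by (simp add: \<tau> M a_def)
    have bpos: "0 < usize (UNode N)" by (rule usize_pos)
    let ?A = "shaped S v v \<tau>"
    \<comment> \<open>The possible label sets \<open>S'\<close> of the removed subtree, together
      with the label of its root.\<close>
    let ?I = "SIGMA S':{S'. S' \<subseteq> S - {v} \<and> card S' = a}. S'"
    define X where "X = (\<lambda>S' c. {h\<in>?A. c \<in> ch h v \<and> shape h c = t \<and> desc h c = S'})"
    have finI: "finite ?I" using S(1) by (intro finite_SigmaI) (auto intro: finite_subset)
    have rt: "rooted S v h" if "h \<in> ?A" for h using that S by unfold_locales (auto simp: shaped_def)
    have cnt: "card {c\<in>ch h v. shape h c = t} = Suc (count N t)" if h: "h \<in> ?A" for h
    proof -
      interpret rooted S v h by (rule rt[OF h])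
      have "UNode (image_mset (shape h) (mset_set (ch h v))) = \<tau>" using shape_unfold[of v] h by (simp add: shaped_def)
      hence "count (image_mset (shape h) (mset_set (ch h v))) t = Suc (count N t)" by (simp add: \<tau> M)
      moreover have "count (image_mset (shape h) (mset_set (ch h v))) t = card {c\<in>ch h v. shape h c = t}"
        using finite_ch[of v] by (simp add: count_image_mset_eq_card_vimage conj_commute Collect_conj_eq[symmetric])
      ultimately show ?thesis by simp
    qed
    have "card ?A * Suc (count N t) = (\<Sum>h\<in>?A. card {c\<in>ch h v. shape h c = t})" using cnt by simp
    also have "\<dots> = card (SIGMA h:?A. {c\<in>ch h v. shape h c = t})"
      using finite_shaped[OF S(1)] rooted.finite_ch[OF rt] by (intro card_SigmaI[symmetric] ballI) auto
    also have "\<dots> = card (SIGMA p:?I. X (fst p) (snd p))"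
    proof (rule bij_betw_same_card)
      show "bij_betw (\<lambda>(h, c). ((desc h c, c), h)) (SIGMA h:?A. {c\<in>ch h v. shape h c = t}) (SIGMA p:?I. X (fst p) (snd p))"
      proof (rule bij_betw_byWitness[where f'="\<lambda>(p, h). (h, snd p)"])
        show "(\<lambda>(h, c). ((desc h c, c), h)) ` (SIGMA h:?A. {c\<in>ch h v. shape h c = t}) \<subseteq> (SIGMA p:?I. X (fst p) (snd p))"
        proof (rule image_subsetI)
          fix q assume "q \<in> (SIGMA h:?A. {c\<in>ch h v. shape h c = t})"
          then obtain h c where q: "q = (h, c)" "h \<in> ?A" "c \<in> ch h v" "shape h c = t" by auto
          interpret rooted S v h by (rule rt[OF q(2)])
          have "c \<in> S" using ch_in[OF q(3)] by auto
          moreover have "card (desc h c) = a" using usize_shape[OF \<open>c \<in> S\<close>] q by (simp add: a_def)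
          moreover have "desc h c \<subseteq> S - {v}" using desc_subset[OF \<open>c \<in> S\<close>] ch_not_desc[OF q(3)] by auto
          ultimately show "(\<lambda>(h, c). ((desc h c, c), h)) q \<in> (SIGMA p:?I. X (fst p) (snd p))"
            using q self_in_desc by (auto simp: X_def)
        qed
      qed (auto simp: X_def)
    qed
    also have "\<dots> = (\<Sum>p\<in>?I. card (X (fst p) (snd p)))"
      using finI finite_shaped[OF S(1)] by (intro card_SigmaI) (auto simp: X_def)
    finally have nat_eq: "card ?A * Suc (count N t) = (\<Sum>p\<in>?I. card (X (fst p) (snd p)))" .
    have "real (card ?A) * real (Suc (count N t)) = (\<Sum>p\<in>?I. real (card (X (fst p) (snd p))))"
      using arg_cong[OF nat_eq, of real] by (simp only: of_nat_mult of_nat_sum)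
    also have "\<dots> = (\<Sum>p\<in>?I. fact (a - 1) / real (aut t) * (fact (usize (UNode N) - 1) / real (aut (UNode N))))"
    proof (rule sum.cong[OF refl])
      fix p assume "p \<in> ?I"
      then obtain S' c where p: "p = (S', c)" "S' \<subseteq> S - {v}" "card S' = a" "c \<in> S'" by auto
      interpret sp: split S v S' c using S p by unfold_locales auto
      have "card (X S' c) = card (shaped S' c c t) * card (shaped (S - S') v v (UNode N))"
        using sp.card_shaped_child[of t N] by (simp add: X_def \<tau> M)
      moreover have "real (card (shaped S' c c t)) = fact (a - 1) / real (aut t)"
        using less.hyps[of t S' c] p sp.finS S(3) sz bpos by (simp add: a_def \<tau> M)
      moreover have "card (S - S') = usize (UNode N)" using card_Diff_subset[OF sp.finS, of S] p sz by auto
      moreover have "real (card (shaped (S - S') v v (UNode N))) = fact (usize (UNode N) - 1) / real (aut (UNode N))"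
        using less.hyps[of "UNode N" "S - S'" v] calculation(3) S sp.rVS sz apos by (simp add: \<tau> M a_def usize_pos)
      ultimately show "real (card (X (fst p) (snd p))) = fact (a - 1) / real (aut t) * (fact (usize (UNode N) - 1) / real (aut (UNode N)))"
        using p by simp
    qed
    also have "\<dots> = real (card ?I) * (fact (a - 1) / real (aut t) * (fact (usize (UNode N) - 1) / real (aut (UNode N))))" by simp
    also have "card ?I = ((card S - 1) choose a) * a"
    proof -
      have "card ?I = (\<Sum>S'\<in>{S'. S' \<subseteq> S - {v} \<and> card S' = a}. card S')"
        using S(1) by (intro card_SigmaI) (auto intro: finite_subset)
      thus ?thesis using n_subsets[of "S - {v}" a] S by simp
    qed
    also have "real (((card S - 1) choose a) * a) = fact (card S - 1) / (fact (a - 1) * fact (usize (UNode N) - 1))"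
    proof -
      have "card S - 1 - a = usize (UNode N) - 1" "a \<le> card S - 1" using sz bpos by auto
      moreover have "fact a = real a * fact (a - 1)" using apos by (simp add: fact_reduce)
      ultimately show ?thesis using apos by (simp add: binomial_fact field_simps)
    qed
    finally have "real (card ?A) * real (Suc (count N t)) = fact (card S - 1) / (real (aut t) * real (aut (UNode N)))"
      by (simp add: field_simps)
    moreover have "real (aut \<tau>) = real (Suc (count N t)) * (real (aut t) * real (aut (UNode N)))"
      unfolding \<tau> M aut_add_mset by (simp only: of_nat_mult mult.assoc)
    moreover have "x = f / A" if "x * c = f / d" "A = c * d" "c \<noteq> 0" for x c f d A :: real
    proof -
      have "x = (x * c) / c" using that(3) by simp
      also have "\<dots> = f / A" unfolding that(1,2) by (simp add: mult.commute)
      finally show ?thesis .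
    qed
    moreover have "real (Suc (count N t)) \<noteq> 0" by simp
    ultimately show ?thesis by blast
  qed
qed

section \<open>Moments of the number of subtrees of a given shape\<close>

text \<open>Classifies by the descendant set of \<open>v\<close>. \<open>D\<close> records what
  \<open>P\<close> forces on that set; in the pair count it keeps \<open>v'\<close> out.\<close>

lemma card_shaped_eq_sum:
  assumes "finite V" "r \<in> V" "v \<in> V" "v \<noteq> r" and P: "\<And>f. f \<in> shaped V r v \<tau> \<Longrightarrow> P f \<Longrightarrow> desc f v \<subseteq> D"
  shows "card {f\<in>shaped V r v \<tau>. P f} =
    (\<Sum>S\<in>{S. S \<subseteq> (V - {r}) \<inter> D \<and> v \<in> S \<and> card S = usize \<tau>}. card {f\<in>shaped V r v \<tau>. desc f v = S \<and> P f})"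
proof -
  let ?I = "{S. S \<subseteq> (V - {r}) \<inter> D \<and> v \<in> S \<and> card S = usize \<tau>}"
  have "{f\<in>shaped V r v \<tau>. P f} = (\<Union>S\<in>?I. {f\<in>shaped V r v \<tau>. desc f v = S \<and> P f})"
  proof (intro equalityI subsetI)
    fix f assume f: "f \<in> {f\<in>shaped V r v \<tau>. P f}"
    interpret F: rooted V r f using assms f by unfold_locales (auto simp: shaped_def)
    have "r \<notin> desc f v"
    proof
      assume "r \<in> desc f v"
      hence "v = r" using F.desc_antisym[of v r] F.reach[OF assms(3)] assms(3) by blast
      thus False using assms(4) by simp
    qed
    hence "desc f v \<in> ?I"
      using F.usize_shape[OF assms(3)] F.desc_subset[OF assms(3)] self_in_desc[of v f] f P[of f] by (auto simp: shaped_def)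
    thus "f \<in> (\<Union>S\<in>?I. {f\<in>shaped V r v \<tau>. desc f v = S \<and> P f})" using f by auto
  qed auto
  moreover have "card (\<Union>S\<in>?I. {f\<in>shaped V r v \<tau>. desc f v = S \<and> P f}) = (\<Sum>S\<in>?I. card {f\<in>shaped V r v \<tau>. desc f v = S \<and> P f})"
    using assms(1) finite_shaped[OF assms(1)] by (intro card_UN_disjoint) auto
  ultimately show ?thesis by simp
qed

text \<open>Choose the other labels of the subtree among the non-root vertices, then its tree, then
  a parent and a tree on the remaining m vertices: m * m^(m - 2) = m^(m - 1).\<close>

lemma card_shaped:
  assumes V: "finite V" "r \<in> V" and v: "v \<in> V" "v \<noteq> r"
  shows "real (card (shaped V r v \<tau>)) = real ((card V - 2) choose (usize \<tau> - 1)) * (fact (usize \<tau> - 1) / real (aut \<tau>)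
     * real (card V - usize \<tau>) ^ (card V - usize \<tau> - 1))"
proof -
  let ?I = "{S. S \<subseteq> V - {r} \<and> v \<in> S \<and> card S = usize \<tau>}"
  have "card (shaped V r v \<tau>) = (\<Sum>S\<in>?I. card {f\<in>shaped V r v \<tau>. desc f v = S})"
    using card_shaped_eq_sum[OF V v, of \<tau> "\<lambda>_. True" UNIV] by simp
  hence "real (card (shaped V r v \<tau>)) = (\<Sum>S\<in>?I. real (card {f\<in>shaped V r v \<tau>. desc f v = S}))" by simp
  also have "\<dots> = (\<Sum>S\<in>?I. fact (usize \<tau> - 1) / real (aut \<tau>) * real (card V - usize \<tau>) ^ (card V - usize \<tau> - 1))"
  proof (rule sum.cong[OF refl])
    fix S assume S: "S \<in> ?I"
    interpret sp: split V r S v using V S by unfold_locales auto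
    have c: "card (V - S) = card V - usize \<tau>" using S card_Diff_subset[OF sp.finS, of V] by auto
    have "card (V - S) > 0" using sp.rVS V by (auto simp: card_gt_0_iff)
    thus "real (card {f\<in>shaped V r v \<tau>. desc f v = S}) = fact (usize \<tau> - 1) / real (aut \<tau>) * real (card V - usize \<tau>) ^ (card V - usize \<tau> - 1)"
      using card_shaped_root[OF sp.finS, of v \<tau>] S card_forest_root[of "V - S" r] sp.rVS V
      by (simp add: sp.card_shaped_desc c)
  qed
  also have "\<dots> = real (card ?I) * (fact (usize \<tau> - 1) / real (aut \<tau>) * real (card V - usize \<tau>) ^ (card V - usize \<tau> - 1))" by simp
  also have "card ?I = (card V - 2) choose (usize \<tau> - 1)"
    using card_subsets_containing[of "V - {r}" v "usize \<tau>"] V v usize_pos[of \<tau>] by (simp add: numeral_2_eq_2)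
  finally show ?thesis .
qed

text \<open>Equal shapes have equal sizes, so neither vertex descends from the other. The subtree of
  \<open>v\<close> is cut off first, and \<open>card_shaped\<close> counts what remains.\<close>

lemma card_shaped_both:
  assumes V: "finite V" "r \<in> V" and v: "v \<in> V" "v \<noteq> r" and v': "v' \<in> V" "v' \<noteq> r" "v \<noteq> v'"
  shows "real (card {f\<in>shaped V r v \<tau>. shape f v' = \<tau>}) = real ((card V - 3) choose (usize \<tau> - 1)) * (fact (usize \<tau> - 1) / real (aut \<tau>)
     * (real (card V - usize \<tau> - usize \<tau>) * (real ((card V - usize \<tau> - 2) choose (usize \<tau> - 1)) * (fact (usize \<tau> - 1) / real (aut \<tau>)
     * real (card V - usize \<tau> - usize \<tau>) ^ (card V - usize \<tau> - usize \<tau> - 1)))))"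
proof -
  let ?I = "{S. S \<subseteq> (V - {r}) \<inter> (- {v'}) \<and> v \<in> S \<and> card S = usize \<tau>}"
  let ?B = "(fact (usize \<tau> - 1) / real (aut \<tau>)
     * (real (card V - usize \<tau> - usize \<tau>) * (real ((card V - usize \<tau> - 2) choose (usize \<tau> - 1)) * (fact (usize \<tau> - 1) / real (aut \<tau>)
     * real (card V - usize \<tau> - usize \<tau>) ^ (card V - usize \<tau> - usize \<tau> - 1)))))"
  have "card {f\<in>shaped V r v \<tau>. shape f v' = \<tau>} = (\<Sum>S\<in>?I. card {f\<in>shaped V r v \<tau>. desc f v = S \<and> shape f v' = \<tau>})"
  proof (rule card_shaped_eq_sum[OF V v])
    fix f assume f: "f \<in> shaped V r v \<tau>" "shape f v' = \<tau>"
    interpret F: rooted V r f using V f by unfold_locales (auto simp: shaped_def)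
    have "card (desc f v) = card (desc f v')" using F.usize_shape[OF v(1)] F.usize_shape[OF v'(1)] f by (simp add: shaped_def)
    thus "desc f v \<subseteq> - {v'}" using F.card_desc_less[of v' v] v v' by auto
  qed
  hence "real (card {f\<in>shaped V r v \<tau>. shape f v' = \<tau>}) = (\<Sum>S\<in>?I. real (card {f\<in>shaped V r v \<tau>. desc f v = S \<and> shape f v' = \<tau>}))" by simp
  also have "\<dots> = (\<Sum>S\<in>?I. ?B)"
  proof (rule sum.cong[OF refl])
    fix S assume S: "S \<in> ?I"
    interpret sp: split V r S v using V S by unfold_locales auto
    have c: "card (V - S) = card V - usize \<tau>" using S card_Diff_subset[OF sp.finS, of V] by auto
    have "real (card (shaped (V - S) r v' \<tau>)) = real ((card V - usize \<tau> - 2) choose (usize \<tau> - 1)) * (fact (usize \<tau> - 1) / real (aut \<tau>)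
     * real (card V - usize \<tau> - usize \<tau>) ^ (card V - usize \<tau> - usize \<tau> - 1))"
      using card_shaped[of "V - S" r v' \<tau>] V sp.rVS v' S by (simp add: c)
    moreover have "real (card (shaped S v v \<tau>)) = fact (usize \<tau> - 1) / real (aut \<tau>)"
      using card_shaped_root[OF sp.finS, of v \<tau>] S by simp
    moreover have "card {f\<in>shaped V r v \<tau>. desc f v = S \<and> shape f v' = \<tau>}
     = card (shaped S v v \<tau>) * ((card V - card S - card S) * card (shaped (V - S) r v' \<tau>))"
      by (rule sp.card_shaped_pair) (use S v' in auto)
    ultimately show "real (card {f\<in>shaped V r v \<tau>. desc f v = S \<and> shape f v' = \<tau>}) = ?B"
      using S by simp
  qed
  also have "\<dots> = real (card ?I) * ?B" by simp
  also have "card ?I = (card V - 3) choose (usize \<tau> - 1)"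
  proof -
    have "(V - {r}) \<inter> (- {v'}) = V - {r, v'}" by auto
    moreover have "card (V - {r, v'}) = card V - 2" using V v' by (subst card_Diff_subset) auto
    ultimately show ?thesis
      using card_subsets_containing[of "V - {r, v'}" v "usize \<tau>"] V v v' usize_pos[of \<tau>] by (simp add: numeral_3_eq_3 numeral_2_eq_2)
  qed
  finally show ?thesis .
qed

section \<open>Asymptotics of the first two moments\<close>

lemma binomial_asymp:
  "(\<lambda>n. real ((n - c) choose k) * fact k / real n ^ k) \<longlonglongrightarrow> 1"
proof -
  have "(\<lambda>n. \<Prod>i<k. (real n - (real c + real i)) / real n) \<longlonglongrightarrow> (\<Prod>i<k. 1)"
  proof (rule tendsto_prod)
    fix i show "(\<lambda>n. (real n - (real c + real i)) / real n) \<longlonglongrightarrow> 1" by real_asymp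
  qed
  moreover have "\<forall>\<^sub>F n in sequentially. (\<Prod>i<k. (real n - (real c + real i)) / real n) = real ((n - c) choose k) * fact k / real n ^ k"
    using eventually_ge_at_top[of c]
  proof eventually_elim
    case (elim n)
    have "real ((n - c) choose k) * fact k = (\<Prod>i<k. real (n - c) - real i)"
      by (simp add: binomial_gbinomial gbinomial_prod_rev atLeast0LessThan)
    also have "\<dots> = (\<Prod>i<k. real n - (real c + real i))" using elim by (simp add: of_nat_diff algebra_simps)
    finally show ?case by (simp add: prod_dividef)
  qed
  ultimately show ?thesis by (simp add: filterlim_cong)
qed

text \<open>The origin of the factor exp (- size) in \<open>gw\<close>: trees on the vertices left
  after removing a subtree, compared with trees on all n vertices.\<close>

lemma power_ratio_asymp:
  "(\<lambda>n. real (n - c) ^ (n - d) / real n ^ (n - d)) \<longlonglongrightarrow> exp (- real c)"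
proof -
  have 1: "(\<lambda>n. (1 + (- real c) / real n) ^ n) \<longlonglongrightarrow> exp (- real c)"
    by (rule tendsto_exp_limit_sequentially)
  have "(\<lambda>n. 1 + (- real c) / real n) \<longlonglongrightarrow> 1" by real_asymp
  hence "(\<lambda>n. (1 + (- real c) / real n) ^ d) \<longlonglongrightarrow> 1 ^ d" by (intro tendsto_intros)
  with 1 have "(\<lambda>n. (1 + (- real c) / real n) ^ n / (1 + (- real c) / real n) ^ d) \<longlonglongrightarrow> exp (- real c) / 1 ^ d"
    by (rule tendsto_divide) simp
  moreover have "\<forall>\<^sub>F n in sequentially. (1 + (- real c) / real n) ^ n / (1 + (- real c) / real n) ^ d = real (n - c) ^ (n - d) / real n ^ (n - d)"
    using eventually_gt_at_top[of c] eventually_ge_at_top[of d]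
  proof eventually_elim
    case (elim n)
    have eq: "1 + (- real c) / real n = real (n - c) / real n" using elim by (simp add: of_nat_diff field_simps)
    have "real (n - c) / real n \<noteq> 0" using elim by simp
    hence "(real (n - c) / real n) ^ n / (real (n - c) / real n) ^ d = (real (n - c) / real n) ^ (n - d)"
      using elim by (simp add: power_diff)
    thus ?case unfolding eq by (simp add: power_divide)
  qed
  ultimately show ?thesis by (simp add: filterlim_cong)
qed

text \<open>The root 0 is left out since the counts require a vertex different from the root; one
  vertex in n does not affect the limit.\<close>

definition shape_count :: "nat \<Rightarrow> (nat \<Rightarrow> nat) \<Rightarrow> utree \<Rightarrow> nat" where
  "shape_count n f \<tau> = card {v\<in>{1..<n}. shape f v = \<tau>}"

abbreviation tmaps :: "nat \<Rightarrow> (nat \<Rightarrow> nat) set" where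
  "tmaps n \<equiv> forest {..<n} {0}"

lemma card_tmaps: "0 < n \<Longrightarrow> real (card (tmaps n)) = real n ^ (n - 1) / real n"
  using card_forest_root[of "{..<n}" 0] by simp

lemma finite_tmaps: "finite (tmaps n)"
  by (rule finite_forest) simp

text \<open>Numbers of trees, not yet normalised: \<open>mean1\<close> is the count of
  \<open>card_shaped\<close> on n vertices, \<open>mean2\<close> that of
  \<open>card_shaped_both\<close>.\<close>

definition "mean1 n \<tau> = real ((n - 2) choose (usize \<tau> - 1)) * (fact (usize \<tau> - 1) / real (aut \<tau>)
     * real (n - usize \<tau>) ^ (n - usize \<tau> - 1))"

definition "mean2 n \<tau> = real ((n - 3) choose (usize \<tau> - 1)) * (fact (usize \<tau> - 1) / real (aut \<tau>)
     * (real (n - usize \<tau> - usize \<tau>) * (real ((n - usize \<tau> - 2) choose (usize \<tau> - 1)) * (fact (usize \<tau> - 1) / real (aut \<tau>)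
     * real (n - usize \<tau> - usize \<tau>) ^ (n - usize \<tau> - usize \<tau> - 1)))))"

lemma shape_count_eq_sum: "real (shape_count n f \<tau>) = (\<Sum>v\<in>{1..<n}. of_bool (shape f v = \<tau>))"
  unfolding shape_count_def by (simp add: of_bool_def sum.If_cases Int_def)

lemma sum_shape_count: "(\<Sum>f\<in>tmaps n. real (shape_count n f \<tau>)) = real (n - 1) * mean1 n \<tau>"
proof -
  have "(\<Sum>f\<in>tmaps n. real (shape_count n f \<tau>)) = (\<Sum>v\<in>{1..<n}. \<Sum>f\<in>tmaps n. of_bool (shape f v = \<tau>))"
    unfolding shape_count_eq_sum by (rule sum.swap)
  also have "\<dots> = (\<Sum>v\<in>{1..<n}. mean1 n \<tau>)"
  proof (rule sum.cong[OF refl])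
    fix v assume v: "v \<in> {1..<n}"
    have "(\<Sum>f\<in>tmaps n. of_bool (shape f v = \<tau>)) = real (card (shaped {..<n} 0 v \<tau>))"
      using finite_tmaps by (simp add: of_bool_def sum.If_cases Int_def shaped_def)
    thus "(\<Sum>f\<in>tmaps n. of_bool (shape f v = \<tau>)) = mean1 n \<tau>"
      using card_shaped[of "{..<n}" 0 v \<tau>] v by (simp add: mean1_def)
  qed
  finally show ?thesis by simp
qed

lemma sum_shape_count_sq:
  "(\<Sum>f\<in>tmaps n. (real (shape_count n f \<tau>))\<^sup>2) = real (n - 1) * mean1 n \<tau> + real (n - 1) * real (n - 2) * mean2 n \<tau>"
proof -
  let ?b = "\<lambda>f v. of_bool (shape f v = \<tau>) :: real"
  have "(\<Sum>f\<in>tmaps n. (real (shape_count n f \<tau>))\<^sup>2) = (\<Sum>f\<in>tmaps n. \<Sum>v\<in>{1..<n}. \<Sum>v'\<in>{1..<n}. ?b f v * ?b f v')"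
    unfolding shape_count_eq_sum power2_eq_square sum_product ..
  also have "\<dots> = (\<Sum>f\<in>tmaps n. \<Sum>v\<in>{1..<n}. ?b f v + (\<Sum>v'\<in>{1..<n} - {v}. ?b f v * ?b f v'))"
  proof (intro sum.cong refl)
    fix f v assume "v \<in> {1..<n}"
    hence "(\<Sum>v'\<in>{1..<n}. ?b f v * ?b f v') = ?b f v * ?b f v + (\<Sum>v'\<in>{1..<n} - {v}. ?b f v * ?b f v')"
      by (intro sum.remove) auto
    thus "(\<Sum>v'\<in>{1..<n}. ?b f v * ?b f v') = ?b f v + (\<Sum>v'\<in>{1..<n} - {v}. ?b f v * ?b f v')"
      by (simp only: of_bool_conj[symmetric] conj_absorb)
  qed
  also have "\<dots> = (\<Sum>f\<in>tmaps n. real (shape_count n f \<tau>)) + (\<Sum>f\<in>tmaps n. \<Sum>v\<in>{1..<n}. \<Sum>v'\<in>{1..<n} - {v}. ?b f v * ?b f v')"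
    by (simp add: sum.distrib shape_count_eq_sum)
  also have "(\<Sum>f\<in>tmaps n. \<Sum>v\<in>{1..<n}. \<Sum>v'\<in>{1..<n} - {v}. ?b f v * ?b f v') = (\<Sum>v\<in>{1..<n}. \<Sum>v'\<in>{1..<n} - {v}. \<Sum>f\<in>tmaps n. ?b f v * ?b f v')"
    by (subst sum.swap) (intro sum.cong refl sum.swap)
  also have "\<dots> = (\<Sum>v\<in>{1..<n}. \<Sum>v'\<in>{1..<n} - {v}. mean2 n \<tau>)"
  proof (intro sum.cong refl)
    fix v v' assume v: "v \<in> {1..<n}" "v' \<in> {1..<n} - {v}"
    have "(\<Sum>f\<in>tmaps n. ?b f v * ?b f v') = (\<Sum>f\<in>tmaps n. of_bool (shape f v = \<tau> \<and> shape f v' = \<tau>))"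
      by (simp add: of_bool_conj)
    also have "\<dots> = real (card {f\<in>shaped {..<n} 0 v \<tau>. shape f v' = \<tau>})"
      using finite_tmaps by (simp add: of_bool_def sum.If_cases Int_def shaped_def conj_assoc)
    finally show "(\<Sum>f\<in>tmaps n. ?b f v * ?b f v') = mean2 n \<tau>"
      using card_shaped_both[of "{..<n}" 0 v v' \<tau>] v by (simp add: mean2_def)
  qed
  also have "\<dots> = (\<Sum>v\<in>{1..<n}. real (n - 2) * mean2 n \<tau>)"
  proof (rule sum.cong[OF refl])
    fix v assume "v \<in> {1..<n}"
    hence "card ({1..<n} - {v}) = n - 2" by (simp add: numeral_2_eq_2)
    thus "(\<Sum>v'\<in>{1..<n} - {v}. mean2 n \<tau>) = real (n - 2) * mean2 n \<tau>" by (simp only: sum_constant)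
  qed
  also have "\<dots> = real (n - 1) * real (n - 2) * mean2 n \<tau>"
    by (simp only: sum_constant card_atLeastLessThan mult.assoc)
  finally show ?thesis by (simp add: sum_shape_count)
qed

lemma mean1_asymp:
  "(\<lambda>n. real (n - 1) * mean1 n \<tau> / (real n * real (card (tmaps n)))) \<longlonglongrightarrow> gw \<tau>"
proof -
  define s where "s = usize \<tau>"
  have "(\<lambda>n. real (n - 1) / real n * (real ((n - 2) choose (s - 1)) * fact (s - 1) / real n ^ (s - 1)) *
      (real (n - s) ^ (n - (s + 1)) / real n ^ (n - (s + 1))) / real (aut \<tau>)) \<longlonglongrightarrow> 1 * 1 * exp (- real s) / real (aut \<tau>)"
  proof (intro tendsto_intros binomial_asymp power_ratio_asymp)
    show "(\<lambda>n. real (n - 1) / real n) \<longlonglongrightarrow> 1" using binomial_asymp[of 1 1] by simp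
    show "real (aut \<tau>) \<noteq> 0" using aut_pos[of \<tau>] by simp
  qed
  moreover have "\<forall>\<^sub>F n in sequentially. real (n - 1) / real n * (real ((n - 2) choose (s - 1)) * fact (s - 1) / real n ^ (s - 1)) *
      (real (n - s) ^ (n - (s + 1)) / real n ^ (n - (s + 1))) / real (aut \<tau>) = real (n - 1) * mean1 n \<tau> / (real n * real (card (tmaps n)))"
    using eventually_gt_at_top[of s]
  proof eventually_elim
    case (elim n)
    have "s > 0" using usize_pos s_def by simp
    \<comment> \<open>\<open>n * card (tmaps n)\<close> is n^(n - 1); its powers of n are shared out
      among the factors of the product whose limits are known.\<close>
    hence e: "n - 1 = Suc ((s - 1) + (n - (s + 1)))" using elim by simp
    have "real n ^ (n - 1) = real n * (real n ^ (s - 1) * real n ^ (n - (s + 1)))"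
      by (subst e) (simp only: power_add power_Suc)
    hence nT: "real n * real (card (tmaps n)) = real n * (real n ^ (s - 1) * real n ^ (n - (s + 1)))"
      using card_tmaps[of n] elim by simp
    show ?case unfolding nT mean1_def s_def[symmetric] by (simp add: mult_ac)
  qed
  ultimately show ?thesis by (simp add: filterlim_cong gw_def s_def)
qed

lemma mean2_asymp:
  "(\<lambda>n. real (n - 1) * real (n - 2) * mean2 n \<tau> / ((real n)\<^sup>2 * real (card (tmaps n)))) \<longlonglongrightarrow> (gw \<tau>)\<^sup>2"
proof -
  define s where "s = usize \<tau>"
  have "(\<lambda>n. real (n - 1) / real n * (real (n - 2) / real n) * (real ((n - 3) choose (s - 1)) * fact (s - 1) / real n ^ (s - 1)) *
      (real ((n - (s + 2)) choose (s - 1)) * fact (s - 1) / real n ^ (s - 1)) *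
      (real (n - 2 * s) ^ (n - 2 * s) / real n ^ (n - 2 * s)) / (real (aut \<tau>))\<^sup>2) \<longlonglongrightarrow> 1 * 1 * 1 * 1 * exp (- real (2 * s)) / (real (aut \<tau>))\<^sup>2"
  proof (intro tendsto_intros binomial_asymp power_ratio_asymp)
    show "(\<lambda>n. real (n - 1) / real n) \<longlonglongrightarrow> 1" using binomial_asymp[of 1 1] by simp
    show "(\<lambda>n. real (n - 2) / real n) \<longlonglongrightarrow> 1" using binomial_asymp[of 2 1] by simp
    show "(real (aut \<tau>))\<^sup>2 \<noteq> 0" using aut_pos[of \<tau>] by simp
  qed
  moreover have "\<forall>\<^sub>F n in sequentially. real (n - 1) / real n * (real (n - 2) / real n) * (real ((n - 3) choose (s - 1)) * fact (s - 1) / real n ^ (s - 1)) *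
      (real ((n - (s + 2)) choose (s - 1)) * fact (s - 1) / real n ^ (s - 1)) *
      (real (n - 2 * s) ^ (n - 2 * s) / real n ^ (n - 2 * s)) / (real (aut \<tau>))\<^sup>2 = real (n - 1) * real (n - 2) * mean2 n \<tau> / ((real n)\<^sup>2 * real (card (tmaps n)))"
    using eventually_gt_at_top[of "2 * s"]
  proof eventually_elim
    case (elim n)
    have "s > 0" using usize_pos s_def by simp
    \<comment> \<open>Now the denominator is n^n: two powers for the choice of the vertices, s - 1
      for each binomial, the rest for the remaining tree.\<close>
    hence e: "n = 2 + ((s - 1) + (s - 1) + (n - 2 * s))" using elim by simp
    have "real n ^ n = (real n)\<^sup>2 * (real n ^ (s - 1) * real n ^ (s - 1) * real n ^ (n - 2 * s))"
      by (subst (2) e) (simp only: power_add)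
    moreover have "(real n)\<^sup>2 * real (card (tmaps n)) = real n ^ n"
      using card_tmaps[of n] elim by (simp add: power2_eq_square power_Suc[symmetric] del: power_Suc)
    ultimately have nT: "(real n)\<^sup>2 * real (card (tmaps n)) = real n * real n * (real n ^ (s - 1) * real n ^ (s - 1) * real n ^ (n - 2 * s))"
      by (simp add: power2_eq_square)
    have sub: "n - s - s = n - 2 * s" "n - s - 2 = n - (s + 2)" by auto
    have "real (n - 2 * s) ^ (n - 2 * s) = real (n - 2 * s) * real (n - 2 * s) ^ (n - 2 * s - 1)"
      using elim by (simp add: power_eq_if)
    thus ?case unfolding nT mean2_def s_def[symmetric] sub by (simp add: mult_ac power2_eq_square)
  qed
  moreover have "exp (- real (2 * s)) / (real (aut \<tau>))\<^sup>2 = (gw \<tau>)\<^sup>2"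
    by (simp add: gw_def s_def power_divide exp_double[symmetric] exp_minus power_inverse)
  ultimately show ?thesis by (simp add: filterlim_cong)
qed

text \<open>Expanding the square gives a n / n + c n - 2 p a n + p^2 with p =
  \<open>gw \<tau>\<close>. The diagonal part a n / n vanishes, and a n -> p, c n -> p^2 make the
  others cancel.\<close>

lemma shape_count_L2:
  "(\<lambda>n. (\<Sum>f\<in>tmaps n. (real (shape_count n f \<tau>) / real n - gw \<tau>)\<^sup>2) / real (card (tmaps n))) \<longlonglongrightarrow> 0"
proof -
  define a where "a = (\<lambda>n. real (n - 1) * mean1 n \<tau> / (real n * real (card (tmaps n))))"
  define c where "c = (\<lambda>n. real (n - 1) * real (n - 2) * mean2 n \<tau> / ((real n)\<^sup>2 * real (card (tmaps n))))"
  have "(\<lambda>n. a n / real n + c n - 2 * gw \<tau> * a n + (gw \<tau>)\<^sup>2) \<longlonglongrightarrow> 0 + (gw \<tau>)\<^sup>2 - 2 * gw \<tau> * gw \<tau> + (gw \<tau>)\<^sup>2"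
  proof (intro tendsto_intros)
    show "a \<longlonglongrightarrow> gw \<tau>" unfolding a_def by (rule mean1_asymp)
    show "c \<longlonglongrightarrow> (gw \<tau>)\<^sup>2" unfolding c_def by (rule mean2_asymp)
    have "(\<lambda>n. a n * (1 / real n)) \<longlonglongrightarrow> gw \<tau> * 0"
      using mean1_asymp[of \<tau>] lim_1_over_n unfolding a_def by (intro tendsto_intros)
    thus "(\<lambda>n. a n / real n) \<longlonglongrightarrow> 0" by simp
  qed
  moreover have "\<forall>\<^sub>F n in sequentially. a n / real n + c n - 2 * gw \<tau> * a n + (gw \<tau>)\<^sup>2
     = (\<Sum>f\<in>tmaps n. (real (shape_count n f \<tau>) / real n - gw \<tau>)\<^sup>2) / real (card (tmaps n))"
    using eventually_gt_at_top[of 0]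
  proof eventually_elim
    case (elim n)
    have T: "real (card (tmaps n)) > 0" using card_tmaps[of n] elim by simp
    let ?X = "\<lambda>f. real (shape_count n f \<tau>)"
    have "(\<Sum>f\<in>tmaps n. (?X f / real n - gw \<tau>)\<^sup>2) = (\<Sum>f\<in>tmaps n. (?X f)\<^sup>2 / (real n)\<^sup>2 - 2 * gw \<tau> / real n * ?X f + (gw \<tau>)\<^sup>2)"
      by (intro sum.cong refl) (simp add: power2_diff power_divide)
    also have "\<dots> = (\<Sum>f\<in>tmaps n. (?X f)\<^sup>2) / (real n)\<^sup>2 - 2 * gw \<tau> / real n * (\<Sum>f\<in>tmaps n. ?X f) + real (card (tmaps n)) * (gw \<tau>)\<^sup>2"
      by (simp add: sum.distrib sum_subtractf sum_divide_distrib[symmetric] sum_distrib_left[symmetric])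
    finally have eq: "(\<Sum>f\<in>tmaps n. (?X f / real n - gw \<tau>)\<^sup>2) = \<dots>" .
    show ?case unfolding eq unfolding a_def c_def sum_shape_count sum_shape_count_sq
      using T by (simp add: add_divide_distrib diff_divide_distrib power2_eq_square)
  qed
  ultimately show ?thesis by (simp add: filterlim_cong power2_eq_square)
qed

section \<open>Labelled trees as parent maps\<close>

definition edges :: "nat \<Rightarrow> (nat \<Rightarrow> nat) \<Rightarrow> nat set set" where
  "edges n f = (\<lambda>x. {x, f x}) ` {1..<n}"

lemma rooted_tmaps: "f \<in> tmaps n \<Longrightarrow> 0 < n \<Longrightarrow> rooted {..<n} 0 f"
  by unfold_locales auto

lemma tmaps_parent:
  assumes "f \<in> tmaps n" "x \<in> {1..<n}"
  shows "f x < n" "f x \<noteq> x" "x \<in> ch f (f x)"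
proof -
  interpret rooted "{..<n}" 0 f using assms by (intro rooted_tmaps) auto
  show "f x < n" using f_in[of x] assms by auto
  show "f x \<noteq> x" using fixed_imp_root[of x 0] assms by auto
  thus "x \<in> ch f (f x)" by (simp add: ch_def)
qed

lemma connected_in_trans: "connected_in E a b \<Longrightarrow> connected_in E b c \<Longrightarrow> connected_in E a c"
  unfolding connected_in_def by (rule rtranclp_trans)

lemma connected_in_sym: "connected_in E a b \<Longrightarrow> connected_in E b a"
  unfolding connected_in_def
  by (rule sympD[OF symp_rtranclp]) (auto simp: symp_def insert_commute)

lemma connected_in_mono: "E \<subseteq> E' \<Longrightarrow> connected_in E a b \<Longrightarrow> connected_in E' a b"
  unfolding connected_in_def by (rule rtranclp_mono[THEN predicate2D, rotated]) auto

lemma edges_connected: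
  assumes f: "f \<in> tmaps n" and u: "u < n" and v: "v < n"
  shows "connected_in (edges n f) u v"
proof -
  interpret rooted "{..<n}" 0 f using assms by (intro rooted_tmaps) auto
  have "connected_in (edges n f) x 0" if "x < n" for x
  proof -
    have "x \<in> desc f 0" using reach[of x] that by simp
    then obtain k where "(f ^^ k) x = 0" by (auto simp: desc_def)
    thus ?thesis using that
    proof (induction k arbitrary: x)
      case (Suc k)
      show ?case
      proof (cases "x = 0")
        case False
        hence "{x, f x} \<in> edges n f" using Suc.prems by (auto simp: edges_def)
        hence "connected_in (edges n f) x (f x)" by (auto simp: connected_in_def)
        moreover have "connected_in (edges n f) (f x) 0"
          using Suc.IH[of "f x"] Suc.prems f_in[of x] by (simp add: funpow_swap1)
        ultimately show ?thesis by (rule connected_in_trans)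
      qed (simp add: connected_in_def)
    qed (simp add: connected_in_def)
  qed
  thus ?thesis using u v connected_in_sym connected_in_trans by blast
qed

text \<open>Every edge is some {x, f x}. Once it is deleted, no remaining edge leaves the descendant
  set of x, which contains x but not f x.\<close>

lemma edges_labelled_tree:
  assumes f: "f \<in> tmaps n"
  shows "edges n f \<in> labelled_trees n"
  unfolding labelled_trees_def is_labelled_tree_def mem_Collect_eq
proof (intro conjI allI impI)
  show "edges n f \<subseteq> {{i, j} |i j. i < n \<and> j < n \<and> i \<noteq> j}"
  proof
    fix e assume "e \<in> edges n f"
    then obtain x where "x \<in> {1..<n}" "e = {x, f x}" by (auto simp: edges_def)
    thus "e \<in> {{i, j} |i j. i < n \<and> j < n \<and> i \<noteq> j}"
      using tmaps_parent[OF f, of x] by (intro CollectI exI[of _ x] exI[of _ "f x"]) auto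
  qed
  show "connected_in (edges n f) u v" if "u < n" "v < n" for u v by (rule edges_connected[OF f that])
  fix u v assume "{u, v} \<in> edges n f"
  then obtain x where x: "x \<in> {1..<n}" "{u, v} = {x, f x}" by (auto simp: edges_def)
  interpret rooted "{..<n}" 0 f using f x by (intro rooted_tmaps) auto
  have step: "a \<in> desc f x \<longleftrightarrow> b \<in> desc f x" if ab: "{a, b} \<in> edges n f - {{u, v}}" for a b
  proof -
    have "{a, b} \<in> edges n f" using ab by simp
    then obtain y where y: "y \<in> {1..<n}" "{a, b} = {y, f y}" unfolding edges_def by blast
    have "y \<noteq> x"
    proof
      assume "y = x"
      hence "{a, b} = {u, v}" using y(2) x(2) by simp
      thus False using ab by simp
    qed
    have "y \<in> desc f x \<longleftrightarrow> f y \<in> desc f x" using desc_step[of f y x] desc_cases[of y f x] \<open>y \<noteq> x\<close> by blast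
    moreover have "(a = y \<and> b = f y) \<or> (a = f y \<and> b = y)" using y(2) by (auto simp: doubleton_eq_iff)
    ultimately show ?thesis by auto
  qed
  have inv: "a \<in> desc f x \<longleftrightarrow> b \<in> desc f x" if "connected_in (edges n f - {{u, v}}) a b" for a b
    using that unfolding connected_in_def
  proof (induction rule: rtranclp_induct)
    case (step b c)
    thus ?case using \<open>\<And>b a. {a, b} \<in> edges n f - {{u, v}} \<Longrightarrow> (a \<in> desc f x) = (b \<in> desc f x)\<close>[of b c] by simp
  qed simp
  have "f x \<notin> desc f x" using ch_not_desc tmaps_parent(3)[OF f x(1)] by blast
  moreover have "x \<in> desc f x" by (rule self_in_desc)
  moreover have "(u = x \<and> v = f x) \<or> (u = f x \<and> v = x)" using x(2) by (auto simp: doubleton_eq_iff)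
  ultimately have "\<not> (u \<in> desc f x \<longleftrightarrow> v \<in> desc f x)" by auto
  thus "\<not> connected_in (edges n f - {{u, v}}) u v" using inv[of u v] by blast
qed

text \<open>If f and g differ at u, the edge {u, f u} must be the g-edge of f u, so g (f u) = u,
  while f (f u) = u would be a cycle. So the difference climbs along f up to the root, where both
  maps are fixed.\<close>

lemma inj_edges: "inj_on (edges n) (tmaps n)"
proof (rule inj_onI, rule ext, rule ccontr)
  fix f g v assume fg: "f \<in> tmaps n" "g \<in> tmaps n" "edges n f = edges n g" and ne: "f v \<noteq> g v"
  have v: "v \<in> {1..<n}"
  proof (rule ccontr)
    assume "v \<notin> {1..<n}"
    hence "v \<notin> {..<n} - {0}" by auto
    thus False using forestD(2)[OF fg(1), of v] forestD(2)[OF fg(2), of v] ne by simp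
  qed
  interpret rooted "{..<n}" 0 f using fg v by (intro rooted_tmaps) auto
  have step: "f u \<in> {1..<n} \<and> f (f u) \<noteq> g (f u)" if u: "u \<in> {1..<n}" "f u \<noteq> g u" for u
  proof -
    have "{u, f u} \<in> edges n f" using u(1) by (auto simp: edges_def)
    hence "{u, f u} \<in> edges n g" using fg(3) by simp
    then obtain y where y: "y \<in> {1..<n}" "{u, f u} = {y, g y}" by (auto simp: edges_def)
    hence "u = g y \<and> f u = y" using u(2) by (auto simp: doubleton_eq_iff)
    moreover have "f (f u) \<noteq> u"
      using fixed_imp_root[of u 1] u(1) by auto
    ultimately show ?thesis using y(1) by auto
  qed
  have all: "(f ^^ k) v \<in> {1..<n} \<and> f ((f ^^ k) v) \<noteq> g ((f ^^ k) v)" for k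
    by (induction k) (use v ne step in auto)
  obtain k where "(f ^^ k) v = 0" using reach[of v] v by (auto simp: desc_def)
  thus False using all[of k] by simp
qed

text \<open>The parent is a neighbour strictly closer to 0 in graph distance \<open>d\<close>. An
  edge of \<open>E\<close> beyond these would join two vertices already connected without it,
  against acyclicity.\<close>

lemma edges_surj:
  assumes n: "0 < n" and E: "E \<in> labelled_trees n"
  shows "E \<in> edges n ` tmaps n"
proof -
  have E1: "E \<subseteq> {{i, j} |i j. i < n \<and> j < n \<and> i \<noteq> j}" and E2: "\<And>u v. u < n \<Longrightarrow> v < n \<Longrightarrow> connected_in E u v"
    and E3: "\<And>u v. {u, v} \<in> E \<Longrightarrow> \<not> connected_in (E - {{u, v}}) u v"
    using E by (auto simp: labelled_trees_def is_labelled_tree_def)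
  define A where "A = (\<lambda>a b. {a, b} \<in> E)"
  define d where "d = (\<lambda>v. LEAST k. (A ^^ k) v 0)"
  have d: "(A ^^ d v) v 0" if "v < n" for v
  proof -
    have "\<exists>k. (A ^^ k) v 0" using E2[OF that n] by (simp add: connected_in_def A_def rtranclp_power)
    thus ?thesis unfolding d_def by (rule LeastI_ex)
  qed
  have ex: "\<exists>u. {v, u} \<in> E \<and> u < n \<and> d u < d v" if v: "v < n" "v \<noteq> 0" for v
  proof -
    have "d v \<noteq> 0"
    proof
      assume "d v = 0"
      thus False using d[OF v(1)] v(2) by simp
    qed
    then obtain k where k: "d v = Suc k" using not0_implies_Suc by blast
    then obtain u where u: "A v u" "(A ^^ k) u 0" using d[OF v(1)] by (metis relpowp_Suc_D2)
    have "d u \<le> k" unfolding d_def by (rule Least_le[of "\<lambda>k. (A ^^ k) u 0", OF u(2)])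
    moreover have "u < n" using u(1) E1 by (auto simp: A_def doubleton_eq_iff dest!: subsetD)
    ultimately show ?thesis using u(1) k by (auto simp: A_def)
  qed
  define f where "f = (\<lambda>v. if v < n \<and> v \<noteq> 0 then SOME u. {v, u} \<in> E \<and> u < n \<and> d u < d v else v)"
  have f: "{v, f v} \<in> E" "f v < n" "d (f v) < d v" if "v < n" "v \<noteq> 0" for v
    using someI_ex[OF ex[OF that]] that by (auto simp: f_def)
  have fT: "f \<in> tmaps n"
  proof (rule forestI)
    fix x assume "x \<in> {..<n}"
    thus "\<exists>k. (f ^^ k) x \<in> {0}"
    proof (induction "d x" arbitrary: x rule: less_induct)
      case less
      show ?case
      proof (cases "x = 0")
        case False
        then obtain k where "(f ^^ k) (f x) \<in> {0}" using less.hyps[of "f x"] f less.prems by auto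
        hence "(f ^^ Suc k) x \<in> {0}" by (simp add: funpow_swap1)
        thus ?thesis by blast
      qed (auto intro: exI[of _ 0])
    qed
  qed (use f in \<open>auto simp: f_def\<close>)
  have sub: "edges n f \<subseteq> E" using f by (auto simp: edges_def)
  have "E \<subseteq> edges n f"
  proof (rule ccontr)
    assume "\<not> E \<subseteq> edges n f"
    then obtain e where e: "e \<in> E" "e \<notin> edges n f" by auto
    then obtain u v where uv: "e = {u, v}" "u < n" "v < n" using E1 by blast
    have "connected_in (edges n f) u v" by (rule edges_connected[OF fT uv(2,3)])
    moreover have "edges n f \<subseteq> E - {{u, v}}" using sub e uv by auto
    ultimately have "connected_in (E - {{u, v}}) u v" using connected_in_mono by blast
    thus False using E3[of u v] e uv by blast
  qed
  thus ?thesis using sub fT by blast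
qed

lemma bij_edges: "0 < n \<Longrightarrow> bij_betw (edges n) (tmaps n) (labelled_trees n)"
  using inj_edges[of n] edges_labelled_tree[of _ n] edges_surj[of n] by (auto simp: bij_betw_def)

section \<open>The characteristic polynomial of a tree\<close>

text \<open>Triangularity without choosing an order of the vertices: along a permutation with
  nonzero product, \<open>card (desc f i)\<close> never increases and drops at every moved point,
  while its sum is invariant.\<close>

lemma det_ch_pattern:
  fixes M :: "complex mat"
  assumes f: "f \<in> tmaps n" and n: "0 < n" and M: "M \<in> carrier_mat n n"
    and pat: "\<And>i j. i < n \<Longrightarrow> j < n \<Longrightarrow> M $$ (i, j) \<noteq> 0 \<Longrightarrow> i = j \<or> j \<in> ch f i"
  shows "det M = (\<Prod>i<n. M $$ (i, i))"
proof -
  interpret rooted "{..<n}" 0 f by (rule rooted_tmaps[OF f n])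
  have zero: "(\<Prod>i=0..<n. M $$ (i, p i)) = 0" if p: "p permutes {0..<n}" "p \<noteq> id" for p
  proof (rule ccontr)
    assume "(\<Prod>i=0..<n. M $$ (i, p i)) \<noteq> 0"
    hence nz: "M $$ (i, p i) \<noteq> 0" if "i < n" for i using that by (auto simp: prod_zero_iff)
    have c: "i = p i \<or> p i \<in> ch f i" if "i < n" for i
      using pat[OF that _ nz[OF that]] permutes_in_image[OF p(1), of i] that by auto
    have le: "card (desc f (p i)) \<le> card (desc f i)" and lt: "i \<noteq> p i \<Longrightarrow> card (desc f (p i)) < card (desc f i)" if "i < n" for i
      using c[OF that] card_desc_less[of "p i" i] ch_in_desc[of "p i" f i] that by (auto simp: ch_def)
    obtain i where i: "p i \<noteq> i" using p(2) by (auto simp: fun_eq_iff)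
    hence "i < n" using permutes_not_in[OF p(1), of i] by (metis atLeastLessThan_iff zero_le)
    have "(\<Sum>i\<in>{0..<n}. card (desc f (p i))) < (\<Sum>i\<in>{0..<n}. card (desc f i))"
      by (rule sum_strict_mono_ex1) (use le lt[OF \<open>i < n\<close>] i \<open>i < n\<close> in \<open>auto intro!: bexI[of _ i]\<close>)
    moreover have "(\<Sum>i\<in>{0..<n}. card (desc f (p i))) = (\<Sum>i\<in>{0..<n}. card (desc f i))"
      using sum.permute[OF p(1), of "\<lambda>i. card (desc f i)"] by (simp add: o_def)
    ultimately show False by simp
  qed
  have "det M = (\<Sum>p\<in>{p. p permutes {0..<n}}. signof p * (\<Prod>i=0..<n. M $$ (i, p i)))"
    by (rule det_def'[OF M])
  also have "\<dots> = (\<Sum>p\<in>{id}. signof p * (\<Prod>i=0..<n. M $$ (i, p i)))"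
    by (rule sum.mono_neutral_right) (auto simp: finite_permutations permutes_id zero)
  finally show ?thesis by (simp add: atLeast0LessThan)
qed

lemma wt_shape:
  assumes f: "f \<in> tmaps n" and n: "0 < n"
  shows "wt z (shape f v) = - 1 / (z + (\<Sum>c\<in>ch f v. wt z (shape f c)))"
proof -
  interpret rooted "{..<n}" 0 f by (rule rooted_tmaps[OF f n])
  show ?thesis by (subst shape_unfold) (simp add: sum_unfold_sum_mset multiset.map_comp o_def)
qed

lemma edges_iff:
  assumes f: "f \<in> tmaps n" and ij: "i < n" "j < n"
  shows "{i, j} \<in> edges n f \<longleftrightarrow> i \<in> ch f j \<or> j \<in> ch f i" "\<not> (i \<in> ch f j \<and> j \<in> ch f i)"
proof -
  interpret rooted "{..<n}" 0 f using f ij by (intro rooted_tmaps) auto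
  show "\<not> (i \<in> ch f j \<and> j \<in> ch f i)" using ch_not_desc ch_in_desc by blast
  have nz: "x \<in> {1..<n}" if "x \<in> ch f y" for x y using ch_in[OF that] by auto
  show "{i, j} \<in> edges n f \<longleftrightarrow> i \<in> ch f j \<or> j \<in> ch f i"
  proof
    assume "{i, j} \<in> edges n f"
    then obtain x where x: "x \<in> {1..<n}" "{i, j} = {x, f x}" by (auto simp: edges_def)
    thus "i \<in> ch f j \<or> j \<in> ch f i" using tmaps_parent(3)[OF f x(1)] by (auto simp: doubleton_eq_iff)
  next
    assume "i \<in> ch f j \<or> j \<in> ch f i"
    thus "{i, j} \<in> edges n f"
    proof
      assume "i \<in> ch f j"
      thus ?thesis using nz[of i j] unfolding edges_def by (intro image_eqI[of _ _ i]) (auto simp: ch_def)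
    next
      assume "j \<in> ch f i"
      thus ?thesis using nz[of j i] unfolding edges_def by (intro image_eqI[of _ _ j]) (auto simp: ch_def)
    qed
  qed
qed

text \<open>Gaussian elimination from the leaves: \<open>z - A = L D L\<^sup>T\<close> with \<open>L\<close> unipotent and
  \<open>D = diag (- 1 / wt)\<close>.\<close>
lemma char_poly_tree:
  assumes f: "f \<in> tmaps n" and n: "0 < n" and z: "0 < Im z"
  shows "poly (char_poly (adjacency_matrix n (edges n f))) z = (\<Prod>v<n. - 1 / wt z (shape f v))"
proof -
  interpret rooted "{..<n}" 0 f by (rule rooted_tmaps[OF f n])
  define w where "w = (\<lambda>v. wt z (shape f v))"
  define d where "d = (\<lambda>v. - 1 / w v)"
  have w0: "w v \<noteq> 0" for v unfolding w_def by (rule wt_props(3)[OF z])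
  have d_eq: "d v = z + (\<Sum>c\<in>ch f v. w c)" for v
  proof -
    have "w v = - 1 / (z + (\<Sum>c\<in>ch f v. w c))" unfolding w_def by (rule wt_shape[OF f n])
    thus ?thesis by (simp add: d_def)
  qed
  have wd: "w v * d v = - 1" for v using w0[of v] by (simp add: d_def)
  \<comment> \<open>Elimination multipliers: the entry -1 at a child k, with pivot
    \<open>d k = - 1 / w k\<close>, has multiplier \<open>w k\<close>.\<close>
  define l where "l = (\<lambda>i k. of_bool (k = i) + of_bool (k \<in> ch f i) * w k)"
  define L where "L = mat n n (\<lambda>(i, k). l i k)"
  define B where "B = mat n n (\<lambda>(i, k). l i k * d k)"
  let ?A = "adjacency_matrix n (edges n f)"
  have Lc: "L \<in> carrier_mat n n" and Bc: "B \<in> carrier_mat n n" by (auto simp: L_def B_def)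
  have self: "i \<notin> ch f i" for i by (simp add: ch_def)
  have "det L = (\<Prod>i<n. L $$ (i, i))"
    by (rule det_ch_pattern[OF f n Lc]) (auto simp: L_def l_def of_bool_def split: if_splits)
  also have "\<dots> = (\<Prod>i<n. 1)" by (rule prod.cong) (auto simp: L_def l_def self)
  finally have detL: "det L = 1" by simp
  have "det B = (\<Prod>i<n. B $$ (i, i))"
    by (rule det_ch_pattern[OF f n Bc]) (auto simp: B_def l_def of_bool_def split: if_splits)
  also have "\<dots> = (\<Prod>i<n. d i)" by (rule prod.cong) (auto simp: B_def l_def self)
  finally have detB: "det B = (\<Prod>v<n. d v)" .
  \<comment> \<open>Since \<open>w k * d k = - 1\<close>, each child contributes - w k to the
    diagonal, reducing \<open>d i\<close> to z, and -1 next to the diagonal entry's parent-child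
    position. Distinct i and j share no child, so all other entries vanish.\<close>
  have entry: "(\<Sum>k<n. l i k * d k * l j k) = (if i = j then z else 0) - of_bool ({i, j} \<in> edges n f)"
    if ij: "i < n" "j < n" for i j
  proof -
    have disj: "\<not> (k \<in> ch f i \<and> k \<in> ch f j)" if "i \<noteq> j" for k using that by (auto simp: ch_def)
    have "l i k * d k * l j k = of_bool (k = i) * of_bool (i = j) * d i - of_bool (k = i) * of_bool (i \<in> ch f j)
        - of_bool (k = j) * of_bool (j \<in> ch f i) - of_bool (i = j) * (of_bool (k \<in> ch f i) * w k)" for k
    proof -
      have a: "w k * (w k * d k) = - w k" "d k * (w k * w k) = - w k" "d k * w k = -1" 
        using wd[of k] by (simp_all add: mult_ac) (simp add: mult.left_commute[of "d k"])
      show ?thesis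
      proof (cases "i = j")
        case True
        thus ?thesis using self[of i] a by (auto simp: l_def of_bool_def algebra_simps)
      next
        case False
        thus ?thesis using disj[OF False, of k] self[of i] self[of j] a by (auto simp: l_def of_bool_def algebra_simps)
      qed
    qed
    hence "(\<Sum>k<n. l i k * d k * l j k) = (\<Sum>k<n. of_bool (k = i) * (of_bool (i = j) * d i)) - (\<Sum>k<n. of_bool (k = i) * of_bool (i \<in> ch f j))
        - (\<Sum>k<n. of_bool (k = j) * of_bool (j \<in> ch f i)) - of_bool (i = j) * (\<Sum>k<n. of_bool (k \<in> ch f i) * w k)"
      by (simp add: sum_subtractf sum_distrib_left mult.assoc)
    also have "(\<Sum>k<n. of_bool (k \<in> ch f i) * w k) = (\<Sum>k\<in>ch f i. w k)"
    proof -
      have "{..<n} \<inter> ch f i = ch f i" using ch_in by auto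
      thus ?thesis by (simp add: of_bool_def if_distrib[of "\<lambda>x. x * _"] sum.If_cases cong: if_cong)
    qed
    also have "(\<Sum>k<n. of_bool (k = i) * (of_bool (i = j) * d i)) = of_bool (i = j) * d i"
      using ij by (simp add: of_bool_def if_distrib[of "\<lambda>x. x * _"] sum.delta cong: if_cong)
    also have "(\<Sum>k<n. of_bool (k = i) * of_bool (i \<in> ch f j)) = (of_bool (i \<in> ch f j) :: complex)"
      using ij by (simp add: of_bool_def if_distrib[of "\<lambda>x. x * _"] sum.delta cong: if_cong)
    also have "(\<Sum>k<n. of_bool (k = j) * of_bool (j \<in> ch f i)) = (of_bool (j \<in> ch f i) :: complex)"
      using ij by (simp add: of_bool_def if_distrib[of "\<lambda>x. x * _"] sum.delta cong: if_cong)
    finally show ?thesis using edges_iff[OF f ij] d_eq[of i] self[of i] by (auto simp: of_bool_def)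
  qed
  have "poly (char_poly ?A) z = det (B * transpose_mat L)"
    unfolding char_poly_def
  proof (rule poly_det_cong[of _ n])
    show "B * transpose_mat L \<in> carrier_mat n n" using Lc Bc by auto
    show "char_poly_matrix ?A \<in> carrier_mat n n" by (auto simp: adjacency_matrix_def)
    fix i j assume ij: "i < n" "j < n"
    have "(B * transpose_mat L) $$ (i, j) = (\<Sum>k<n. l i k * d k * l j k)"
      using ij by (simp add: B_def L_def scalar_prod_def atLeast0LessThan)
    thus "poly (char_poly_matrix ?A $$ (i, j)) z = (B * transpose_mat L) $$ (i, j)"
      using entry[OF ij] ij by (simp add: char_poly_matrix_def adjacency_matrix_def)
  qed
  also have "\<dots> = det B * det (transpose_mat L)" using Bc Lc by (intro det_mult) auto
  also have "det (transpose_mat L) = 1" using det_transpose[OF Lc] detL by simp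
  finally show ?thesis by (simp add: detB d_def w_def)
qed

section \<open>Logarithmic derivative of the characteristic polynomial\<close>

lemma has_field_derivative_prod_log:
  fixes F :: "'a \<Rightarrow> complex \<Rightarrow> complex"
  assumes "finite S" "\<And>v. v \<in> S \<Longrightarrow> (F v has_field_derivative F' v) (at z)" "\<And>v. v \<in> S \<Longrightarrow> F v z \<noteq> 0"
  shows "((\<lambda>z. \<Prod>v\<in>S. F v z) has_field_derivative ((\<Prod>v\<in>S. F v z) * (\<Sum>v\<in>S. F' v / F v z))) (at z)"
  using assms
proof (induction S rule: finite_induct)
  case (insert x S)
  have "((\<lambda>z. F x z * (\<Prod>v\<in>S. F v z)) has_field_derivative
     (F x z * ((\<Prod>v\<in>S. F v z) * (\<Sum>v\<in>S. F' v / F v z)) + F' x * (\<Prod>v\<in>S. F v z))) (at z)"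
    using insert by (intro derivative_eq_intros) auto
  moreover have "F x z \<noteq> 0" using insert by auto
  ultimately show ?case using insert.hyps by (simp add: algebra_simps)
qed auto

lemma pderiv_prod_list_linear:
  fixes as :: "complex list"
  assumes "poly (\<Prod>a\<leftarrow>as. [:- a, 1:]) z \<noteq> 0"
  shows "poly (pderiv (\<Prod>a\<leftarrow>as. [:- a, 1:])) z = poly (\<Prod>a\<leftarrow>as. [:- a, 1:]) z * (\<Sum>a\<leftarrow>as. 1 / (z - a))"
  using assms
proof (induction as)
  case (Cons a as)
  let ?P = "\<Prod>a\<leftarrow>as. [:- a, 1:]"
  have ne: "z \<noteq> a" "poly ?P z \<noteq> 0" using Cons.prems by (auto simp: algebra_simps)
  have e: "(\<Prod>a\<leftarrow>a # as. [:- a, 1:]) = [:- a, 1:] * ?P" by (simp only: list.map prod_list.Cons)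
  have "poly (pderiv ([:- a, 1:] * ?P)) z = (z - a) * poly (pderiv ?P) z + poly ?P z"
    unfolding pderiv_mult poly_add poly_mult by (simp add: pderiv_pCons)
  also have "\<dots> = (z - a) * poly ?P z * (1 / (z - a) + (\<Sum>a\<leftarrow>as. 1 / (z - a)))"
    using Cons.IH[OF ne(2)] ne(1) by (simp add: distrib_left)
  moreover have "poly ([:- a, 1:] * ?P) z = (z - a) * poly ?P z" by (simp only: poly_mult) simp
  ultimately show ?case unfolding e by (simp only: list.map sum_list.Cons)
qed simp

lemma order_prod_list_linear:
  fixes as :: "complex list"
  shows "order e (\<Prod>a\<leftarrow>as. [:- a, 1:]) = count (mset as) e"
proof (induction as)
  case (Cons a as)
  have nz: "(\<Prod>a\<leftarrow>as. [:- a, 1:]) \<noteq> 0" by (auto simp: prod_list_zero_iff)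
  have "order e [:- a, 1:] = (if a = e then 1 else 0)"
    using order_power_n_n[of a 1] order_0I[of "[:- a, 1:]" e] by auto
  moreover have "[:- a, 1:] * (\<Prod>a\<leftarrow>as. [:- a, 1:]) \<noteq> 0" using nz by (simp only: mult_eq_0_iff) simp
  hence "order e ([:- a, 1:] * (\<Prod>a\<leftarrow>as. [:- a, 1:])) = order e [:- a, 1:] + order e (\<Prod>a\<leftarrow>as. [:- a, 1:])"
    by (rule order_mult)
  ultimately show ?case unfolding list.map prod_list.Cons using Cons.IH by simp
qed simp

lemma stieltjes_eq_log_deriv:
  fixes A :: "complex mat"
  assumes A: "A \<in> carrier_mat n n" and z: "poly (char_poly A) z \<noteq> 0"
  shows "(\<Sum>e\<in>{e. eigenvalue A e}. of_nat (order e (char_poly A)) / (e - z)) = - poly (pderiv (char_poly A)) z / poly (char_poly A) z"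
proof -
  obtain as where as: "char_poly A = (\<Prod>a\<leftarrow>as. [:- a, 1:])" using char_poly_factorized[OF A] by blast
  have "{e. eigenvalue A e} = set as"
    using eigenvalue_root_char_poly[OF A] unfolding as by (auto simp: poly_prod_list prod_list_zero_iff)
  hence "(\<Sum>e\<in>{e. eigenvalue A e}. of_nat (order e (char_poly A)) / (e - z)) = (\<Sum>e\<in>set_mset (mset as). of_nat (count (mset as) e) * (1 / (e - z)))"
    by (simp add: as order_prod_list_linear)
  also have "\<dots> = (\<Sum>e\<in>#mset as. 1 / (e - z))" by (rule sum_mset_count[symmetric]) auto
  also have "\<dots> = (\<Sum>a\<leftarrow>as. 1 / (a - z))" by (induction as) simp_all
  also have "\<dots> = - (\<Sum>a\<leftarrow>as. 1 / (z - a))"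
  proof -
    have "1 / (a - z) = - (1 / (z - a))" for a by (metis minus_diff_eq minus_divide_right)
    thus ?thesis by (induction as) simp_all
  qed
  also have "(\<Sum>a\<leftarrow>as. 1 / (z - a)) = poly (pderiv (char_poly A)) z / poly (char_poly A) z"
    using pderiv_prod_list_linear[of as z] z unfolding as by simp
  finally show ?thesis by simp
qed

text \<open>\<open>char_poly_tree\<close> holds on an open set and can be differentiated there. The
  logarithmic derivative of -1 / W is - W' / W, and its sign cancels the one in
  \<open>stieltjes_eq_log_deriv\<close>.\<close>

lemma m_n_tree:
  assumes f: "f \<in> tmaps n" and n: "0 < n" and z: "0 < Im z"
  shows "m_n n (edges n f) z = (1 / of_nat n) * (\<Sum>v<n. dwt z (shape f v) / wt z (shape f v))"
proof -
  let ?A = "adjacency_matrix n (edges n f)"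
  let ?p = "char_poly ?A"
  have A: "?A \<in> carrier_mat n n" and dim: "dim_row ?A = n" by (auto simp: adjacency_matrix_def)
  have w0: "wtH t u \<noteq> 0" if "0 < Im u" for t u using H_setD(5)[OF wtH_in_H_set that] .
  have p: "poly ?p u = (\<Prod>v<n. - 1 / wtH (shape f v) u)" if "0 < Im u" for u
    using char_poly_tree[OF f n that] that by (simp add: wtH_eq)
  have p0: "poly ?p z \<noteq> 0" using p[OF z] w0[OF z] by (simp add: prod_zero_iff)
  have "((\<lambda>u. \<Prod>v<n. - 1 / wtH (shape f v) u) has_field_derivative
     ((\<Prod>v<n. - 1 / wtH (shape f v) z) * (\<Sum>v<n. (dwt z (shape f v) / (wtH (shape f v) z)\<^sup>2) / (- 1 / wtH (shape f v) z)))) (at z)"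
  proof (rule has_field_derivative_prod_log)
    fix v
    show "- 1 / wtH (shape f v) z \<noteq> 0" using w0[OF z] by simp
    show "((\<lambda>u. - 1 / wtH (shape f v) u) has_field_derivative dwt z (shape f v) / (wtH (shape f v) z)\<^sup>2) (at z)"
      by (rule derivative_eq_intros wtH_has_field_derivative[OF z] refl w0[OF z] | simp add: power2_eq_square)+
  qed simp
  hence "((\<lambda>u. poly ?p u) has_field_derivative
     ((\<Prod>v<n. - 1 / wtH (shape f v) z) * (\<Sum>v<n. (dwt z (shape f v) / (wtH (shape f v) z)\<^sup>2) / (- 1 / wtH (shape f v) z)))) (at z)"
    by (rule has_field_derivative_transform_within_open[OF _ open_upper_half]) (use z p in auto)
  moreover have "((\<lambda>u. poly ?p u) has_field_derivative poly (pderiv ?p) z) (at z)" by (rule poly_DERIV)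
  ultimately have "poly (pderiv ?p) z = poly ?p z * (\<Sum>v<n. (dwt z (shape f v) / (wtH (shape f v) z)\<^sup>2) / (- 1 / wtH (shape f v) z))"
    unfolding p[OF z] by (rule DERIV_unique[rotated])
  also have "(\<Sum>v<n. (dwt z (shape f v) / (wtH (shape f v) z)\<^sup>2) / (- 1 / wtH (shape f v) z)) = - (\<Sum>v<n. dwt z (shape f v) / wt z (shape f v))"
    unfolding sum_negf[symmetric]
    by (intro sum.cong refl) (use w0[OF z] z in \<open>simp add: wtH_eq power2_eq_square field_simps\<close>)
  finally have "- poly (pderiv ?p) z / poly ?p z = (\<Sum>v<n. dwt z (shape f v) / wt z (shape f v))" using p0 by simp
  thus ?thesis unfolding m_n_def esm_stieltjes_def stieltjes_eq_log_deriv[OF A p0] dim by simp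
qed

section \<open>Convergence of the Stieltjes transform\<close>

lemma gw_finite_approx:
  assumes "0 < e"
  obtains F where "finite F" "1 - e < (\<Sum>\<tau>\<in>F. gw \<tau>)"
proof -
  have "((\<lambda>\<tau>. complex_of_real (gw \<tau>)) has_sum 1) UNIV"
    using pmf_has_sum[of "\<lambda>_. 1" 1 gw_pmf] by (simp add: scaleR_conv_of_real)
  hence "\<forall>\<^sub>F F in finite_subsets_at_top UNIV. dist (\<Sum>\<tau>\<in>F. complex_of_real (gw \<tau>)) 1 < e"
    using assms by (simp add: has_sum_def tendsto_iff)
  then obtain F where F: "finite F" "dist (\<Sum>\<tau>\<in>F. complex_of_real (gw \<tau>)) 1 < e"
    by (auto simp: eventually_finite_subsets_at_top)
  have "dist (\<Sum>\<tau>\<in>F. complex_of_real (gw \<tau>)) 1 = cmod (complex_of_real ((\<Sum>\<tau>\<in>F. gw \<tau>) - 1))"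
    by (simp add: dist_norm)
  hence "\<bar>(\<Sum>\<tau>\<in>F. gw \<tau>) - 1\<bar> < e" using F(2) by (simp only: norm_of_real)
  thus ?thesis using that F(1) by force
qed

lemma expectation_restrict_bound:
  fixes g :: "utree \<Rightarrow> complex"
  assumes "finite F" and g: "\<And>\<tau>. cmod (g \<tau>) \<le> b"
  shows "cmod (measure_pmf.expectation gw_pmf g - (\<Sum>\<tau>\<in>F. gw \<tau> *\<^sub>R g \<tau>)) \<le> b * (1 - (\<Sum>\<tau>\<in>F. gw \<tau>))"
proof -
  let ?E = "measure_pmf.expectation gw_pmf"
  have b: "0 \<le> b" using g[of undefined] norm_ge_zero order_trans by blast
  have int: "integrable (measure_pmf gw_pmf) (\<lambda>\<tau>. h \<tau> :: complex)" if "\<And>\<tau>. cmod (h \<tau>) \<le> b" for h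
    by (rule measure_pmf.integrable_const_bound[where B=b]) (use that in auto)
  have "?E (\<lambda>\<tau>. if \<tau> \<in> F then g \<tau> else 0) = (\<Sum>\<tau>\<in>F. gw \<tau> *\<^sub>R g \<tau>)"
    by (subst integral_measure_pmf[OF assms(1)]) (auto split: if_splits intro!: sum.cong)
  hence "?E g - (\<Sum>\<tau>\<in>F. gw \<tau> *\<^sub>R g \<tau>) = ?E (\<lambda>\<tau>. g \<tau> - (if \<tau> \<in> F then g \<tau> else 0))"
    by (subst Bochner_Integration.integral_diff) (auto intro!: int g b)
  also have "cmod \<dots> \<le> ?E (\<lambda>\<tau>. cmod (g \<tau> - (if \<tau> \<in> F then g \<tau> else 0)))" by (rule integral_norm_bound)
  also have "\<dots> \<le> ?E (\<lambda>\<tau>. b - (if \<tau> \<in> F then b else 0))"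
    by (intro integral_mono measure_pmf.integrable_const_bound[where B=b]) (use g b in auto)
  also have "\<dots> = b - ?E (\<lambda>\<tau>. if \<tau> \<in> F then b else 0)"
    by (subst Bochner_Integration.integral_diff) (auto intro!: measure_pmf.integrable_const_bound[where B=b] simp: b)
  also have "?E (\<lambda>\<tau>. if \<tau> \<in> F then b else 0) = (\<Sum>\<tau>\<in>F. gw \<tau> * b)"
    by (subst integral_measure_pmf[OF assms(1)]) (auto split: if_splits intro!: sum.cong)
  also have "b - (\<Sum>\<tau>\<in>F. gw \<tau> * b) = b * (1 - (\<Sum>\<tau>\<in>F. gw \<tau>))"
    unfolding sum_distrib_right[symmetric] by (simp add: right_diff_distrib mult.commute)
  finally show ?thesis .
qed

text \<open>Three errors: the root, the frequencies of shapes in \<open>F\<close>, and the vertices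
  with shape outside \<open>F\<close>. The last are counted by complement, which brings in the
  frequency errors again; hence the factor 2.\<close>

lemma sum_shape_bound:
  fixes g :: "utree \<Rightarrow> complex"
  assumes F: "finite F" and n: "0 < n" and g: "\<And>\<tau>. cmod (g \<tau>) \<le> b"
  shows "cmod ((1 / of_nat n) * (\<Sum>v<n. g (shape f v)) - (\<Sum>\<tau>\<in>F. gw \<tau> *\<^sub>R g \<tau>))
     \<le> b * (1 / real n + 2 * (\<Sum>\<tau>\<in>F. \<bar>real (shape_count n f \<tau>) / real n - gw \<tau>\<bar>) + (1 - (\<Sum>\<tau>\<in>F. gw \<tau>)))"
proof -
  have b: "0 \<le> b" using g[of undefined] norm_ge_zero order_trans by blast
  let ?N = "\<lambda>\<tau>. real (shape_count n f \<tau>)"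
  let ?I = "{v\<in>{1..<n}. shape f v \<in> F}" and ?O = "{v\<in>{1..<n}. shape f v \<notin> F}"
  let ?D = "\<Sum>\<tau>\<in>F. \<bar>?N \<tau> / real n - gw \<tau>\<bar>"
  have split: "{..<n} = insert 0 (?I \<union> ?O)" using n by auto
  have inI: "(\<Sum>v\<in>?I. h (shape f v)) = (\<Sum>\<tau>\<in>F. ?N \<tau> *\<^sub>R h \<tau>)" for h :: "utree \<Rightarrow> complex"
  proof -
    have "(\<Sum>v\<in>?I. h (shape f v)) = (\<Sum>\<tau>\<in>F. \<Sum>v\<in>{v\<in>?I. shape f v = \<tau>}. h (shape f v))"
      using F by (intro sum.group[symmetric]) auto
    also have "\<dots> = (\<Sum>\<tau>\<in>F. ?N \<tau> *\<^sub>R h \<tau>)"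
    proof (rule sum.cong[OF refl])
      fix \<tau> assume "\<tau> \<in> F"
      hence "{v\<in>?I. shape f v = \<tau>} = {v\<in>{1..<n}. shape f v = \<tau>}" by auto
      thus "(\<Sum>v\<in>{v\<in>?I. shape f v = \<tau>}. h (shape f v)) = ?N \<tau> *\<^sub>R h \<tau>"
        by (simp add: shape_count_def scaleR_conv_of_real)
    qed
    finally show ?thesis .
  qed
  have cI: "real (card ?I) = (\<Sum>\<tau>\<in>F. ?N \<tau>)"
  proof -
    have "complex_of_real (real (card ?I)) = complex_of_real (\<Sum>\<tau>\<in>F. ?N \<tau>)"
      using inI[of "\<lambda>_. 1"] by (simp add: scaleR_conv_of_real)
    thus ?thesis by (simp only: of_real_eq_iff)
  qed
  have "card ?I + card ?O = card (?I \<union> ?O)" by (rule card_Un_disjoint[symmetric]) auto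
  also have "?I \<union> ?O = {1..<n}" by auto
  finally have cO: "real (card ?O) \<le> real n - (\<Sum>\<tau>\<in>F. ?N \<tau>)" using cI by simp
  have sumN: "\<bar>(\<Sum>\<tau>\<in>F. ?N \<tau>) / real n - (\<Sum>\<tau>\<in>F. gw \<tau>)\<bar> \<le> ?D"
    unfolding sum_divide_distrib sum_subtractf[symmetric] by (rule sum_abs)
  have "real (card ?O) / real n \<le> (real n - (\<Sum>\<tau>\<in>F. ?N \<tau>)) / real n" using cO by (intro divide_right_mono) auto
  also have "\<dots> = 1 - (\<Sum>\<tau>\<in>F. ?N \<tau>) / real n" using n by (simp add: diff_divide_distrib)
  finally have O: "real (card ?O) / real n \<le> 1 - (\<Sum>\<tau>\<in>F. gw \<tau>) + ?D" using sumN by linarith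
  have "(\<Sum>v<n. g (shape f v)) = g (shape f 0) + ((\<Sum>v\<in>?I. g (shape f v)) + (\<Sum>v\<in>?O. g (shape f v)))"
    unfolding split by (subst sum.insert, simp, simp, subst sum.union_disjoint) auto
  hence eq: "(1 / of_nat n) * (\<Sum>v<n. g (shape f v)) - (\<Sum>\<tau>\<in>F. gw \<tau> *\<^sub>R g \<tau>)
     = (1 / of_nat n) * g (shape f 0) + (\<Sum>\<tau>\<in>F. (?N \<tau> / real n - gw \<tau>) *\<^sub>R g \<tau>) + (1 / of_nat n) * (\<Sum>v\<in>?O. g (shape f v))"
    unfolding inI by (simp add: scaleR_diff_left sum_subtractf algebra_simps sum_divide_distrib scaleR_conv_of_real)
  have "cmod ((1 / of_nat n) * (\<Sum>v<n. g (shape f v)) - (\<Sum>\<tau>\<in>F. gw \<tau> *\<^sub>R g \<tau>)) \<le> b / real n + ?D * b + real (card ?O) / real n * b"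
    unfolding eq
  proof (intro norm_triangle_mono)
    show "cmod ((1 / of_nat n) * g (shape f 0)) \<le> b / real n"
      using g by (simp add: norm_divide divide_right_mono)
    have "cmod (\<Sum>\<tau>\<in>F. (?N \<tau> / real n - gw \<tau>) *\<^sub>R g \<tau>) \<le> (\<Sum>\<tau>\<in>F. \<bar>?N \<tau> / real n - gw \<tau>\<bar> * b)"
      by (rule sum_norm_le) (simp add: g mult_left_mono)
    thus "cmod (\<Sum>\<tau>\<in>F. (?N \<tau> / real n - gw \<tau>) *\<^sub>R g \<tau>) \<le> ?D * b" by (simp add: sum_distrib_right)
    have "cmod (\<Sum>v\<in>?O. g (shape f v)) \<le> real (card ?O) * b"
      by (rule order_trans[OF sum_norm_le[of _ _ "\<lambda>_. b"]]) (auto simp: g)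
    thus "cmod ((1 / of_nat n) * (\<Sum>v\<in>?O. g (shape f v))) \<le> real (card ?O) / real n * b"
      by (simp add: norm_mult norm_divide divide_right_mono)
  qed
  also have "\<dots> \<le> b / real n + ?D * b + (1 - (\<Sum>\<tau>\<in>F. gw \<tau>) + ?D) * b"
    by (rule add_left_mono[OF mult_right_mono[OF O b]])
  also have "\<dots> = b * (1 / real n + 2 * ?D + (1 - (\<Sum>\<tau>\<in>F. gw \<tau>)))"
    by (simp only: distrib_left distrib_right mult_2 mult_2_right) (simp add: mult.commute)
  finally show ?thesis .
qed

lemma shape_count_L1:
  "(\<lambda>n. (\<Sum>f\<in>tmaps n. \<bar>real (shape_count n f \<tau>) / real n - gw \<tau>\<bar>) / real (card (tmaps n))) \<longlonglongrightarrow> 0"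
proof (rule tendsto_sandwich[OF _ _ tendsto_const])
  let ?Y = "\<lambda>n f. real (shape_count n f \<tau>) / real n - gw \<tau>"
  let ?T = "\<lambda>n. real (card (tmaps n))"
  show "\<forall>\<^sub>F n in sequentially. 0 \<le> (\<Sum>f\<in>tmaps n. \<bar>?Y n f\<bar>) / ?T n" by (auto intro!: sum_nonneg)
  show "\<forall>\<^sub>F n in sequentially. (\<Sum>f\<in>tmaps n. \<bar>?Y n f\<bar>) / ?T n \<le> sqrt ((\<Sum>f\<in>tmaps n. (?Y n f)\<^sup>2) / ?T n)"
  proof (rule always_eventually, rule allI, rule real_le_rsqrt)
    fix n
    have "(\<Sum>f\<in>tmaps n. \<bar>?Y n f\<bar> * 1)\<^sup>2 \<le> (\<Sum>f\<in>tmaps n. \<bar>?Y n f\<bar>\<^sup>2) * (\<Sum>f\<in>tmaps n. 1\<^sup>2)"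
      by (rule Cauchy_Schwarz_ineq_sum)
    hence cs: "(\<Sum>f\<in>tmaps n. \<bar>?Y n f\<bar>)\<^sup>2 \<le> (\<Sum>f\<in>tmaps n. (?Y n f)\<^sup>2) * ?T n" by simp
    show "((\<Sum>f\<in>tmaps n. \<bar>?Y n f\<bar>) / ?T n)\<^sup>2 \<le> (\<Sum>f\<in>tmaps n. (?Y n f)\<^sup>2) / ?T n"
    proof (cases "?T n = 0")
      case False
      have "((\<Sum>f\<in>tmaps n. \<bar>?Y n f\<bar>) / ?T n)\<^sup>2 \<le> ((\<Sum>f\<in>tmaps n. (?Y n f)\<^sup>2) * ?T n) / (?T n)\<^sup>2"
        unfolding power_divide by (rule divide_right_mono[OF cs]) simp
      thus ?thesis using False by (simp add: power2_eq_square)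
    qed simp
  qed
  show "(\<lambda>n. sqrt ((\<Sum>f\<in>tmaps n. (?Y n f)\<^sup>2) / ?T n)) \<longlonglongrightarrow> 0"
    using tendsto_real_sqrt[OF shape_count_L2[of \<tau>]] by simp
qed

lemma expectation_uniform_random_tree:
  assumes n: "0 < n"
  shows "measure_pmf.expectation (uniform_random_tree n) (F :: _ \<Rightarrow> real) = (\<Sum>f\<in>tmaps n. F (edges n f)) / real (card (tmaps n))"
proof -
  have "real (card (tmaps n)) > 0" using card_tmaps[OF n] n by simp
  hence ne: "tmaps n \<noteq> {}" by auto
  note bij = bij_edges[OF n]
  have lt: "finite (labelled_trees n)" "labelled_trees n \<noteq> {}"
    using bij_betw_finite[OF bij] finite_tmaps[of n] bij ne by (auto simp: bij_betw_def)
  have "measure_pmf.expectation (uniform_random_tree n) F = sum F (labelled_trees n) / real (card (labelled_trees n))"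
    unfolding uniform_random_tree_def by (rule integral_pmf_of_set[OF lt(2,1)])
  thus ?thesis using sum.reindex_bij_betw[OF bij, of F] bij_betw_same_card[OF bij] by simp
qed

theorem theorem6:
  fixes Q :: "(complex \<Rightarrow> complex) measure"
  assumes "GW_resolvent_fixed_point Q"
  shows "\<exists>R. (X_fixed_point Q R \<and> (\<forall>R'. X_fixed_point Q R' \<longrightarrow> R' = R)) \<and>
             (\<forall>z\<in>\<complex>\<^sub>+.
                (\<lambda>n. measure_pmf.expectation (uniform_random_tree n)
                        (\<lambda>E. cmod (m_n n E z - integral\<^sup>L R (\<lambda>f. f z))))
                \<longlonglongrightarrow> 0)"
proof (intro exI[of _ "spine_law Q"] conjI ballI)
  have Q: "prob_on_H Q" by (rule prob_on_H_Q[OF assms])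
  show R: "X_fixed_point Q (spine_law Q)" by (rule X_fixed_point_spine_law[OF Q])
  show "\<forall>R'. X_fixed_point Q R' \<longrightarrow> R' = spine_law Q" using X_fixed_point_unique[OF Q] by blast
  fix z assume "z \<in> \<complex>\<^sub>+"
  hence z: "0 < Im z" by simp
  define b where "b = 1 / Im z"
  have b: "0 < b" using z by (simp add: b_def)
  define g where "g = (\<lambda>t. dwt z t / wt z t)"
  have g: "cmod (g t) \<le> b" for t unfolding g_def b_def by (rule cmod_dwt_div_wt_le[OF z])
  define c where "c = integral\<^sup>L (spine_law Q) (\<lambda>f. f z)"
  have c: "c = measure_pmf.expectation gw_pmf g"
    unfolding c_def g_def by (rule expectation_dwt_div_wt[OF assms R z, symmetric])
  let ?T = "\<lambda>n. real (card (tmaps n))"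
  let ?L = "\<lambda>n. measure_pmf.expectation (uniform_random_tree n) (\<lambda>E. cmod (m_n n E z - c))"
  have "?L \<longlonglongrightarrow> 0"
  proof (rule LIMSEQ_I)
    fix r :: real assume r: "0 < r"
    \<comment> \<open>The tail bound contributes b * 2 e = r / 2, which leaves room for the terms
      vanishing with n.\<close>
    define e where "e = r / (4 * b)"
    have e: "0 < e" using r b by (simp add: e_def)
    \<comment> \<open>\<open>F\<close> is fixed before n grows, so that convergence of finitely many
      frequencies suffices.\<close>
    obtain F where F: "finite F" "1 - e < (\<Sum>\<tau>\<in>F. gw \<tau>)" by (rule gw_finite_approx[OF e])
    let ?D = "\<lambda>n. \<Sum>\<tau>\<in>F. (\<Sum>f\<in>tmaps n. \<bar>real (shape_count n f \<tau>) / real n - gw \<tau>\<bar>) / ?T n"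
    have bound: "?L n \<le> b * (1 / real n + 2 * ?D n + 2 * e)" if n: "0 < n" for n
    proof -
      have T: "?T n > 0" using card_tmaps[OF n] n by simp
      have pt: "cmod (m_n n (edges n f) z - c) \<le> b * (1 / real n + 2 * (\<Sum>\<tau>\<in>F. \<bar>real (shape_count n f \<tau>) / real n - gw \<tau>\<bar>) + 2 * e)"
        if f: "f \<in> tmaps n" for f
      proof -
        let ?S = "\<Sum>\<tau>\<in>F. gw \<tau> *\<^sub>R g \<tau>"
        have "cmod (m_n n (edges n f) z - c) \<le> cmod (m_n n (edges n f) z - ?S) + cmod (c - ?S)"
          using norm_triangle_ineq4[of "m_n n (edges n f) z - ?S" "c - ?S"] by simp
        also have "\<dots> \<le> b * (1 / real n + 2 * (\<Sum>\<tau>\<in>F. \<bar>real (shape_count n f \<tau>) / real n - gw \<tau>\<bar>) + (1 - (\<Sum>\<tau>\<in>F. gw \<tau>))) + b * (1 - (\<Sum>\<tau>\<in>F. gw \<tau>))"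
        proof (rule add_mono)
          show "cmod (m_n n (edges n f) z - ?S) \<le> b * (1 / real n + 2 * (\<Sum>\<tau>\<in>F. \<bar>real (shape_count n f \<tau>) / real n - gw \<tau>\<bar>) + (1 - (\<Sum>\<tau>\<in>F. gw \<tau>)))"
            unfolding m_n_tree[OF f n z] using sum_shape_bound[OF F(1) n g, where f=f] by (simp only: g_def)
          show "cmod (c - ?S) \<le> b * (1 - (\<Sum>\<tau>\<in>F. gw \<tau>))"
            unfolding c by (rule expectation_restrict_bound[OF F(1) g])
        qed
        also have "\<dots> = b * (1 / real n + 2 * (\<Sum>\<tau>\<in>F. \<bar>real (shape_count n f \<tau>) / real n - gw \<tau>\<bar>) + 2 * (1 - (\<Sum>\<tau>\<in>F. gw \<tau>)))"
          by (simp add: algebra_simps)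
        also have "\<dots> \<le> b * (1 / real n + 2 * (\<Sum>\<tau>\<in>F. \<bar>real (shape_count n f \<tau>) / real n - gw \<tau>\<bar>) + 2 * e)"
          using F(2) b by (intro mult_left_mono add_mono) auto
        finally show ?thesis .
      qed
      have "?L n = (\<Sum>f\<in>tmaps n. cmod (m_n n (edges n f) z - c)) / ?T n"
        by (rule expectation_uniform_random_tree[OF n])
      also have "\<dots> \<le> (\<Sum>f\<in>tmaps n. b * (1 / real n + 2 * (\<Sum>\<tau>\<in>F. \<bar>real (shape_count n f \<tau>) / real n - gw \<tau>\<bar>) + 2 * e)) / ?T n"
        using pt T by (intro divide_right_mono sum_mono) auto
      also have "(\<Sum>f\<in>tmaps n. b * (1 / real n + 2 * (\<Sum>\<tau>\<in>F. \<bar>real (shape_count n f \<tau>) / real n - gw \<tau>\<bar>) + 2 * e))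
         = b * (?T n * (1 / real n) + 2 * (\<Sum>f\<in>tmaps n. \<Sum>\<tau>\<in>F. \<bar>real (shape_count n f \<tau>) / real n - gw \<tau>\<bar>) + ?T n * (2 * e))"
        by (simp add: sum_distrib_left[symmetric] sum.distrib)
      also have "\<dots> / ?T n = b * (1 / real n + 2 * ((\<Sum>f\<in>tmaps n. \<Sum>\<tau>\<in>F. \<bar>real (shape_count n f \<tau>) / real n - gw \<tau>\<bar>) / ?T n) + 2 * e)"
        using T by (simp add: add_divide_distrib distrib_left)
      also have "(\<Sum>f\<in>tmaps n. \<Sum>\<tau>\<in>F. \<bar>real (shape_count n f \<tau>) / real n - gw \<tau>\<bar>) / ?T n = ?D n"
        by (subst sum.swap) (simp add: sum_divide_distrib)
      finally show ?thesis .
    qed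
    have "(\<lambda>n. b * (1 / real n + 2 * ?D n + 2 * e)) \<longlonglongrightarrow> b * (0 + 2 * (\<Sum>\<tau>\<in>F. 0) + 2 * e)"
      by (intro tendsto_intros lim_1_over_n shape_count_L1)
    moreover have "b * (0 + 2 * (\<Sum>\<tau>\<in>F. 0) + 2 * e) < r" using r b by (simp add: e_def)
    ultimately have "\<forall>\<^sub>F n in sequentially. b * (1 / real n + 2 * ?D n + 2 * e) < r" by (rule order_tendstoD(2))
    with eventually_gt_at_top[of 0] have "\<forall>\<^sub>F n in sequentially. norm (?L n - 0) < r"
    proof eventually_elim
      case (elim n)
      have "0 \<le> ?L n" by (rule integral_nonneg_AE) auto
      thus ?case using bound[OF elim(1)] elim(2) by simp
    qed
    thus "\<exists>no. \<forall>n\<ge>no. norm (?L n - 0) < r" by (simp add: eventually_at_top_linorder)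
  qed
  thus "(\<lambda>n. measure_pmf.expectation (uniform_random_tree n)
                        (\<lambda>E. cmod (m_n n E z - integral\<^sup>L (spine_law Q) (\<lambda>f. f z)))) \<longlonglongrightarrow> 0"
    by (simp add: c_def)
qed

end
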